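(* For every natural number $k$ and every sentence $\varphi$: $(LimR)^{(k)}\vdash\varphi$ if and only if $L\Sigma_{1}^{-(k)}\vdash\varphi$.
   Context: $\mathsf{EA}$ is elementary recursive arithmetic (function symbols for all elementary recursive functions, purely universal axioms, quantifier-free induction). The limit existence rule $(LimR)$ is: from $\exists m\forall n\geq m\, h(n+1)\leq h(n)$ infer $\exists m\forall n\geq m\, h(n)=h(m)$, for elementary recursive $h$. Derivability with $k$-nested applications of $(LimR)$ is defined inductively: $(LimR)^{(0)}\vdash\psi$ means $\mathsf{EA}\vdash\psi$; $(LimR)^{(k+1)}$ proves everything provable in $(LimR)^{(k)}$ together with all conclusions $\exists m\forall n\geq m\, h(n)=h(m)$ such that $(LimR)^{(k)}\vdash\exists m\forall n\geq m\, h(n+1)\leq h(n)$, closed under first-order logic over $\mathsf{EA}$. $L\Sigma_{1}^{-(k)}$ is $\mathsf{EA}$ plus the schema $\exists x_1\cdots\exists x_k\,\theta(x_1,\ldots,x_k)\to\exists x_1\cdots\exists x_k\bigwedge_{i=1}^{k}[\exists\vec y\,\theta(x_1,\ldots,x_i,\vec y)\land\forall z<x_i\forall\vec y\,\lnot\theta(x_1,\ldots,x_{i-1},z,\vec y)]$ for all $\Sigma^0_1$ formulas $\theta$ without parameters (i.e., every nonempty parameter-free $\Sigma^0_1$ $k$-ary relation has a least tuple in the lexicographic order on $\mathbb{N}^k$). In particular $L\Sigma_1^{-(0)}=\mathsf{EA}$. *)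

theory Defs
  imports Main
begin

section \<open>The language of elementary recursive arithmetic\<close>

text \<open>
  Function symbols are the definitions of Kalmar elementary functions.  \<open>FComp n f gs\<close> is the
  \<open>n\<close>-ary composition \<open>f (g\<^sub>1 x, ..., g\<^sub>m x)\<close> (the arity is recorded since \<open>gs\<close> may be empty);
  \<open>FSum f\<close> and \<open>FProd f\<close> denote the functions mapping \<open>(y, x)\<close> to the sum and to the product of
  \<open>f (z, x)\<close> over \<open>z < y\<close>, where \<open>x\<close> is a tuple of parameters.
\<close>

datatype efun =
    FZero
  | FSucc
  | FPred
  | FProj nat nat
  | FAdd
  | FMul
  | FMonus
  | FComp nat efun "efun list"
  | FSum efun
  | FProd efun

primrec arity :: "efun \<Rightarrow> nat" where
  "arity FZero = 0"
| "arity FSucc = 1"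
| "arity FPred = 1"
| "arity (FProj n i) = n"
| "arity FAdd = 2"
| "arity FMul = 2"
| "arity FMonus = 2"
| "arity (FComp n f gs) = n"
| "arity (FSum f) = arity f"
| "arity (FProd f) = arity f"

fun wf_fun :: "efun \<Rightarrow> bool" where
  "wf_fun (FProj n i) \<longleftrightarrow> i < n"
| "wf_fun (FComp n f gs) \<longleftrightarrow>
     wf_fun f \<and> arity f = length gs \<and> (\<forall>g \<in> set gs. wf_fun g \<and> arity g = n)"
| "wf_fun (FSum f) \<longleftrightarrow> wf_fun f \<and> 1 \<le> arity f"
| "wf_fun (FProd f) \<longleftrightarrow> wf_fun f \<and> 1 \<le> arity f"
| "wf_fun _ \<longleftrightarrow> True"

text \<open>Variables are de Bruijn indices: \<open>All\<close> binds index \<open>0\<close> of its body.\<close>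

datatype tm =
    Var nat
  | App efun "tm list"

datatype fm =
    Bot
  | Eq tm tm
  | Imp fm fm
  | All fm

abbreviation Neg :: "fm \<Rightarrow> fm" where "Neg \<phi> \<equiv> Imp \<phi> Bot"
abbreviation And :: "fm \<Rightarrow> fm \<Rightarrow> fm" where "And \<phi> \<psi> \<equiv> Neg (Imp \<phi> (Neg \<psi>))"
abbreviation Ex :: "fm \<Rightarrow> fm" where "Ex \<phi> \<equiv> Neg (All (Neg \<phi>))"

primrec Conj :: "fm list \<Rightarrow> fm" where
  "Conj [] = Neg Bot"
| "Conj (\<phi> # \<phi>s) = And \<phi> (Conj \<phi>s)"

abbreviation zero :: tm where "zero \<equiv> App FZero []"
abbreviation succ :: "tm \<Rightarrow> tm" where "succ t \<equiv> App FSucc [t]"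
abbreviation pred :: "tm \<Rightarrow> tm" where "pred t \<equiv> App FPred [t]"
abbreviation plus :: "tm \<Rightarrow> tm \<Rightarrow> tm" where "plus s t \<equiv> App FAdd [s, t]"
abbreviation times :: "tm \<Rightarrow> tm \<Rightarrow> tm" where "times s t \<equiv> App FMul [s, t]"
abbreviation monus :: "tm \<Rightarrow> tm \<Rightarrow> tm" where "monus s t \<equiv> App FMonus [s, t]"

text \<open>The language has no relation symbol besides equality.\<close>

abbreviation Le :: "tm \<Rightarrow> tm \<Rightarrow> fm" where "Le s t \<equiv> Eq (monus s t) zero"
abbreviation Less :: "tm \<Rightarrow> tm \<Rightarrow> fm" where "Less s t \<equiv> Le (succ s) t"

primrec wf_tm :: "tm \<Rightarrow> bool" where
  "wf_tm (Var n) \<longleftrightarrow> True"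
| "wf_tm (App f ts) \<longleftrightarrow> wf_fun f \<and> length ts = arity f \<and> (\<forall>b \<in> set (map wf_tm ts). b)"

primrec wf_fm :: "fm \<Rightarrow> bool" where
  "wf_fm Bot \<longleftrightarrow> True"
| "wf_fm (Eq s t) \<longleftrightarrow> wf_tm s \<and> wf_tm t"
| "wf_fm (Imp \<phi> \<psi>) \<longleftrightarrow> wf_fm \<phi> \<and> wf_fm \<psi>"
| "wf_fm (All \<phi>) \<longleftrightarrow> wf_fm \<phi>"

primrec fv_tm :: "tm \<Rightarrow> nat set" where
  "fv_tm (Var n) = {n}"
| "fv_tm (App f ts) = \<Union> (set (map fv_tm ts))"

primrec fv :: "fm \<Rightarrow> nat set" where
  "fv Bot = {}"
| "fv (Eq s t) = fv_tm s \<union> fv_tm t"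
| "fv (Imp \<phi> \<psi>) = fv \<phi> \<union> fv \<psi>"
| "fv (All \<phi>) = {n. Suc n \<in> fv \<phi>}"

definition sentence :: "fm \<Rightarrow> bool" where
  "sentence \<phi> \<longleftrightarrow> wf_fm \<phi> \<and> fv \<phi> = {}"

text \<open>Simultaneous capture-avoiding substitution.\<close>

primrec subst_tm :: "(nat \<Rightarrow> tm) \<Rightarrow> tm \<Rightarrow> tm" where
  "subst_tm \<sigma> (Var n) = \<sigma> n"
| "subst_tm \<sigma> (App f ts) = App f (map (subst_tm \<sigma>) ts)"

abbreviation lift_tm :: "tm \<Rightarrow> tm" where
  "lift_tm \<equiv> subst_tm (\<lambda>n. Var (Suc n))"

primrec subst :: "(nat \<Rightarrow> tm) \<Rightarrow> fm \<Rightarrow> fm" where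
  "subst \<sigma> Bot = Bot"
| "subst \<sigma> (Eq s t) = Eq (subst_tm \<sigma> s) (subst_tm \<sigma> t)"
| "subst \<sigma> (Imp \<phi> \<psi>) = Imp (subst \<sigma> \<phi>) (subst \<sigma> \<psi>)"
| "subst \<sigma> (All \<phi>) = All (subst (case_nat (Var 0) (\<lambda>n. lift_tm (\<sigma> n))) \<phi>)"

abbreviation lift :: "fm \<Rightarrow> fm" where
  "lift \<equiv> subst (\<lambda>n. Var (Suc n))"

text \<open>\<open>inst t \<phi>\<close> is the instance of \<open>All \<phi>\<close> for the term \<open>t\<close>.\<close>

abbreviation inst :: "tm \<Rightarrow> fm \<Rightarrow> fm" where
  "inst t \<equiv> subst (case_nat t Var)"


section \<open>First-order logic with equality\<close>

text \<open>
  A Hilbert calculus for well-formed formulas.  Generalisation is unrestricted, so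
  non-logical axioms with free variables stand for their universal closures.
\<close>

inductive derives :: "fm set \<Rightarrow> fm \<Rightarrow> bool" (infix "\<turnstile>" 50) for T :: "fm set" where
  Ax: "\<phi> \<in> T \<Longrightarrow> wf_fm \<phi> \<Longrightarrow> T \<turnstile> \<phi>"
| ImpK: "wf_fm \<phi> \<Longrightarrow> wf_fm \<psi> \<Longrightarrow> T \<turnstile> Imp \<phi> (Imp \<psi> \<phi>)"
| ImpS: "wf_fm \<phi> \<Longrightarrow> wf_fm \<psi> \<Longrightarrow> wf_fm \<chi> \<Longrightarrow>
    T \<turnstile> Imp (Imp \<phi> (Imp \<psi> \<chi>)) (Imp (Imp \<phi> \<psi>) (Imp \<phi> \<chi>))"
| DNeg: "wf_fm \<phi> \<Longrightarrow> T \<turnstile> Imp (Neg (Neg \<phi>)) \<phi>"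
| AllE: "wf_fm \<phi> \<Longrightarrow> wf_tm t \<Longrightarrow> T \<turnstile> Imp (All \<phi>) (inst t \<phi>)"
| AllI: "wf_fm \<phi> \<Longrightarrow> wf_fm \<psi> \<Longrightarrow> T \<turnstile> Imp (All (Imp (lift \<phi>) \<psi>)) (Imp \<phi> (All \<psi>))"
| Refl: "wf_tm t \<Longrightarrow> T \<turnstile> Eq t t"
| Leibniz: "wf_tm s \<Longrightarrow> wf_tm t \<Longrightarrow> wf_fm \<phi> \<Longrightarrow> T \<turnstile> Imp (Eq s t) (Imp (inst s \<phi>) (inst t \<phi>))"
| MP: "T \<turnstile> Imp \<phi> \<psi> \<Longrightarrow> T \<turnstile> \<phi> \<Longrightarrow> T \<turnstile> \<psi>"
| Gen: "T \<turnstile> \<phi> \<Longrightarrow> T \<turnstile> All \<phi>"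

lemma derives_mono [mono]: "S \<subseteq> T \<Longrightarrow> S \<turnstile> \<phi> \<longrightarrow> T \<turnstile> \<phi>"
proof
  assume "S \<subseteq> T" "S \<turnstile> \<phi>"
  from this(2,1) show "T \<turnstile> \<phi>"
    by (induction rule: derives.induct) (auto intro: derives.intros)
qed


section \<open>Elementary recursive arithmetic\<close>

inductive_set defining_axioms :: "fm set" where
  "Neg (Eq (succ (Var 0)) zero) \<in> defining_axioms"
| "Eq (pred zero) zero \<in> defining_axioms"
| "Eq (pred (succ (Var 0))) (Var 0) \<in> defining_axioms"
| "i < n \<Longrightarrow> Eq (App (FProj n i) (map Var [0..<n])) (Var i) \<in> defining_axioms"
| "Eq (plus (Var 0) zero) (Var 0) \<in> defining_axioms"
| "Eq (plus (Var 0) (succ (Var 1))) (succ (plus (Var 0) (Var 1))) \<in> defining_axioms"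
| "Eq (times (Var 0) zero) zero \<in> defining_axioms"
| "Eq (times (Var 0) (succ (Var 1))) (plus (times (Var 0) (Var 1)) (Var 0)) \<in> defining_axioms"
| "Eq (monus (Var 0) zero) (Var 0) \<in> defining_axioms"
| "Eq (monus (Var 0) (succ (Var 1))) (pred (monus (Var 0) (Var 1))) \<in> defining_axioms"
| "wf_fun (FComp n f gs) \<Longrightarrow>
     Eq (App (FComp n f gs) (map Var [0..<n])) (App f (map (\<lambda>g. App g (map Var [0..<n])) gs))
       \<in> defining_axioms"
| "wf_fun (FSum f) \<Longrightarrow> xs = map Var [1..<arity f] \<Longrightarrow>
     Eq (App (FSum f) (zero # xs)) zero \<in> defining_axioms"
| "wf_fun (FSum f) \<Longrightarrow> xs = map Var [1..<arity f] \<Longrightarrow>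
     Eq (App (FSum f) (succ (Var 0) # xs))
        (plus (App (FSum f) (Var 0 # xs)) (App f (Var 0 # xs))) \<in> defining_axioms"
| "wf_fun (FProd f) \<Longrightarrow> xs = map Var [1..<arity f] \<Longrightarrow>
     Eq (App (FProd f) (zero # xs)) (succ zero) \<in> defining_axioms"
| "wf_fun (FProd f) \<Longrightarrow> xs = map Var [1..<arity f] \<Longrightarrow>
     Eq (App (FProd f) (succ (Var 0) # xs))
        (times (App (FProd f) (Var 0 # xs)) (App f (Var 0 # xs))) \<in> defining_axioms"

primrec qfree :: "fm \<Rightarrow> bool" where
  "qfree Bot \<longleftrightarrow> True"
| "qfree (Eq s t) \<longleftrightarrow> True"
| "qfree (Imp \<phi> \<psi>) \<longleftrightarrow> qfree \<phi> \<and> qfree \<psi>"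
| "qfree (All \<phi>) \<longleftrightarrow> False"

text \<open>
  Quantifier-free induction is taken as a rule, as in primitive recursive arithmetic: it keeps
  all axioms purely universal (lemma \<open>EA_universal\<close>).  Since bounded search is elementary,
  the induction schema for quantifier-free formulas yields the same theory.  The induction variable is index \<open>0\<close>;
  all other variables are parameters.
\<close>

inductive_set EA :: "fm set" where
  Defining: "\<phi> \<in> defining_axioms \<Longrightarrow> \<phi> \<in> EA"
| Induction: "qfree \<phi> \<Longrightarrow> wf_fm \<phi> \<Longrightarrow> EA \<turnstile> subst (Var(0 := zero)) \<phi> \<Longrightarrow>
    EA \<turnstile> Imp \<phi> (subst (Var(0 := succ (Var 0))) \<phi>) \<Longrightarrow> \<phi> \<in> EA"
  monos derives_mono

lemma EA_universal: "\<phi> \<in> EA \<Longrightarrow> qfree \<phi>"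
  by (induction rule: EA.induct) (auto elim: defining_axioms.cases)


section \<open>The limit rule and the least element schema\<close>

definition lim_premise :: "efun \<Rightarrow> fm" where
  "lim_premise h = Ex (All (Imp (Le (Var 1) (Var 0))
     (Le (App h [succ (Var 0)]) (App h [Var 0]))))"

definition lim_conclusion :: "efun \<Rightarrow> fm" where
  "lim_conclusion h = Ex (All (Imp (Le (Var 1) (Var 0)) (Eq (App h [Var 0]) (App h [Var 1]))))"

text \<open>\<open>LimR k\<close> is the set of theorems derivable with \<open>k\<close>-nested applications of the limit rule.\<close>

primrec LimR :: "nat \<Rightarrow> fm set" where
  "LimR 0 = {\<psi>. EA \<turnstile> \<psi>}"
| "LimR (Suc k) = {\<psi>. LimR k \<union>
      {lim_conclusion h | h. wf_fun h \<and> arity h = 1 \<and> lim_premise h \<in> LimR k} \<turnstile> \<psi>}"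

text \<open>In \<open>All_le\<close> the bound \<open>t\<close> is lifted, so it does not contain the bound variable.\<close>

inductive bounded_fm :: "fm \<Rightarrow> bool" where
  "bounded_fm Bot"
| "bounded_fm (Eq s t)"
| "bounded_fm \<phi> \<Longrightarrow> bounded_fm \<psi> \<Longrightarrow> bounded_fm (Imp \<phi> \<psi>)"
| All_le: "bounded_fm \<phi> \<Longrightarrow> bounded_fm (All (Imp (Le (Var 0) (lift_tm t)) \<phi>))"

inductive Sigma1 :: "fm \<Rightarrow> bool" where
  "bounded_fm \<phi> \<Longrightarrow> Sigma1 \<phi>"
| "Sigma1 \<phi> \<Longrightarrow> Sigma1 (Ex \<phi>)"

text \<open>
  In a formula \<open>\<theta>(x\<^sub>1, ..., x\<^sub>k)\<close> the variable \<open>x\<^sub>j\<close> is index \<open>k - j\<close>, so that \<open>(Ex ^^ k) \<theta>\<close> is its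
  existential closure with outermost variable \<open>x\<^sub>1\<close>.  \<open>subst_tail k i \<theta>\<close> is
  \<open>\<theta>(x\<^sub>1, ..., x\<^sub>i, y)\<close> below the quantifier prefix \<open>x\<^sub>1, ..., x\<^sub>k, y\<close>, and
  \<open>subst_below k i \<theta>\<close> is \<open>\<theta>(x\<^sub>1, ..., x\<^sub>i\<^sub>-\<^sub>1, z, y)\<close> below \<open>x\<^sub>1, ..., x\<^sub>k, z, y\<close>, where \<open>y\<close> is
  a tuple of length \<open>k - i\<close>.
\<close>

definition subst_tail :: "nat \<Rightarrow> nat \<Rightarrow> fm \<Rightarrow> fm" where
  "subst_tail k i = subst (\<lambda>n. if n < k - i then Var n else Var (n + (k - i)))"

definition subst_below :: "nat \<Rightarrow> nat \<Rightarrow> fm \<Rightarrow> fm" where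
  "subst_below k i = subst (\<lambda>n. if n \<le> k - i then Var n else Var (n + (k - i) + 1))"

definition least_tuple_axiom :: "nat \<Rightarrow> fm \<Rightarrow> fm" where
  "least_tuple_axiom k \<theta> = Imp ((Ex ^^ k) \<theta>) ((Ex ^^ k) (Conj (map (\<lambda>i.
      And ((Ex ^^ (k - i)) (subst_tail k i \<theta>))
          (All (Imp (Less (Var 0) (Var (k - i + 1)))
                    ((All ^^ (k - i)) (Neg (subst_below k i \<theta>))))))
    [1..<k + 1])))"

definition LSigma1 :: "nat \<Rightarrow> fm set" where
  "LSigma1 k = EA \<union> {least_tuple_axiom k \<theta> | \<theta>. wf_fm \<theta> \<and> Sigma1 \<theta> \<and> fv \<theta> \<subseteq> {..<k}}"

end

theory Submission
  imports Defs "HOL-Library.Countable"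
begin

text \<open>
  By soundness and completeness it suffices that the two theories have the same models, which is
  shown by induction on \<open>k\<close>.

  Limits give least tuples: let \<open>a\<close> be the least \<open>k\<close>-tuple with \<open>\<exists>y. \<theta>(a, y)\<close>.  At stage \<open>n\<close> the
  bounded search for the least pair \<open>(x, y)\<close> with a witness below \<open>n\<close> eventually finds \<open>x = a\<close>, and from
  then on the \<open>y\<close> found, an elementary function \<open>h(n)\<close>, can only decrease; its limit completes \<open>a\<close> to a
  least \<open>(k + 1)\<close>-tuple.

  Least tuples give limits: in a model \<open>M\<close> of \<open>L\<Sigma>\<^sub>1\<close> for \<open>k + 1\<close>, consider the elements that are
  \<open>\<Sigma>\<^sub>1\<close>-definable from a least \<open>k\<close>-tuple of some \<open>\<Sigma>\<^sub>1\<close> relation.  They form a \<open>\<Sigma>\<^sub>1\<close>-elementary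
  substructure, because least tuples can be amalgamated by adding them componentwise, and it
  is again a model for \<open>k\<close>.  Hence \<open>h\<close> is decreasing there beyond some \<open>m\<close>, definable from a least tuple
  \<open>a\<close> of \<open>\<theta>\<close>, and by elementarity also in \<open>M\<close>.  The least tuple of the relation
  \<open>\<theta>(x) \<and> \<exists>n\<ge>m(x). y = h(n)\<close> then has the limit of \<open>h\<close> as its last component.
\<close>

section \<open>Substitution\<close>

text \<open>The premise of the rule is a theorem, so it speaks about all models of stage
  \<open>k\<close>, and both directions exploit this. A model \<open>M\<close> for
  \<open>k + 1\<close> is itself one for \<open>k\<close>, so \<open>h\<close> decreases in
  \<open>M\<close> from some point on; but that point may be undefinable, and a parameter-free
  schema cannot refer to it. The premise is therefore applied to the hull, where every element is
  definable from a least tuple. Conversely, the \<open>h\<close> extracted from \<theta> has to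
  decrease eventually in every model for \<open>k\<close>, also where \<theta> is empty, hence a
  default value in its definition. Least tuples are amalgamated by sums because concatenation would
  double their length, and \<open>k\<close> must not grow. Addition is strictly monotone in both
  arguments, so the least sum of members of two relations has only one decomposition, and both
  summands can be recovered from it. No pairing function is used: finitely many witnesses are
  controlled by one common bound, which also serves as the stage of the search.\<close>

lemma subst_tm_cong: "(\<And>n. n \<in> fv_tm t \<Longrightarrow> \<sigma> n = \<tau> n) \<Longrightarrow> subst_tm \<sigma> t = subst_tm \<tau> t"
  by (induction t) auto

lemma subst_cong: "(\<And>n. n \<in> fv \<phi> \<Longrightarrow> \<sigma> n = \<tau> n) \<Longrightarrow> subst \<sigma> \<phi> = subst \<tau> \<phi>"
proof (induction \<phi> arbitrary: \<sigma> \<tau>)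
  case (Eq s t)
  then show ?case by (auto intro: subst_tm_cong)
next
  case (Imp \<phi> \<psi>)
  show ?case using Imp.IH(1)[of \<sigma> \<tau>] Imp.IH(2)[of \<sigma> \<tau>] Imp.prems by auto
next
  case (All \<phi>)
  show ?case by (auto intro!: All.IH simp: All.prems split: nat.split)
qed auto

lemma subst_tm_subst_tm: "subst_tm \<sigma> (subst_tm \<tau> t) = subst_tm (\<lambda>n. subst_tm \<sigma> (\<tau> n)) t"
  by (induction t) auto

lemma subst_subst: "subst \<sigma> (subst \<tau> \<phi>) = subst (\<lambda>n. subst_tm \<sigma> (\<tau> n)) \<phi>"
proof (induction \<phi> arbitrary: \<sigma> \<tau>)
  case (All \<phi>)
  show ?case
    by (auto simp: All.IH subst_tm_subst_tm split: nat.split intro!: subst_cong)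
qed (auto simp: subst_tm_subst_tm)

lemma subst_tm_Var: "subst_tm Var t = t"
  by (induction t) (auto simp: map_idI)

lemma subst_Var: "subst Var \<phi> = \<phi>"
proof (induction \<phi>)
  case (All \<phi>)
  have "(case_nat (Var 0) (\<lambda>n. lift_tm (Var n))) = Var" by (auto split: nat.split)
  then show ?case using All by simp
qed (auto simp: subst_tm_Var)

lemma wf_subst_tm: "wf_tm t \<Longrightarrow> (\<And>n. wf_tm (\<sigma> n)) \<Longrightarrow> wf_tm (subst_tm \<sigma> t)"
  by (induction t) auto

lemma wf_subst: "wf_fm \<phi> \<Longrightarrow> (\<And>n. wf_tm (\<sigma> n)) \<Longrightarrow> wf_fm (subst \<sigma> \<phi>)"
  by (induction \<phi> arbitrary: \<sigma>) (auto simp: wf_subst_tm split: nat.split)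

lemma wf_lift_tm: "wf_tm t \<Longrightarrow> wf_tm (lift_tm t)"
  by (rule wf_subst_tm) auto

lemma qfree_subst: "qfree (subst \<sigma> \<phi>) = qfree \<phi>"
  by (induction \<phi>) auto

lemma finite_fv_tm: "finite (fv_tm t)"
  by (induction t) auto

lemma finite_fv: "finite (fv \<phi>)"
proof (induction \<phi>)
  case (All \<phi>)
  have "{n. Suc n \<in> fv \<phi>} = Suc -` fv \<phi>" by auto
  then show ?case using All by (simp add: finite_vimageI)
qed (auto simp: finite_fv_tm)


lemma inst_up: "inst t (subst (case_nat (Var 0) (\<lambda>n. lift_tm (\<sigma> n))) \<phi>) = subst (case_nat t \<sigma>) \<phi>"
  by (auto simp: subst_subst subst_tm_subst_tm subst_tm_Var split: nat.split intro!: subst_cong)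

lemma derives_wf: "T \<turnstile> \<phi> \<Longrightarrow> wf_fm \<phi>"
proof (induction rule: derives.induct)
  case (MP \<phi> \<psi>) then show ?case by simp
qed (auto intro!: wf_subst split: nat.split)

text \<open>Generalising and instantiating index 0 replaces one variable and lowers the others;
  after \<open>n\<close> rounds the first \<open>n\<close> indices have been replaced.\<close>

lemma derives_subst_prefix:
  assumes "\<And>n. wf_tm (\<sigma> n)" "T \<turnstile> \<phi>"
  shows "T \<turnstile> subst (\<lambda>i. if i < n then \<sigma> i else Var (i - n)) \<phi>"
  using assms
proof (induction n arbitrary: \<sigma> \<phi>)
  case 0
  then show ?case by (simp add: subst_Var)
next
  case (Suc n)
  \<comment> \<open>The remaining \<open>n\<close> instantiations replace the first \<open>n\<close>
    indices and lower all others by \<open>n\<close>; the shift protects the variables of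
    \<open>\<sigma> 0\<close> from them.\<close>
  define t where "t = subst_tm (\<lambda>i. Var (i + n)) (\<sigma> 0)"
  have wt: "wf_tm t" using Suc.prems by (simp add: t_def wf_subst_tm)
  have "T \<turnstile> inst t \<phi>"
    using MP[OF AllE Gen] derives_wf Suc.prems(2) wt by blast
  then have "T \<turnstile> subst (\<lambda>i. if i < n then \<sigma> (Suc i) else Var (i - n)) (inst t \<phi>)"
    using Suc.IH[of "\<lambda>i. \<sigma> (Suc i)"] Suc.prems by blast
  moreover have "subst (\<lambda>i. if i < n then \<sigma> (Suc i) else Var (i - n)) (inst t \<phi>)
     = subst (\<lambda>i. if i < Suc n then \<sigma> i else Var (i - Suc n)) \<phi>"
    by (auto simp: subst_subst t_def subst_tm_subst_tm subst_tm_Var split: nat.split intro!: subst_cong)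
  ultimately show ?case by simp
qed

lemma derives_subst:
  assumes "\<And>n. wf_tm (\<sigma> n)" "T \<turnstile> \<phi>"
  shows "T \<turnstile> subst \<sigma> \<phi>"
proof -
  obtain n where n: "fv \<phi> \<subseteq> {..<n}" using finite_fv[of \<phi>] unfolding finite_nat_set_iff_bounded by blast
  have "subst (\<lambda>i. if i < n then \<sigma> i else Var (i - n)) \<phi> = subst \<sigma> \<phi>"
    using n by (intro subst_cong) auto
  then show ?thesis using derives_subst_prefix[of \<sigma> T \<phi> n] assms by simp
qed


section \<open>Structures and soundness\<close>

datatype 'a struct = Struct (carrier: "'a set") (interp: "efun \<Rightarrow> 'a list \<Rightarrow> 'a")

primrec eval :: "'a struct \<Rightarrow> (nat \<Rightarrow> 'a) \<Rightarrow> tm \<Rightarrow> 'a" where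
  "eval M e (Var n) = e n"
| "eval M e (App f ts) = interp M f (map (eval M e) ts)"

primrec sat :: "'a struct \<Rightarrow> (nat \<Rightarrow> 'a) \<Rightarrow> fm \<Rightarrow> bool" where
  "sat M e Bot \<longleftrightarrow> False"
| "sat M e (Eq s t) \<longleftrightarrow> eval M e s = eval M e t"
| "sat M e (Imp \<phi> \<psi>) \<longleftrightarrow> (sat M e \<phi> \<longrightarrow> sat M e \<psi>)"
| "sat M e (All \<phi>) \<longleftrightarrow> (\<forall>x\<in>carrier M. sat M (case_nat x e) \<phi>)"

definition wf_struct :: "'a struct \<Rightarrow> bool" where
  "wf_struct M \<longleftrightarrow> carrier M \<noteq> {} \<and>
    (\<forall>f xs. wf_fun f \<longrightarrow> length xs = arity f \<longrightarrow> set xs \<subseteq> carrier M \<longrightarrow> interp M f xs \<in> carrier M)"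

definition env :: "'a struct \<Rightarrow> (nat \<Rightarrow> 'a) set" where
  "env M = {e. range e \<subseteq> carrier M}"

definition models :: "'a struct \<Rightarrow> fm set \<Rightarrow> bool" where
  "models M T \<longleftrightarrow> wf_struct M \<and> (\<forall>\<phi>\<in>T. wf_fm \<phi> \<longrightarrow> (\<forall>e\<in>env M. sat M e \<phi>))"

lemma all_nat_split: "(\<forall>n. P n) \<longleftrightarrow> P 0 \<and> (\<forall>n. P (Suc n))"
  by (metis not0_implies_Suc)

lemma env_case_nat [simp]: "case_nat x e \<in> env M \<longleftrightarrow> x \<in> carrier M \<and> e \<in> env M"
  by (simp add: env_def image_subset_iff) (subst all_nat_split, simp)

lemma env_carrier: "e \<in> env M \<Longrightarrow> e n \<in> carrier M"
  by (auto simp: env_def)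

lemma env_upd: "e \<in> env M \<Longrightarrow> x \<in> carrier M \<Longrightarrow> e(n := x) \<in> env M"
  by (auto simp: env_def)

lemma models_mono: "models M T \<Longrightarrow> S \<subseteq> T \<Longrightarrow> models M S"
  by (auto simp: models_def)

lemma eval_carrier: "wf_struct M \<Longrightarrow> e \<in> env M \<Longrightarrow> wf_tm t \<Longrightarrow> eval M e t \<in> carrier M"
proof (induction t)
  case (App f ts)
  then have "set (map (eval M e) ts) \<subseteq> carrier M" by auto
  then show ?case using App.prems unfolding wf_struct_def by simp
qed (auto simp: env_def)

lemma eval_subst_tm: "eval M e (subst_tm \<sigma> t) = eval M (\<lambda>n. eval M e (\<sigma> n)) t"
  by (induction t) (auto simp: comp_def cong: map_cong)

lemma sat_subst: "sat M e (subst \<sigma> \<phi>) \<longleftrightarrow> sat M (\<lambda>n. eval M e (\<sigma> n)) \<phi>"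
proof (induction \<phi> arbitrary: e \<sigma>)
  case (All \<phi>)
  have "(\<lambda>n. eval M (case_nat x e) (case_nat (Var 0) (\<lambda>n. lift_tm (\<sigma> n)) n))
      = case_nat x (\<lambda>n. eval M e (\<sigma> n))" for x
    by (auto simp: eval_subst_tm split: nat.split)
  then show ?case by (simp add: All)
qed (auto simp: eval_subst_tm)

lemma eval_cong: "(\<And>n. n \<in> fv_tm t \<Longrightarrow> e n = e' n) \<Longrightarrow> eval M e t = eval M e' t"
proof (induction t)
  case (App f ts)
  then have "map (eval M e) ts = map (eval M e') ts" by auto
  then show ?case by (simp only: eval.simps)
qed auto

lemma sat_cong: "(\<And>n. n \<in> fv \<phi> \<Longrightarrow> e n = e' n) \<Longrightarrow> sat M e \<phi> \<longleftrightarrow> sat M e' \<phi>"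
proof (induction \<phi> arbitrary: e e')
  case (Eq s t)
  then show ?case using eval_cong[of s e e' M] eval_cong[of t e e' M] by auto
next
  case (Imp \<phi> \<psi>)
  show ?case using Imp.IH(1)[of e e'] Imp.IH(2)[of e e'] Imp.prems by auto
next
  case (All \<phi>)
  have "sat M (case_nat x e) \<phi> \<longleftrightarrow> sat M (case_nat x e') \<phi>" for x
    by (rule All.IH) (auto simp: All.prems split: nat.split)
  then show ?case by simp
qed auto

lemma sat_inst: "sat M e (inst t \<phi>) \<longleftrightarrow> sat M (case_nat (eval M e t) e) \<phi>"
proof -
  have "(\<lambda>n. eval M e (case_nat t Var n)) = case_nat (eval M e t) e"
    by (auto split: nat.split)
  then show ?thesis by (simp add: sat_subst)
qed

lemma soundness: "T \<turnstile> \<phi> \<Longrightarrow> models M T \<Longrightarrow> e \<in> env M \<Longrightarrow> sat M e \<phi>"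
proof (induction arbitrary: e rule: derives.induct)
  case (Ax \<phi>)
  then show ?case by (auto simp: models_def)
next
  case (AllE \<phi> t)
  then show ?case by (auto simp: sat_inst models_def eval_carrier)
next
  case (AllI \<phi> \<psi>)
  then show ?case by (auto simp: sat_subst)
next
  case (Leibniz s t \<phi>)
  then show ?case by (auto simp: sat_inst)
qed auto


section \<open>Completeness\<close>

declare derives_mono [mono del]

text \<open>Local consequence: generalisation is not applied to the assumptions in \<open>\<Gamma>\<close>.\<close>

inductive loc :: "fm set \<Rightarrow> fm set \<Rightarrow> fm \<Rightarrow> bool" for T \<Gamma> where
  loc_thm: "T \<turnstile> \<phi> \<Longrightarrow> loc T \<Gamma> \<phi>"
| loc_ass: "\<phi> \<in> \<Gamma> \<Longrightarrow> wf_fm \<phi> \<Longrightarrow> loc T \<Gamma> \<phi>"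
| loc_mp: "loc T \<Gamma> (Imp \<phi> \<psi>) \<Longrightarrow> loc T \<Gamma> \<phi> \<Longrightarrow> loc T \<Gamma> \<psi>"

lemma loc_wf: "loc T \<Gamma> \<phi> \<Longrightarrow> wf_fm \<phi>"
  by (induction rule: loc.induct) (auto simp: derives_wf)

lemma loc_empty: "loc T {} \<phi> \<longleftrightarrow> T \<turnstile> \<phi>"
proof
  show "loc T {} \<phi> \<Longrightarrow> T \<turnstile> \<phi>"
    by (induction rule: loc.induct) (auto intro: MP)
qed (rule loc_thm)

lemma loc_mono: "loc T \<Gamma> \<phi> \<Longrightarrow> \<Gamma> \<subseteq> \<Delta> \<Longrightarrow> loc T \<Delta> \<phi>"
  by (induction rule: loc.induct) (auto intro: loc.intros)

lemma loc_finite: "loc T \<Gamma> \<phi> \<Longrightarrow> \<exists>\<Delta>. finite \<Delta> \<and> \<Delta> \<subseteq> \<Gamma> \<and> loc T \<Delta> \<phi>"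
proof (induction rule: loc.induct)
  case (loc_thm \<phi>)
  then show ?case by (auto intro!: exI[of _ "{}"] loc.loc_thm)
next
  case (loc_ass \<phi>)
  then show ?case by (auto intro!: exI[of _ "{\<phi>}"] loc.loc_ass)
next
  case (loc_mp \<phi> \<psi>)
  then obtain \<Delta> \<Delta>' where "finite \<Delta>" "\<Delta> \<subseteq> \<Gamma>" "loc T \<Delta> (Imp \<phi> \<psi>)"
    "finite \<Delta>'" "\<Delta>' \<subseteq> \<Gamma>" "loc T \<Delta>' \<phi>" by blast
  then have "finite (\<Delta> \<union> \<Delta>')" "\<Delta> \<union> \<Delta>' \<subseteq> \<Gamma>" "loc T (\<Delta> \<union> \<Delta>') \<psi>"
    using loc.loc_mp[OF loc_mono loc_mono] by (blast+)
  then show ?case by blast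
qed

lemma loc_K: "loc T \<Gamma> \<psi> \<Longrightarrow> wf_fm \<phi> \<Longrightarrow> loc T \<Gamma> (Imp \<phi> \<psi>)"
  using loc_mp[OF loc_thm[OF ImpK]] loc_wf by blast

lemma loc_S: "loc T \<Gamma> (Imp \<phi> (Imp \<psi> \<chi>)) \<Longrightarrow> loc T \<Gamma> (Imp \<phi> \<psi>) \<Longrightarrow> loc T \<Gamma> (Imp \<phi> \<chi>)"
proof -
  assume 1: "loc T \<Gamma> (Imp \<phi> (Imp \<psi> \<chi>))" and 2: "loc T \<Gamma> (Imp \<phi> \<psi>)"
  have "T \<turnstile> Imp (Imp \<phi> (Imp \<psi> \<chi>)) (Imp (Imp \<phi> \<psi>) (Imp \<phi> \<chi>))"
    using loc_wf[OF 1] by (simp add: ImpS)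
  from loc_mp[OF loc_mp[OF loc_thm[OF this] 1] 2] show ?thesis .
qed

lemma loc_I: assumes "wf_fm \<phi>" shows "loc T \<Gamma> (Imp \<phi> \<phi>)"
  by (rule loc_S[where \<psi> = "Imp \<phi> \<phi>"]; rule loc_thm; rule ImpK) (use assms in simp_all)

text \<open>\<open>loc\<close> has no generalisation rule, so the usual argument with K, S and
  identity is complete.\<close>

lemma deduction: "loc T (insert \<alpha> \<Gamma>) \<phi> \<Longrightarrow> wf_fm \<alpha> \<Longrightarrow> loc T \<Gamma> (Imp \<alpha> \<phi>)"
proof (induction rule: loc.induct)
  case (loc_thm \<phi>)
  then show ?case using loc_K loc.loc_thm by blast
next
  case (loc_ass \<phi>)
  then show ?case by (auto intro: loc_K loc.loc_ass loc_I)
next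
  case (loc_mp \<phi> \<psi>)
  then show ?case using loc_S by blast
qed

lemma loc_insert: "loc T \<Gamma> (Imp \<alpha> \<phi>) \<Longrightarrow> loc T (insert \<alpha> \<Gamma>) \<phi>"
proof -
  assume *: "loc T \<Gamma> (Imp \<alpha> \<phi>)"
  then show ?thesis
    using loc_mp[OF loc_mono[OF *] loc_ass, of "insert \<alpha> \<Gamma>"] loc_wf[OF *] by auto
qed

lemma loc_DNeg: "loc T \<Gamma> (Neg (Neg \<phi>)) \<Longrightarrow> loc T \<Gamma> \<phi>"
proof -
  assume *: "loc T \<Gamma> (Neg (Neg \<phi>))"
  then have "T \<turnstile> Imp (Neg (Neg \<phi>)) \<phi>" using loc_wf[OF *] by (simp add: DNeg)
  from loc_mp[OF loc_thm[OF this] *] show ?thesis .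
qed

lemma loc_ccontr: "loc T (insert (Neg \<phi>) \<Gamma>) Bot \<Longrightarrow> wf_fm \<phi> \<Longrightarrow> loc T \<Gamma> \<phi>"
  using deduction[of T "Neg \<phi>" \<Gamma> Bot] loc_DNeg by auto

lemma loc_Bot: "loc T \<Gamma> Bot \<Longrightarrow> wf_fm \<phi> \<Longrightarrow> loc T \<Gamma> \<phi>"
  by (rule loc_ccontr[OF loc_mono]) auto

lemma loc_subst:
  assumes "\<And>n. wf_tm (\<sigma> n)"
  shows "loc T \<Gamma> \<phi> \<Longrightarrow> loc T (subst \<sigma> ` \<Gamma>) (subst \<sigma> \<phi>)"
proof (induction rule: loc.induct)
  case (loc_thm \<phi>)
  then show ?case using assms by (auto intro: loc.loc_thm derives_subst)
next
  case (loc_ass \<phi>)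
  then show ?case using assms by (auto intro!: loc.loc_ass wf_subst)
next
  case (loc_mp \<phi> \<psi>)
  then show ?case
    using loc.loc_mp[of T "subst \<sigma> ` \<Gamma>" "subst \<sigma> \<phi>" "subst \<sigma> \<psi>"] by simp
qed

text \<open>The finitely many assumptions are turned one by one into antecedents, generalised over
  there, and brought back by \<open>AllI\<close>, whose antecedent occurs lifted.\<close>

lemma loc_gen: "finite \<Gamma> \<Longrightarrow> loc T (lift ` \<Gamma>) \<psi> \<Longrightarrow> \<forall>\<gamma>\<in>\<Gamma>. wf_fm \<gamma> \<Longrightarrow> loc T \<Gamma> (All \<psi>)"
proof (induction arbitrary: \<psi> rule: finite_induct)
  case empty
  then show ?case by (simp add: loc_empty Gen)
next
  case (insert \<alpha> \<Gamma>)
  then have "loc T (lift ` \<Gamma>) (Imp (lift \<alpha>) \<psi>)"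
    using deduction[of T "lift \<alpha>" "lift ` \<Gamma>" \<psi>] by (simp add: wf_subst)
  then have "loc T \<Gamma> (All (Imp (lift \<alpha>) \<psi>))" using insert by blast
  moreover have "wf_fm \<psi>" using insert.prems loc_wf by blast
  ultimately have "loc T \<Gamma> (Imp \<alpha> (All \<psi>))"
    using loc_mp[OF loc_thm[OF AllI]] insert.prems(2) by blast
  then show ?case by (rule loc_insert)
qed

lemma loc_fresh:
  assumes "finite \<Gamma>" "\<forall>\<gamma>\<in>\<Gamma>. wf_fm \<gamma>" "loc T \<Gamma> (inst (Var y) \<psi>)"
    "\<forall>\<gamma>\<in>\<Gamma>. y \<notin> fv \<gamma>" "y \<notin> fv (All \<psi>)"
  shows "loc T \<Gamma> (All \<psi>)"
proof (rule loc_gen[OF assms(1) _ assms(2)])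
  \<comment> \<open>Renames \<open>y\<close> to index 0 and shifts everything else: on the
    assumptions this is \<open>lift\<close>, and on the instance at \<open>y\<close> it restores
    \<psi>.\<close>
  define \<sigma> where "\<sigma> = (\<lambda>n. if n = y then Var 0 else Var (Suc n))"
  have "loc T (subst \<sigma> ` \<Gamma>) (subst \<sigma> (inst (Var y) \<psi>))"
    using assms(3) by (auto intro!: loc_subst simp: \<sigma>_def)
  moreover have "subst \<sigma> ` \<Gamma> = lift ` \<Gamma>"
    using assms(4) by (intro image_cong refl subst_cong) (auto simp: \<sigma>_def)
  moreover have "subst \<sigma> (inst (Var y) \<psi>) = subst Var \<psi>"
    unfolding subst_subst using assms(5)
    by (intro subst_cong) (auto simp: \<sigma>_def split: nat.split)
  ultimately show "loc T (lift ` \<Gamma>) \<psi>" by (simp add: subst_Var)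
qed

text \<open>A refuted Henkin axiom makes the instance at \<open>y\<close> derivable, freshness
  generalises it, and then the axiom itself is derivable. Variables act as witnesses, so the
  language stays the same.\<close>

lemma henkin_step:
  assumes "finite \<Gamma>" "\<forall>\<gamma>\<in>\<Gamma>. wf_fm \<gamma>" "wf_fm \<psi>" "\<forall>\<gamma>\<in>\<Gamma>. y \<notin> fv \<gamma>" "y \<notin> fv (All \<psi>)"
    "loc T (insert (Imp (inst (Var y) \<psi>) (All \<psi>)) \<Gamma>) Bot"
  shows "loc T \<Gamma> Bot"
proof -
  let ?A = "inst (Var y) \<psi>" and ?B = "All \<psi>"
  have wA: "wf_fm ?A" using assms(3) by (auto intro!: wf_subst split: nat.split)
  have N: "loc T \<Gamma> (Neg (Imp ?A ?B))"
    using deduction[OF assms(6)] wA assms(3) by simp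
  have "loc T (insert (Neg ?A) \<Gamma>) (Imp ?A ?B)"
    using wA assms(3)
    by (auto intro!: deduction[OF loc_Bot[OF loc_mp[OF loc_ass[of "Neg ?A"] loc_ass[of ?A]]]])
  then have "loc T (insert (Neg ?A) \<Gamma>) Bot"
    using loc_mp[OF loc_mono[OF N]] by blast
  then have "loc T \<Gamma> ?A" using loc_ccontr wA by blast
  then have "loc T \<Gamma> ?B" using loc_fresh assms by blast
  then have "loc T \<Gamma> (Imp ?A ?B)" using loc_K wA by blast
  then show ?thesis using N loc_mp by blast
qed

section \<open>Enumeration of the formulas and the Henkin chain\<close>

instance efun :: countable by countable_datatype
instance tm :: countable by countable_datatype
instance fm :: countable by countable_datatype

definition fresh :: "fm set \<Rightarrow> fm \<Rightarrow> nat" where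
  "fresh \<Gamma> \<psi> = (SOME y. (\<forall>\<gamma>\<in>\<Gamma>. y \<notin> fv \<gamma>) \<and> y \<notin> fv (All \<psi>))"

lemma fresh: "finite \<Gamma> \<Longrightarrow> (\<forall>\<gamma>\<in>\<Gamma>. fresh \<Gamma> \<psi> \<notin> fv \<gamma>) \<and> fresh \<Gamma> \<psi> \<notin> fv (All \<psi>)"
proof -
  assume "finite \<Gamma>"
  then have "finite (\<Union> (fv ` insert (All \<psi>) \<Gamma>))"
    using finite_fv by blast
  then obtain y where "y \<notin> \<Union> (fv ` insert (All \<psi>) \<Gamma>)"
    by (metis ex_new_if_finite infinite_UNIV_nat)
  then show ?thesis unfolding fresh_def by (intro someI_ex[of "\<lambda>y. _ y \<and> _ y"] exI[of _ y]) auto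
qed

definition add_cons :: "fm set \<Rightarrow> fm \<Rightarrow> fm set \<Rightarrow> fm set" where
  "add_cons T \<psi> \<Gamma> = (if loc T (insert \<psi> \<Gamma>) Bot then \<Gamma> else insert \<psi> \<Gamma>)"

definition add_henkin :: "fm \<Rightarrow> fm set \<Rightarrow> fm set" where
  "add_henkin \<psi> \<Gamma> = insert (Imp (inst (Var (fresh \<Gamma> \<psi>)) \<psi>) (All \<psi>)) \<Gamma>"

text \<open>The formula with number \<open>n\<close> is used twice: it is added if consistent, and,
  as the body of a universal formula, it receives its Henkin axiom. Stages stay finite, so a fresh
  variable is always at hand.\<close>

primrec chain :: "fm set \<Rightarrow> fm \<Rightarrow> nat \<Rightarrow> fm set" where
  "chain T \<phi> 0 = {\<phi>}"
| "chain T \<phi> (Suc n) = (if wf_fm (from_nat n)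
     then add_henkin (from_nat n) (add_cons T (from_nat n) (chain T \<phi> n)) else chain T \<phi> n)"

lemma chain_mono: "m \<le> n \<Longrightarrow> chain T \<phi> m \<subseteq> chain T \<phi> n"
  by (rule lift_Suc_mono_le) (auto simp: add_henkin_def add_cons_def)

lemma chain_cons:
  assumes "wf_fm \<phi>" "\<not> loc T {\<phi>} Bot"
  shows "finite (chain T \<phi> n) \<and> (\<forall>\<gamma>\<in>chain T \<phi> n. wf_fm \<gamma>) \<and> \<not> loc T (chain T \<phi> n) Bot"
proof (induction n)
  case (Suc n)
  show ?case
  proof (cases "wf_fm (from_nat n)")
    case True
    let ?\<Delta> = "add_cons T (from_nat n) (chain T \<phi> n)"
    have \<Delta>: "finite ?\<Delta>" "\<forall>\<gamma>\<in>?\<Delta>. wf_fm \<gamma>" "\<not> loc T ?\<Delta> Bot"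
      using Suc True by (auto simp: add_cons_def)
    then have "\<not> loc T (add_henkin (from_nat n) ?\<Delta>) Bot"
      unfolding add_henkin_def using henkin_step True fresh by blast
    then show ?thesis using \<Delta> True
      by (auto simp: add_henkin_def intro!: wf_subst split: nat.split)
  qed (use Suc in simp)
qed (use assms in auto)

definition henkin_set :: "fm set \<Rightarrow> fm \<Rightarrow> fm set" where
  "henkin_set T \<phi> = (\<Union>n. chain T \<phi> n)"

section \<open>Consistency, completeness and Henkin property of the union of the chain\<close>

context
  fixes T :: "fm set" and \<phi>\<^sub>0 :: fm and U :: "fm \<Rightarrow> bool"
  assumes wf0: "wf_fm \<phi>\<^sub>0" and cons0: "\<not> loc T {\<phi>\<^sub>0} Bot"
  defines "U \<equiv> loc T (henkin_set T \<phi>\<^sub>0)"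
begin

lemma U_chain: "loc T (chain T \<phi>\<^sub>0 n) \<psi> \<Longrightarrow> U \<psi>"
  unfolding U_def henkin_set_def by (erule loc_mono) auto

lemma U_cons: "\<not> U Bot"
proof
  assume "U Bot"
  then have "loc T (henkin_set T \<phi>\<^sub>0) Bot" by (simp only: U_def)
  from loc_finite[OF this] obtain \<Delta> where
    \<Delta>: "finite \<Delta>" "\<Delta> \<subseteq> henkin_set T \<phi>\<^sub>0" "loc T \<Delta> Bot" by blast
  \<comment> \<open>A refutation uses finitely many members, and these all occur in one
    stage.\<close>
  from \<Delta>(1,2) have "\<exists>n. \<Delta> \<subseteq> chain T \<phi>\<^sub>0 n"
  proof (induction rule: finite_induct)
    case (insert x F)
    then obtain n m where "F \<subseteq> chain T \<phi>\<^sub>0 n" "x \<in> chain T \<phi>\<^sub>0 m"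
      by (auto simp: henkin_set_def)
    then have "insert x F \<subseteq> chain T \<phi>\<^sub>0 (max n m)"
      using chain_mono[of n "max n m" T \<phi>\<^sub>0] chain_mono[of m "max n m" T \<phi>\<^sub>0] by auto
    then show ?case by blast
  qed auto
  then obtain n where "\<Delta> \<subseteq> chain T \<phi>\<^sub>0 n" ..
  from loc_mono[OF \<Delta>(3) this] show False using chain_cons[OF wf0 cons0, of n] by simp
qed

lemma U_wf: "U \<psi> \<Longrightarrow> wf_fm \<psi>"
  unfolding U_def by (rule loc_wf)

lemma U_thm: "T \<turnstile> \<psi> \<Longrightarrow> U \<psi>"
  unfolding U_def by (rule loc_thm)

lemma U_mp: "U (Imp \<psi> \<chi>) \<Longrightarrow> U \<psi> \<Longrightarrow> U \<chi>"
  unfolding U_def by (rule loc_mp)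

lemma U_start: "U \<phi>\<^sub>0"
  by (rule U_chain[of 0]) (simp add: loc_ass wf0)

lemma U_complete: assumes "wf_fm \<psi>" "\<not> U \<psi>" shows "U (Neg \<psi>)"
proof -
  obtain n where n: "from_nat n = \<psi>" using surj_from_nat by (metis surj_def)
  \<comment> \<open>An underivable formula cannot have been accepted at its own stage, so it was
    inconsistent with that stage.\<close>
  have "\<psi> \<notin> chain T \<phi>\<^sub>0 (Suc n)" using U_chain[of "Suc n" \<psi>] loc_ass assms by blast
  then have "loc T (insert \<psi> (chain T \<phi>\<^sub>0 n)) Bot"
    using n assms by (auto simp: add_cons_def add_henkin_def split: if_splits)
  then show ?thesis using deduction assms U_chain by blast
qed

lemma U_Imp: assumes "wf_fm \<psi>" "wf_fm \<chi>" shows "U (Imp \<psi> \<chi>) \<longleftrightarrow> (U \<psi> \<longrightarrow> U \<chi>)"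
proof
  assume *: "U \<psi> \<longrightarrow> U \<chi>"
  show "U (Imp \<psi> \<chi>)"
  proof (cases "U \<psi>")
    case True
    then show ?thesis using * loc_K assms unfolding U_def by blast
  next
    case False
    then have "U (Neg \<psi>)" using U_complete assms by blast
    then have "loc T (insert \<psi> (henkin_set T \<phi>\<^sub>0)) Bot" unfolding U_def by (rule loc_insert)
    then show ?thesis using loc_Bot assms deduction unfolding U_def by blast
  qed
qed (blast intro: U_mp)

lemma U_All: assumes "wf_fm \<psi>" shows "U (All \<psi>) \<longleftrightarrow> (\<forall>t. wf_tm t \<longrightarrow> U (inst t \<psi>))"
proof
  assume "U (All \<psi>)"
  then show "\<forall>t. wf_tm t \<longrightarrow> U (inst t \<psi>)" using U_mp[OF U_thm[OF AllE]] assms by blast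
next
  assume *: "\<forall>t. wf_tm t \<longrightarrow> U (inst t \<psi>)"
  obtain n where n: "from_nat n = \<psi>" using surj_from_nat by (metis surj_def)
  let ?y = "fresh (add_cons T \<psi> (chain T \<phi>\<^sub>0 n)) \<psi>"
  have "loc T (chain T \<phi>\<^sub>0 (Suc n)) (Imp (inst (Var ?y) \<psi>) (All \<psi>))"
    using n assms by (auto intro!: loc_ass wf_subst simp: add_henkin_def split: nat.split)
  then show "U (All \<psi>)" using U_chain U_mp * by (metis wf_tm.simps(1))
qed

lemma U_Leibniz:
  assumes "U (Eq s t)" "U (inst s \<psi>)" "wf_fm \<psi>" shows "U (inst t \<psi>)"
  using assms U_mp[OF U_mp[OF U_thm[OF Leibniz]]] U_wf[OF assms(1)] by auto

lemma U_refl: "wf_tm t \<Longrightarrow> U (Eq t t)"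
  using U_thm Refl by blast

lemma lift_inst_tm: "subst_tm (case_nat t Var) (lift_tm s) = s"
  by (simp add: subst_tm_subst_tm subst_tm_Var)

lemma U_sym: assumes "U (Eq s t)" shows "U (Eq t s)"
  using U_Leibniz[OF assms, of "Eq (Var 0) (lift_tm s)"] U_wf[OF assms] U_refl
  by (auto simp: lift_inst_tm wf_subst_tm)

lemma U_trans: assumes "U (Eq r s)" "U (Eq s t)" shows "U (Eq r t)"
  using U_Leibniz[OF assms(2), of "Eq (lift_tm r) (Var 0)"] U_wf[OF assms(1)] assms(1)
  by (auto simp: lift_inst_tm wf_subst_tm)

lemma U_cong1:
  assumes "U (Eq s t)" "wf_tm (App f (us @ s # vs))"
  shows "U (Eq (App f (us @ s # vs)) (App f (us @ t # vs)))"
proof -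
  let ?\<psi> = "Eq (lift_tm (App f (us @ s # vs))) (App f (map lift_tm us @ Var 0 # map lift_tm vs))"
  have inst: "inst r ?\<psi> = Eq (App f (us @ s # vs)) (App f (us @ r # vs))" for r
    by (simp add: lift_inst_tm comp_def)
  have "U (inst s ?\<psi>)" unfolding inst by (rule U_refl[OF assms(2)])
  moreover have "wf_fm ?\<psi>" using assms(2) by (simp add: wf_lift_tm ball_Un)
  ultimately have "U (inst t ?\<psi>)" using U_Leibniz[OF assms(1), of ?\<psi>] by blast
  then show ?thesis unfolding inst .
qed

text \<open>Leibniz replaces one argument at a time; \<open>us\<close> collects the arguments that
  have already been passed, so that the induction runs along the rest of the list.\<close>

lemma U_cong:
  assumes "list_all2 (\<lambda>s t. U (Eq s t)) ss ts" "wf_tm (App f (us @ ss))"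
  shows "U (Eq (App f (us @ ss)) (App f (us @ ts)))"
  using assms
proof (induction arbitrary: us rule: list_all2_induct)
  case Nil
  then show ?case by (simp add: U_refl del: wf_tm.simps)
next
  case (Cons s ss t ts)
  have "U (Eq (App f (us @ s # ss)) (App f (us @ t # ss)))"
    using U_cong1 Cons by blast
  moreover have "U (Eq (App f ((us @ [t]) @ ss)) (App f ((us @ [t]) @ ts)))"
    using U_wf[OF Cons.hyps(1)] Cons.prems by (intro Cons.IH) auto
  ultimately show ?case using U_trans by simp
qed

section \<open>The term model\<close>

definition cls :: "tm \<Rightarrow> tm set" where
  "cls t = {s. U (Eq t s)}"

definition rep :: "tm set \<Rightarrow> tm" where
  "rep x = (SOME t. wf_tm t \<and> cls t = x)"

definition term_struct :: "tm set struct" where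
  "term_struct = Struct (cls ` {t. wf_tm t}) (\<lambda>f xs. cls (App f (map rep xs)))"

lemma cls_eq: "wf_tm s \<Longrightarrow> cls s = cls t \<longleftrightarrow> U (Eq s t)"
proof
  assume "wf_tm s" "cls s = cls t"
  then have "s \<in> cls t" using U_refl by (auto simp: cls_def)
  then show "U (Eq s t)" by (simp add: cls_def U_sym)
next
  assume "U (Eq s t)"
  then show "cls s = cls t" unfolding cls_def by (blast intro: U_trans U_sym)
qed

lemma rep_cls: assumes "wf_tm t" shows "wf_tm (rep (cls t))" "U (Eq (rep (cls t)) t)"
proof -
  have "wf_tm (rep (cls t)) \<and> cls (rep (cls t)) = cls t"
    unfolding rep_def by (rule someI[of _ t]) (use assms in auto)
  then show "wf_tm (rep (cls t))" "U (Eq (rep (cls t)) t)" using cls_eq by auto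
qed

lemma interp_term_struct:
  assumes "wf_tm (App f ts)"
  shows "interp term_struct f (map cls ts) = cls (App f ts)"
proof -
  have "wf_tm (App f (map (rep \<circ> cls) ts))" using assms rep_cls by auto
  moreover have "list_all2 (\<lambda>s t. U (Eq s t)) (map (rep \<circ> cls) ts) ts"
    using assms rep_cls by (auto simp: list_all2_conv_all_nth)
  ultimately show ?thesis
    using U_cong[of "map (rep \<circ> cls) ts" ts f "[]"] by (simp add: term_struct_def cls_eq)
qed

lemma eval_term_struct:
  assumes "\<And>n. wf_tm (\<sigma> n)"
  shows "wf_tm t \<Longrightarrow> eval term_struct (\<lambda>n. cls (\<sigma> n)) t = cls (subst_tm \<sigma> t)"
proof (induction t)
  case (App f ts)
  then have "map (eval term_struct (\<lambda>n. cls (\<sigma> n))) ts = map cls (map (subst_tm \<sigma>) ts)"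
    by auto
  moreover have "wf_tm (App f (map (subst_tm \<sigma>) ts))"
    using App.prems assms by (auto intro: wf_subst_tm)
  ultimately show ?case by (simp only: eval.simps subst_tm.simps interp_term_struct)
qed auto

text \<open>An environment of the term model is a substitution up to provable equality. Stating the
  claim for substitutions covers open formulas, and the quantifier case just extends the
  substitution by one term.\<close>

lemma truth:
  assumes "\<And>n. wf_tm (\<sigma> n)" "wf_fm \<psi>"
  shows "sat term_struct (\<lambda>n. cls (\<sigma> n)) \<psi> \<longleftrightarrow> U (subst \<sigma> \<psi>)"
  using assms
proof (induction \<psi> arbitrary: \<sigma>)
  case Bot
  then show ?case by (simp add: U_cons)
next
  case (Eq s t)
  then show ?case by (simp add: eval_term_struct cls_eq wf_subst_tm)
next
  case (Imp \<psi> \<chi>)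
  then show ?case by (simp add: U_Imp wf_subst)
next
  case (All \<psi>)
  have "sat term_struct (case_nat (cls t) (\<lambda>n. cls (\<sigma> n))) \<psi> \<longleftrightarrow> U (subst (case_nat t \<sigma>) \<psi>)"
    if "wf_tm t" for t
  proof -
    have "case_nat (cls t) (\<lambda>n. cls (\<sigma> n)) = (\<lambda>n. cls (case_nat t \<sigma> n))"
      by (rule ext) (simp split: nat.split)
    then show ?thesis using All.IH[of "case_nat t \<sigma>"] All.prems that by (auto split: nat.split)
  qed
  moreover have "wf_fm (subst (case_nat (Var 0) (\<lambda>n. lift_tm (\<sigma> n))) \<psi>)"
    using All.prems by (auto intro!: wf_subst wf_subst_tm split: nat.split)
  ultimately show ?case
    by (simp add: term_struct_def[THEN arg_cong[of _ _ carrier]] U_All inst_up)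
qed

lemma env_term_struct:
  assumes "e \<in> env term_struct"
  obtains \<sigma> where "\<And>n. wf_tm (\<sigma> n)" "e = (\<lambda>n. cls (\<sigma> n))"
proof -
  have "\<forall>n. \<exists>t. wf_tm t \<and> e n = cls t" using assms by (auto simp: env_def term_struct_def)
  then show ?thesis using that by metis
qed

lemma models_term_struct: "models term_struct T"
proof -
  have "wf_struct term_struct"
  proof -
    have "interp term_struct f xs \<in> carrier term_struct"
      if "wf_fun f" "length xs = arity f" "set xs \<subseteq> carrier term_struct" for f xs
    proof -
      have "xs \<in> map cls ` lists {t. wf_tm t}"
        using that(3) unfolding lists_image[symmetric] by (auto simp: term_struct_def)
      then obtain ts where ts: "xs = map cls ts" "\<forall>t\<in>set ts. wf_tm t" by auto
      then have wf: "wf_tm (App f ts)" using that by simp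
      have "interp term_struct f xs = cls (App f ts)" unfolding ts by (rule interp_term_struct[OF wf])
      then show ?thesis using wf by (simp add: term_struct_def del: wf_tm.simps)
    qed
    moreover have "carrier term_struct \<noteq> {}"
      by (auto simp: term_struct_def intro: exI[of _ "Var 0"])
    ultimately show ?thesis by (auto simp: wf_struct_def)
  qed
  \<comment> \<open>Axioms may be open: an environment amounts to a substitution, and theorems are
    closed under substitution.\<close>
  moreover have "sat term_struct e \<psi>" if "\<psi> \<in> T" "wf_fm \<psi>" "e \<in> env term_struct" for \<psi> e
    using env_term_struct[OF that(3)] that truth U_thm derives_subst Ax by metis
  ultimately show ?thesis by (auto simp: models_def)
qed

lemma countermodel: "\<exists>M :: tm set struct. models M T \<and> (\<exists>e\<in>env M. sat M e \<phi>\<^sub>0)"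
proof -
  have "sat term_struct (\<lambda>n. cls (Var n)) \<phi>\<^sub>0" using truth[of Var] wf0 U_start by (simp add: subst_Var)
  moreover have "(\<lambda>n. cls (Var n)) \<in> env term_struct" by (auto simp: env_def term_struct_def)
  ultimately show ?thesis using models_term_struct by blast
qed

end

text \<open>Countermodels consist of classes of terms, so a single carrier type suffices and the
  rest of the proof deals with structures of this type only.\<close>

theorem completeness:
  assumes "wf_fm \<phi>" "\<And>(M :: tm set struct) e. models M T \<Longrightarrow> e \<in> env M \<Longrightarrow> sat M e \<phi>"
  shows "T \<turnstile> \<phi>"
proof (rule ccontr)
  assume *: "\<not> T \<turnstile> \<phi>"
  have "\<not> loc T {Neg \<phi>} Bot" using loc_ccontr[of T \<phi> "{}"] * assms(1) loc_empty by blast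
  then show False using countermodel[of "Neg \<phi>" T] assms by auto
qed


section \<open>Models of elementary arithmetic\<close>

type_synonym mdl = "tm set struct"
type_synonym elt = "tm set"

abbreviation zr :: "mdl \<Rightarrow> elt" where "zr M \<equiv> interp M FZero []"
abbreviation sc :: "mdl \<Rightarrow> elt \<Rightarrow> elt" where "sc M x \<equiv> interp M FSucc [x]"
abbreviation pd :: "mdl \<Rightarrow> elt \<Rightarrow> elt" where "pd M x \<equiv> interp M FPred [x]"
abbreviation ad :: "mdl \<Rightarrow> elt \<Rightarrow> elt \<Rightarrow> elt" where "ad M x y \<equiv> interp M FAdd [x, y]"
abbreviation ml :: "mdl \<Rightarrow> elt \<Rightarrow> elt \<Rightarrow> elt" where "ml M x y \<equiv> interp M FMul [x, y]"
abbreviation mn :: "mdl \<Rightarrow> elt \<Rightarrow> elt \<Rightarrow> elt" where "mn M x y \<equiv> interp M FMonus [x, y]"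

definition le :: "mdl \<Rightarrow> elt \<Rightarrow> elt \<Rightarrow> bool" where "le M x y \<longleftrightarrow> mn M x y = zr M"
definition lt :: "mdl \<Rightarrow> elt \<Rightarrow> elt \<Rightarrow> bool" where "lt M x y \<longleftrightarrow> le M (sc M x) y"

lemma EA_carrier:
  assumes "models M EA"
  shows "wf_fun f \<Longrightarrow> length xs = arity f \<Longrightarrow> set xs \<subseteq> carrier M \<Longrightarrow> interp M f xs \<in> carrier M"
  using assms by (simp add: models_def wf_struct_def)

lemma EA_carriers [simp]:
  assumes "models M EA"
  shows "zr M \<in> carrier M" "x \<in> carrier M \<Longrightarrow> sc M x \<in> carrier M" "x \<in> carrier M \<Longrightarrow> pd M x \<in> carrier M"
    "x \<in> carrier M \<Longrightarrow> y \<in> carrier M \<Longrightarrow> ad M x y \<in> carrier M"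
    "x \<in> carrier M \<Longrightarrow> y \<in> carrier M \<Longrightarrow> ml M x y \<in> carrier M"
    "x \<in> carrier M \<Longrightarrow> y \<in> carrier M \<Longrightarrow> mn M x y \<in> carrier M"
  by (auto intro!: EA_carrier[OF assms])

definition lenv :: "mdl \<Rightarrow> elt list \<Rightarrow> nat \<Rightarrow> elt" where
  "lenv M xs i = (if i < length xs then xs ! i else zr M)"

lemma lenv_env: "models M EA \<Longrightarrow> set xs \<subseteq> carrier M \<Longrightarrow> lenv M xs \<in> env M"
  by (auto simp: lenv_def env_def)

lemma lenv_Cons [simp]: "lenv M (x # xs) 0 = x" "lenv M (x # xs) (Suc i) = lenv M xs i"
  by (auto simp: lenv_def)

lemma map_lenv: "length xs = n \<Longrightarrow> map (lenv M xs) [0..<n] = xs"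
  by (auto simp: lenv_def list_eq_iff_nth_eq)

lemma EA_axiom:
  assumes "models M EA" "\<phi> \<in> defining_axioms" "wf_fm \<phi>" "set xs \<subseteq> carrier M"
  shows "sat M (lenv M xs) \<phi>"
  using assms(1,2,3) lenv_env[OF assms(1,4)] EA.Defining[OF assms(2)] unfolding models_def by blast

lemma EA_equations_aux:
  assumes "models M EA" "x \<in> carrier M" "y \<in> carrier M"
  shows "sc M x \<noteq> zr M" "pd M (zr M) = zr M" "pd M (sc M x) = x"
    "ad M x (zr M) = x" "ad M x (sc M y) = sc M (ad M x y)"
    "ml M x (zr M) = zr M" "ml M x (sc M y) = ad M (ml M x y) x"
    "mn M x (zr M) = x" "mn M x (sc M y) = pd M (mn M x y)"
  using assms
    EA_axiom[OF assms(1) defining_axioms.intros(1), of "[x]"]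
    EA_axiom[OF assms(1) defining_axioms.intros(2), of "[x]"]
    EA_axiom[OF assms(1) defining_axioms.intros(3), of "[x]"]
    EA_axiom[OF assms(1) defining_axioms.intros(5), of "[x]"]
    EA_axiom[OF assms(1) defining_axioms.intros(6), of "[x, y]"]
    EA_axiom[OF assms(1) defining_axioms.intros(7), of "[x]"]
    EA_axiom[OF assms(1) defining_axioms.intros(8), of "[x, y]"]
    EA_axiom[OF assms(1) defining_axioms.intros(9), of "[x]"]
    EA_axiom[OF assms(1) defining_axioms.intros(10), of "[x, y]"]
  by simp_all

lemma EA_equations [simp]:
  assumes "models M EA"
  shows "x \<in> carrier M \<Longrightarrow> sc M x \<noteq> zr M" "pd M (zr M) = zr M" "x \<in> carrier M \<Longrightarrow> pd M (sc M x) = x"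
    "x \<in> carrier M \<Longrightarrow> ad M x (zr M) = x"
    "x \<in> carrier M \<Longrightarrow> y \<in> carrier M \<Longrightarrow> ad M x (sc M y) = sc M (ad M x y)"
    "x \<in> carrier M \<Longrightarrow> ml M x (zr M) = zr M"
    "x \<in> carrier M \<Longrightarrow> y \<in> carrier M \<Longrightarrow> ml M x (sc M y) = ad M (ml M x y) x"
    "x \<in> carrier M \<Longrightarrow> mn M x (zr M) = x"
    "x \<in> carrier M \<Longrightarrow> y \<in> carrier M \<Longrightarrow> mn M x (sc M y) = pd M (mn M x y)"
  using EA_equations_aux[OF assms _ EA_carriers(1)[OF assms]]
    EA_equations_aux(2)[OF assms EA_carriers(1,1)[OF assms]] EA_equations_aux(5,7,9)[OF assms]
  by simp_all

lemma EA_proj: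
  fixes M :: mdl
  assumes "models M EA" "i < n" "length xs = n" "set xs \<subseteq> carrier M"
  shows "interp M (FProj n i) xs = xs ! i"
  using EA_axiom[OF assms(1) defining_axioms.intros(4)[OF assms(2)], of xs] assms
  by (simp add: map_lenv comp_def) (simp add: lenv_def)

lemma EA_comp:
  fixes M :: mdl
  assumes "models M EA" "wf_fun (FComp n f gs)" "length xs = n" "set xs \<subseteq> carrier M"
  shows "interp M (FComp n f gs) xs = interp M f (map (\<lambda>g. interp M g xs) gs)"
  using EA_axiom[OF assms(1) defining_axioms.intros(11)[OF assms(2)], of xs] assms
  by (simp add: map_lenv comp_def)

lemma map_lenv_Cons: "length xs = n \<Longrightarrow> map (lenv M (x # xs)) [Suc 0..<Suc n] = xs"
  by (auto simp: lenv_def list_eq_iff_nth_eq simp del: upt_Suc)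

lemma EA_sum:
  assumes "models M EA" "wf_fun (FSum f)" "Suc (length xs) = arity f" "set xs \<subseteq> carrier M" "x \<in> carrier M"
  shows "interp M (FSum f) (zr M # xs) = zr M"
    "interp M (FSum f) (sc M x # xs) = ad M (interp M (FSum f) (x # xs)) (interp M f (x # xs))"
  using EA_axiom[OF assms(1) defining_axioms.intros(12)[OF assms(2) refl], of "x # xs"]
    EA_axiom[OF assms(1) defining_axioms.intros(13)[OF assms(2) refl], of "x # xs"] assms
    map_lenv_Cons[OF refl, of M x xs]
  by (simp_all add: comp_def)

lemma EA_prod:
  assumes "models M EA" "wf_fun (FProd f)" "Suc (length xs) = arity f" "set xs \<subseteq> carrier M" "x \<in> carrier M"
  shows "interp M (FProd f) (zr M # xs) = sc M (zr M)"
    "interp M (FProd f) (sc M x # xs) = ml M (interp M (FProd f) (x # xs)) (interp M f (x # xs))"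
  using EA_axiom[OF assms(1) defining_axioms.intros(14)[OF assms(2) refl], of "x # xs"]
    EA_axiom[OF assms(1) defining_axioms.intros(15)[OF assms(2) refl], of "x # xs"] assms
    map_lenv_Cons[OF refl, of M x xs]
  by (simp_all add: comp_def)


subsection \<open>Elementary functions and relations, uniformly in all models\<close>

text \<open>One term or formula has to serve all models of \<open>EA\<close> at once: induction is a rule of
  \<open>EA\<close>, whose premises must hold in every model.\<close>

definition elemf :: "(mdl \<Rightarrow> (nat \<Rightarrow> elt) \<Rightarrow> elt) \<Rightarrow> bool" where
  "elemf F \<longleftrightarrow> (\<exists>t. wf_tm t \<and> (\<forall>M e. models M EA \<longrightarrow> e \<in> env M \<longrightarrow> F M e = eval M e t))"

definition elemd :: "(mdl \<Rightarrow> (nat \<Rightarrow> elt) \<Rightarrow> bool) \<Rightarrow> bool" where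
  "elemd Q \<longleftrightarrow> (\<exists>\<phi>. wf_fm \<phi> \<and> qfree \<phi> \<and>
     (\<forall>M e. models M EA \<longrightarrow> e \<in> env M \<longrightarrow> (Q M e \<longleftrightarrow> sat M e \<phi>)))"

named_theorems elem_intros

lemma elemf_var [elem_intros]: "elemf (\<lambda>M e. e i)"
  unfolding elemf_def by (rule exI[of _ "Var i"]) simp

lemma elemf_carrier: "elemf F \<Longrightarrow> models M EA \<Longrightarrow> e \<in> env M \<Longrightarrow> F M e \<in> carrier M"
  unfolding elemf_def models_def by (auto simp: eval_carrier)

lemma elemf_appl:
  assumes "wf_fun f" "length Fs = arity f" "\<forall>F\<in>set Fs. elemf F"
  shows "elemf (\<lambda>M e. interp M f (map (\<lambda>F. F M e) Fs))"
proof -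
  have "\<forall>F\<in>set Fs. \<exists>t. wf_tm t \<and> (\<forall>M e. models M EA \<longrightarrow> e \<in> env M \<longrightarrow> F M e = eval M e t)"
    using assms by (auto simp: elemf_def)
  then obtain T where T: "\<forall>F\<in>set Fs. wf_tm (T F) \<and>
      (\<forall>M e. models M EA \<longrightarrow> e \<in> env M \<longrightarrow> F M e = eval M e (T F))" by metis
  have "map (\<lambda>F. F M e) Fs = map (eval M e) (map T Fs)" if "models M EA" "e \<in> env M" for M e
    using T that by auto
  then show ?thesis unfolding elemf_def
    by (intro exI[of _ "App f (map T Fs)"]) (use assms T in \<open>auto simp del: map_map\<close>)
qed

lemma elemf_app0 [elem_intros]: "elemf (\<lambda>M e. zr M)"
  using elemf_appl[of FZero "[]"] by simp

lemma elemf_app1 [elem_intros]: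
  "wf_fun f \<Longrightarrow> arity f = 1 \<Longrightarrow> elemf F \<Longrightarrow> elemf (\<lambda>M e. interp M f [F M e])"
  using elemf_appl[of f "[F]"] by simp

lemma elemf_app2 [elem_intros]:
  "wf_fun f \<Longrightarrow> arity f = 2 \<Longrightarrow> elemf F \<Longrightarrow> elemf G \<Longrightarrow> elemf (\<lambda>M e. interp M f [F M e, G M e])"
  using elemf_appl[of f "[F, G]"] by simp

lemma elemd_eq [elem_intros]: "elemf F \<Longrightarrow> elemf G \<Longrightarrow> elemd (\<lambda>M e. F M e = G M e)"
  unfolding elemf_def elemd_def by (metis qfree.simps(2) sat.simps(2) wf_fm.simps(2))

lemma elemd_false [elem_intros]: "elemd (\<lambda>M e. False)"
  unfolding elemd_def by (rule exI[of _ Bot]) simp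

lemma elemd_imp [elem_intros]:
  assumes "elemd P" "elemd Q" shows "elemd (\<lambda>M e. P M e \<longrightarrow> Q M e)"
proof -
  from assms(1) obtain \<phi> where 1: "wf_fm \<phi>" "qfree \<phi>"
    "\<And>M e. models M EA \<Longrightarrow> e \<in> env M \<Longrightarrow> (P M e \<longleftrightarrow> sat M e \<phi>)" unfolding elemd_def by blast
  from assms(2) obtain \<psi> where 2: "wf_fm \<psi>" "qfree \<psi>"
    "\<And>M e. models M EA \<Longrightarrow> e \<in> env M \<Longrightarrow> (Q M e \<longleftrightarrow> sat M e \<psi>)" unfolding elemd_def by blast
  show ?thesis unfolding elemd_def by (rule exI[of _ "Imp \<phi> \<psi>"]) (use 1 2 in simp)
qed

lemma elemd_not [elem_intros]: "elemd P \<Longrightarrow> elemd (\<lambda>M e. \<not> P M e)"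
  using elemd_imp[OF _ elemd_false, of P] by simp

lemma elemd_or [elem_intros]: "elemd P \<Longrightarrow> elemd Q \<Longrightarrow> elemd (\<lambda>M e. P M e \<or> Q M e)"
  using elemd_imp[OF elemd_not, of P Q] by (simp add: disj_imp)

lemma elemd_and [elem_intros]: "elemd P \<Longrightarrow> elemd Q \<Longrightarrow> elemd (\<lambda>M e. P M e \<and> Q M e)"
  using elemd_not[OF elemd_or[OF elemd_not elemd_not], of P Q] by simp

lemma elemd_le [elem_intros]: "elemf F \<Longrightarrow> elemf G \<Longrightarrow> elemd (\<lambda>M e. le M (F M e) (G M e))"
  unfolding le_def by (intro elem_intros) auto

lemma elemd_lt [elem_intros]: "elemf F \<Longrightarrow> elemf G \<Longrightarrow> elemd (\<lambda>M e. lt M (F M e) (G M e))"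
  unfolding lt_def by (intro elem_intros) auto

lemma elemf_subst_all:
  assumes "elemf F" "\<And>n. elemf (G n)" shows "elemf (\<lambda>M e. F M (\<lambda>n. G n M e))"
proof -
  from assms(1) obtain t where t: "wf_tm t" "\<And>M e. models M EA \<Longrightarrow> e \<in> env M \<Longrightarrow> F M e = eval M e t"
    unfolding elemf_def by blast
  from assms(2) obtain T where T: "\<And>n. wf_tm (T n)"
      "\<And>n M e. models M EA \<Longrightarrow> e \<in> env M \<Longrightarrow> G n M e = eval M e (T n)" unfolding elemf_def by metis
  have "(\<lambda>n. G n M e) \<in> env M" if "models M EA" "e \<in> env M" for M e
    using elemf_carrier[OF assms(2) that] by (auto simp: env_def)
  then show ?thesis unfolding elemf_def
    by (intro exI[of _ "subst_tm T t"]) (use t T in \<open>simp add: wf_subst_tm eval_subst_tm\<close>)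
qed

lemma elemd_subst_all:
  assumes "elemd Q" "\<And>n. elemf (G n)" shows "elemd (\<lambda>M e. Q M (\<lambda>n. G n M e))"
proof -
  from assms(1) obtain \<phi> where t: "wf_fm \<phi>" "qfree \<phi>"
      "\<And>M e. models M EA \<Longrightarrow> e \<in> env M \<Longrightarrow> Q M e \<longleftrightarrow> sat M e \<phi>"
    unfolding elemd_def by blast
  from assms(2) obtain T where T: "\<And>n. wf_tm (T n)"
      "\<And>n M e. models M EA \<Longrightarrow> e \<in> env M \<Longrightarrow> G n M e = eval M e (T n)" unfolding elemf_def by metis
  have "(\<lambda>n. G n M e) \<in> env M" if "models M EA" "e \<in> env M" for M e
    using elemf_carrier[OF assms(2) that] by (auto simp: env_def)
  then show ?thesis unfolding elemd_def
    by (intro exI[of _ "subst T \<phi>"]) (use t T in \<open>simp add: wf_subst sat_subst qfree_subst\<close>)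
qed

lemma elemf_subst0:
  assumes "elemf (\<lambda>M e. F M (e 0) (\<lambda>n. e (Suc n)))" "elemf G" shows "elemf (\<lambda>M e. F M (G M e) e)"
  using elemf_subst_all[OF assms(1), of "case_nat G (\<lambda>n M e. e n)"] assms(2) elemf_var
  by (simp split: nat.split)


lemma elemf_ren: "elemf F \<Longrightarrow> elemf (\<lambda>M e. F M (\<lambda>n. e (\<rho> n)))"
  by (rule elemf_subst_all[OF _ elemf_var])

lemma elemd_ren: "elemd Q \<Longrightarrow> elemd (\<lambda>M e. Q M (\<lambda>n. e (\<rho> n)))"
  by (rule elemd_subst_all[OF _ elemf_var])

text \<open>The induction rule of \<open>EA\<close>, whose premises become provable by completeness.\<close>

lemma EA_rule:
  assumes "elemd (\<lambda>M e. P M (e 0) (\<lambda>n. e (Suc n)))"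
    and base: "\<And>M p. models M EA \<Longrightarrow> p \<in> env M \<Longrightarrow> P M (zr M) p"
    and step: "\<And>M x p. models M EA \<Longrightarrow> x \<in> carrier M \<Longrightarrow> p \<in> env M \<Longrightarrow> P M x p \<Longrightarrow> P M (sc M x) p"
    and M: "models M EA" "x \<in> carrier M" "p \<in> env M"
  shows "P M x p"
proof -
  from assms(1) obtain \<phi> where \<phi>: "wf_fm \<phi>" "qfree \<phi>"
      "\<And>M e. models M EA \<Longrightarrow> e \<in> env M \<Longrightarrow> P M (e 0) (\<lambda>n. e (Suc n)) \<longleftrightarrow> sat M e \<phi>"
    unfolding elemd_def by blast
  have tl: "(\<lambda>n. e (Suc n)) \<in> env M" if "e \<in> env M" for e and M :: mdl
    using that by (auto simp: env_def)
  have s: "sat M e (subst (Var(0 := t)) \<phi>) \<longleftrightarrow> P M (eval M e t) (\<lambda>n. e (Suc n))"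
    if "models M EA" "e \<in> env M" "wf_tm t" for M e t
  proof -
    have "(\<lambda>n. eval M e ((Var(0 := t)) n)) = e(0 := eval M e t)" by (rule ext) simp
    moreover have "eval M e t \<in> carrier M" using that eval_carrier models_def by blast
    ultimately show ?thesis using \<phi>(3)[OF that(1) env_upd[OF that(2)], of "eval M e t" 0]
      by (simp add: sat_subst)
  qed
  have "EA \<turnstile> subst (Var(0 := zero)) \<phi>"
    by (rule completeness) (use \<phi>(1) base s tl in \<open>auto intro!: wf_subst\<close>)
  moreover have "EA \<turnstile> Imp \<phi> (subst (Var(0 := succ (Var 0))) \<phi>)"
  proof (rule completeness)
    fix M :: mdl and e assume "models M EA" "e \<in> env M"
    then show "sat M e (Imp \<phi> (subst (Var(0 := succ (Var 0))) \<phi>))"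
      using s[of M e "succ (Var 0)"] \<phi>(3)[of M e] step[of M "e 0" "\<lambda>n. e (Suc n)"] tl
      by (simp add: env_carrier)
  qed (use \<phi>(1) in \<open>auto intro!: wf_subst\<close>)
  ultimately have "\<phi> \<in> EA" using \<phi> EA.Induction by blast
  then have "sat M (case_nat x p) \<phi>" using M \<phi>(1) by (auto simp: models_def)
  then show ?thesis using \<phi>(3)[of M "case_nat x p"] M by simp
qed

text \<open>The form in which the arithmetic laws are proved: induction on the first argument, the
  other two are parameters. A law with fewer variables fills the spare places with one of its
  own.\<close>

lemma EA_rule3:
  assumes "elemd (\<lambda>M e. P M (e 0) (e 1) (e 2))"
    and "\<And>M y z. models M EA \<Longrightarrow> y \<in> carrier M \<Longrightarrow> z \<in> carrier M \<Longrightarrow> P M (zr M) y z"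
    and "\<And>M x y z. models M EA \<Longrightarrow> x \<in> carrier M \<Longrightarrow> y \<in> carrier M \<Longrightarrow> z \<in> carrier M \<Longrightarrow>
      P M x y z \<Longrightarrow> P M (sc M x) y z"
    and M: "models M EA" "x \<in> carrier M" "y \<in> carrier M" "z \<in> carrier M"
  shows "P M x y z"
  using EA_rule[where P = "\<lambda>M x p. P M x (p 0) (p 1)" and M = M and x = x and p = "lenv M [y, z]"]
    assms lenv_env[of M "[y, z]"]
  by (simp add: env_carrier numeral_2_eq_2)

section \<open>Laws of addition and truncated subtraction\<close>

lemma sc_inj [simp]: "models M EA \<Longrightarrow> x \<in> carrier M \<Longrightarrow> y \<in> carrier M \<Longrightarrow> sc M x = sc M y \<longleftrightarrow> x = y"
  by (metis EA_equations(3))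

lemma ad_zero_left [simp]: "models M EA \<Longrightarrow> x \<in> carrier M \<Longrightarrow> ad M (zr M) x = x"
  by (rule EA_rule3[where P = "\<lambda>M x y z. ad M (zr M) x = x" and y = x and z = x])
     ((intro elem_intros; simp) | simp)+

lemma ad_succ_left [simp]:
  "models M EA \<Longrightarrow> x \<in> carrier M \<Longrightarrow> y \<in> carrier M \<Longrightarrow> ad M (sc M x) y = sc M (ad M x y)"
  by (rule EA_rule3[where P = "\<lambda>M y x z. ad M (sc M x) y = sc M (ad M x y)" and z = x])
     ((intro elem_intros; simp) | simp)+

lemma ad_comm: "models M EA \<Longrightarrow> x \<in> carrier M \<Longrightarrow> y \<in> carrier M \<Longrightarrow> ad M x y = ad M y x"
  by (rule EA_rule3[where P = "\<lambda>M y x z. ad M x y = ad M y x" and z = x])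
     ((intro elem_intros; simp) | simp)+

lemma ad_assoc: "models M EA \<Longrightarrow> x \<in> carrier M \<Longrightarrow> y \<in> carrier M \<Longrightarrow> z \<in> carrier M \<Longrightarrow>
    ad M (ad M x y) z = ad M x (ad M y z)"
  by (rule EA_rule3[where P = "\<lambda>M z x y. ad M (ad M x y) z = ad M x (ad M y z)"])
     ((intro elem_intros; simp) | simp)+

lemma zero_or_succ: "models M EA \<Longrightarrow> x \<in> carrier M \<Longrightarrow> x = zr M \<or> sc M (pd M x) = x"
  by (rule EA_rule3[where P = "\<lambda>M x y z. x = zr M \<or> sc M (pd M x) = x" and y = x and z = x])
     ((intro elem_intros; simp) | simp)+

lemma mn_zero_left [simp]: "models M EA \<Longrightarrow> x \<in> carrier M \<Longrightarrow> mn M (zr M) x = zr M"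
  by (rule EA_rule3[where P = "\<lambda>M x y z. mn M (zr M) x = zr M" and y = x and z = x])
     ((intro elem_intros; simp) | simp)+

lemma mn_succ_succ: "models M EA \<Longrightarrow> x \<in> carrier M \<Longrightarrow> y \<in> carrier M \<Longrightarrow> mn M (sc M x) (sc M y) = mn M x y"
  by (rule EA_rule3[where P = "\<lambda>M y x z. mn M (sc M x) (sc M y) = mn M x y" and z = x])
     ((intro elem_intros; simp) | simp)+

lemma mn_self [simp]: "models M EA \<Longrightarrow> x \<in> carrier M \<Longrightarrow> mn M x x = zr M"
  by (rule EA_rule3[where P = "\<lambda>M x y z. mn M x x = zr M" and y = x and z = x])
     ((intro elem_intros; simp) | simp add: mn_succ_succ del: EA_equations(9))+

lemma mn_ad [simp]: "models M EA \<Longrightarrow> x \<in> carrier M \<Longrightarrow> y \<in> carrier M \<Longrightarrow> mn M (ad M x y) x = y"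
  by (rule EA_rule3[where P = "\<lambda>M x y z. mn M (ad M x y) x = y" and z = x])
     ((intro elem_intros; simp) | simp add: mn_succ_succ del: EA_equations(9))+

lemma mn_ad2 [simp]: "models M EA \<Longrightarrow> x \<in> carrier M \<Longrightarrow> y \<in> carrier M \<Longrightarrow> mn M x (ad M x y) = zr M"
  by (rule EA_rule3[where P = "\<lambda>M y x z. mn M x (ad M x y) = zr M" and z = x])
     ((intro elem_intros; simp) | simp)+

text \<open>Subtraction recurses through the predecessor. If the new difference is nonzero then so
  was the old one, which is therefore a successor, and one unit moves from it to the other
  summand.\<close>

lemma ad_mn:
  assumes "models M EA" "x \<in> carrier M" "y \<in> carrier M" shows "mn M x y \<noteq> zr M \<Longrightarrow> ad M y (mn M x y) = x"
proof -
  have "mn M x y \<noteq> zr M \<longrightarrow> ad M y (mn M x y) = x"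
  proof (rule EA_rule3[where P = "\<lambda>M y x z. mn M x y \<noteq> zr M \<longrightarrow> ad M y (mn M x y) = x" and z = x])
    fix M y x z assume M: "models M EA" "y \<in> carrier M" "x \<in> carrier M"
      and IH: "mn M x y \<noteq> zr M \<longrightarrow> ad M y (mn M x y) = x"
    show "mn M x (sc M y) \<noteq> zr M \<longrightarrow> ad M (sc M y) (mn M x (sc M y)) = x"
    proof
      assume nz: "mn M x (sc M y) \<noteq> zr M"
      let ?u = "mn M x y"
      have u: "?u \<noteq> zr M"
      proof
        assume "?u = zr M" then show False using nz M by simp
      qed
      then have s: "sc M (pd M ?u) = ?u" using zero_or_succ[of M ?u] M by simp
      have "ad M (sc M y) (pd M ?u) = ad M y (sc M (pd M ?u))" using M by simp
      then show "ad M (sc M y) (mn M x (sc M y)) = x" using IH u s M by simp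
    qed
  qed (use assms in \<open>(intro elem_intros; simp) | simp\<close>)+
  then show "mn M x y \<noteq> zr M \<Longrightarrow> ad M y (mn M x y) = x" by blast
qed

lemma ad_mn_le:
  assumes "models M EA" "x \<in> carrier M" "y \<in> carrier M" shows "mn M x y = zr M \<Longrightarrow> ad M x (mn M y x) = y"
proof -
  have "mn M x y = zr M \<longrightarrow> ad M x (mn M y x) = y"
  proof (rule EA_rule3[where P = "\<lambda>M y x z. mn M x y = zr M \<longrightarrow> ad M x (mn M y x) = y" and z = x])
    fix M y x z assume M: "models M EA" "y \<in> carrier M" "x \<in> carrier M"
      and IH: "mn M x y = zr M \<longrightarrow> ad M x (mn M y x) = y"
    show "mn M x (sc M y) = zr M \<longrightarrow> ad M x (mn M (sc M y) x) = sc M y"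
    proof
      assume z: "mn M x (sc M y) = zr M"
      show "ad M x (mn M (sc M y) x) = sc M y"
      proof (cases "mn M x y = zr M")
        case True
        then have y: "sc M y = ad M x (sc M (mn M y x))" using IH M by simp
        show ?thesis unfolding y using M by (simp del: EA_equations(5))
      next
        case False
        \<comment> \<open>Here \<open>x\<close> exceeds \<open>y\<close> but not its successor: the
          difference is one, and \<open>x\<close> is that successor.\<close>
        then have "sc M (pd M (mn M x y)) = mn M x y" using zero_or_succ[of M "mn M x y"] M by simp
        then have "mn M x y = sc M (zr M)" using z M by simp
        then have "x = sc M y" using ad_mn[OF M(1,3,2) False] M by simp
        then show ?thesis using M by (simp del: EA_equations(9))
      qed
    qed
  qed (use assms in \<open>(intro elem_intros; simp) | simp\<close>)+
  then show "mn M x y = zr M \<Longrightarrow> ad M x (mn M y x) = y" by blast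
qed


subsection \<open>The order\<close>

lemma zr_neq_sc [simp]: "models M EA \<Longrightarrow> x \<in> carrier M \<Longrightarrow> zr M \<noteq> sc M x"
  using EA_equations(1) by metis

text \<open>With an explicit difference, facts about the order follow from associativity,
  commutativity and cancellation.\<close>

lemma le_iff:
  assumes "models M EA" "x \<in> carrier M" "y \<in> carrier M"
  shows "le M x y \<longleftrightarrow> (\<exists>k\<in>carrier M. y = ad M x k)"
proof
  assume "le M x y"
  then have "y = ad M x (mn M y x)" using ad_mn_le[OF assms] by (simp add: le_def)
  then show "\<exists>k\<in>carrier M. y = ad M x k" using assms by (metis EA_carriers(6))
qed (use assms in \<open>auto simp: le_def\<close>)

lemma ad_cancel [simp]:
  "models M EA \<Longrightarrow> x \<in> carrier M \<Longrightarrow> y \<in> carrier M \<Longrightarrow> z \<in> carrier M \<Longrightarrow> ad M x y = ad M x z \<longleftrightarrow> y = z"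
  by (metis mn_ad)

lemma le_ad [simp]: "models M EA \<Longrightarrow> x \<in> carrier M \<Longrightarrow> y \<in> carrier M \<Longrightarrow> le M x (ad M x y)"
  by (simp add: le_def)

lemma le_ad2 [simp]: "models M EA \<Longrightarrow> x \<in> carrier M \<Longrightarrow> y \<in> carrier M \<Longrightarrow> le M y (ad M x y)"
  by (simp add: ad_comm[of M x y])

lemma le_refl [simp]: "models M EA \<Longrightarrow> x \<in> carrier M \<Longrightarrow> le M x x"
  by (simp add: le_def)

lemma le_zero [simp]: "models M EA \<Longrightarrow> x \<in> carrier M \<Longrightarrow> le M (zr M) x"
  by (simp add: le_def)

lemma le_sc_sc [simp]: "models M EA \<Longrightarrow> x \<in> carrier M \<Longrightarrow> y \<in> carrier M \<Longrightarrow> le M (sc M x) (sc M y) \<longleftrightarrow> le M x y"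
  by (simp add: le_def mn_succ_succ del: EA_equations(9))

lemma lt_sc [simp]: "models M EA \<Longrightarrow> x \<in> carrier M \<Longrightarrow> y \<in> carrier M \<Longrightarrow> lt M x (sc M y) \<longleftrightarrow> le M x y"
  by (simp add: lt_def)

lemma le_antisym:
  assumes "models M EA" "x \<in> carrier M" "y \<in> carrier M" "le M x y" "le M y x" shows "x = y"
  using ad_mn_le[OF assms(1-3)] assms by (simp add: le_def)

lemma le_linear:
  assumes "models M EA" "x \<in> carrier M" "y \<in> carrier M" shows "le M x y \<or> le M y x"
proof (rule disjCI)
  assume "\<not> le M y x"
  then have "ad M x (mn M y x) = y" using ad_mn[OF assms(1,3,2)] by (simp add: le_def)
  then show "le M x y" using assms by (metis le_iff EA_carriers(6))
qed

lemma le_trans: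
  assumes "models M EA" "x \<in> carrier M" "y \<in> carrier M" "z \<in> carrier M" "le M x y" "le M y z"
  shows "le M x z"
proof -
  obtain k l where "k \<in> carrier M" "l \<in> carrier M" "y = ad M x k" "z = ad M y l"
    using assms le_iff by metis
  then have "z = ad M x (ad M k l)" using assms by (simp add: ad_assoc)
  then show ?thesis using assms \<open>k \<in> carrier M\<close> \<open>l \<in> carrier M\<close> by simp
qed

lemma le_zero_iff [simp]: "models M EA \<Longrightarrow> x \<in> carrier M \<Longrightarrow> le M x (zr M) \<longleftrightarrow> x = zr M"
  by (simp add: le_def)

lemma lt_iff:
  assumes "models M EA" "x \<in> carrier M" "y \<in> carrier M" shows "lt M x y \<longleftrightarrow> \<not> le M y x"
proof
  assume "lt M x y"
  then obtain k where k: "k \<in> carrier M" "y = ad M (sc M x) k"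
    using assms le_iff[of M "sc M x" y] by (auto simp: lt_def)
  show "\<not> le M y x"
  proof
    assume "le M y x"
    then obtain l where l: "l \<in> carrier M" "x = ad M y l" using assms le_iff by metis
    then have "ad M x (zr M) = ad M (ad M (sc M x) k) l" using k assms by simp
    also have "\<dots> = ad M x (sc M (ad M k l))" using k l(1) assms(1,2) by (simp add: ad_assoc)
    finally show False using k(1) l(1) assms(1,2) by (simp del: EA_equations)
  qed
next
  assume "\<not> le M y x"
  then have nz: "mn M y x \<noteq> zr M" by (simp add: le_def)
  then have "sc M (pd M (mn M y x)) = mn M y x" using zero_or_succ[of M "mn M y x"] assms by simp
  then have "ad M x (sc M (pd M (mn M y x))) = y" using ad_mn[OF assms(1,3,2) nz] by simp
  then have "ad M (sc M x) (pd M (mn M y x)) = y" using assms by simp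
  then show "lt M x y" unfolding lt_def using assms by (metis le_ad EA_carriers(2,3,6))
qed

lemma lt_le: "models M EA \<Longrightarrow> x \<in> carrier M \<Longrightarrow> y \<in> carrier M \<Longrightarrow> lt M x y \<longleftrightarrow> le M x y \<and> x \<noteq> y"
  by (metis lt_iff le_linear le_antisym le_refl)


lemma lt_le_trans: "models M EA \<Longrightarrow> x \<in> carrier M \<Longrightarrow> y \<in> carrier M \<Longrightarrow> z \<in> carrier M \<Longrightarrow>
    lt M x y \<Longrightarrow> le M y z \<Longrightarrow> lt M x z"
  by (metis lt_iff le_trans)

lemma ad_le_mono:
  assumes "models M EA" "x \<in> carrier M" "y \<in> carrier M" "z \<in> carrier M" "w \<in> carrier M"
  shows "le M x y \<Longrightarrow> le M z w \<Longrightarrow> le M (ad M x z) (ad M y w)"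
proof -
  assume "le M x y" "le M z w"
  then obtain k l where k: "k \<in> carrier M" "l \<in> carrier M" "y = ad M x k" "w = ad M z l"
    using assms le_iff by metis
  have "ad M y w = ad M (ad M x (ad M k z)) l" using k assms by (simp add: ad_assoc)
  also have "\<dots> = ad M (ad M x z) (ad M k l)"
    using k(1,2) assms(1,2,4) by (simp add: ad_assoc ad_comm[of M k z])
  finally show ?thesis using k assms by simp
qed

text \<open>Strict monotonicity of addition in both arguments; this is what later lets a least sum
  determine its summands.\<close>

lemma ad_le_eq:
  assumes "models M EA" "x \<in> carrier M" "y \<in> carrier M" "z \<in> carrier M" "w \<in> carrier M"
    "le M x y" "le M z w" "le M (ad M y w) (ad M x z)"
  shows "x = y \<and> z = w"
proof -
  obtain k l where k: "k \<in> carrier M" "l \<in> carrier M" "y = ad M x k" "w = ad M z l"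
    using assms le_iff by metis
  have "ad M y w = ad M (ad M x (ad M k z)) l" using k assms by (simp add: ad_assoc)
  also have "\<dots> = ad M (ad M x z) (ad M k l)"
    using k(1,2) assms(1,2,4) by (simp add: ad_assoc ad_comm[of M k z])
  finally have "ad M (ad M x z) (ad M k l) = ad M (ad M x z) (zr M)"
    using ad_le_mono[OF assms(1-7)] assms le_antisym by (metis EA_carriers(4) EA_equations(4))
  then have "ad M k l = zr M" using k assms ad_cancel by (metis EA_carriers(1,4))
  then have "k = zr M" "l = zr M" using k assms(1) by (metis le_ad le_zero_iff, metis le_ad2 le_zero_iff)
  then show ?thesis using k assms by simp
qed


subsection \<open>Characteristic functions and bounded search\<close>

lemma elemf_cong: "elemf F \<Longrightarrow> (\<And>M e. models M EA \<Longrightarrow> e \<in> env M \<Longrightarrow> G M e = F M e) \<Longrightarrow> elemf G"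
  unfolding elemf_def by metis

lemma elemd_cong: "elemd F \<Longrightarrow> (\<And>M e. models M EA \<Longrightarrow> e \<in> env M \<Longrightarrow> G M e = F M e) \<Longrightarrow> elemd G"
  unfolding elemd_def by metis

lemma elemf_eval: "wf_tm t \<Longrightarrow> elemf (\<lambda>M e. eval M e t)"
  unfolding elemf_def by blast

text \<open>With truncated subtraction, an equation has the value
  \<open>1 - ((s - t) + (t - s))\<close>, and an implication between formulas of values
  \<open>p\<close> and \<open>q\<close> the value \<open>1 - p (1 - q)\<close>.\<close>

lemma elemf_char_sat:
  "qfree \<phi> \<Longrightarrow> wf_fm \<phi> \<Longrightarrow> elemf (\<lambda>M e. if sat M e \<phi> then sc M (zr M) else zr M)"
proof (induction \<phi>)
  case Bot
  then show ?case using elemf_app0 by simp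
next
  case (Eq s t)
  then have "elemf (\<lambda>M e. mn M (sc M (zr M)) (ad M (mn M (eval M e s) (eval M e t)) (mn M (eval M e t) (eval M e s))))"
    by (intro elem_intros elemf_eval) auto
  then show ?case
  proof (rule elemf_cong)
    fix M :: mdl and e assume M: "models M EA" "e \<in> env M"
    have c: "eval M e s \<in> carrier M" "eval M e t \<in> carrier M"
      using elemf_carrier[OF elemf_eval] M Eq by auto
    let ?a = "mn M (eval M e s) (eval M e t)" and ?b = "mn M (eval M e t) (eval M e s)"
    show "(if sat M e (Eq s t) then sc M (zr M) else zr M) = mn M (sc M (zr M)) (ad M ?a ?b)"
    proof (cases "eval M e s = eval M e t")
      case True
      then show ?thesis using M c by simp
    next
      case False
      have "ad M ?a ?b \<noteq> zr M"
      proof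
        assume z: "ad M ?a ?b = zr M"
        then have "?a = zr M" using M c le_ad[of M ?a ?b] by simp
        moreover from z have "?b = zr M" using M c le_ad2[of M ?a ?b] by simp
        ultimately show False using False M c le_antisym[of M "eval M e s" "eval M e t"] by (simp add: le_def)
      qed
      then have "sc M (pd M (ad M ?a ?b)) = ad M ?a ?b" using zero_or_succ[of M "ad M ?a ?b"] M c by simp
      then have "mn M (sc M (zr M)) (ad M ?a ?b) = zr M"
        using mn_succ_succ[of M "zr M" "pd M (ad M ?a ?b)"] M c by simp
      then show ?thesis using False by simp
    qed
  qed
next
  case (Imp \<phi> \<psi>)
  then have "elemf (\<lambda>M e. mn M (sc M (zr M)) (ml M (if sat M e \<phi> then sc M (zr M) else zr M)
     (mn M (sc M (zr M)) (if sat M e \<psi> then sc M (zr M) else zr M))))"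
    by (intro elem_intros) auto
  then show ?case
    by (rule elemf_cong) auto
qed auto

lemma elemf_char:
  assumes "elemd Q" shows "elemf (\<lambda>M e. if Q M e then sc M (zr M) else zr M)"
proof -
  from assms obtain \<phi> where \<phi>: "wf_fm \<phi>" "qfree \<phi>"
      "\<And>M e. models M EA \<Longrightarrow> e \<in> env M \<Longrightarrow> Q M e \<longleftrightarrow> sat M e \<phi>" unfolding elemd_def by blast
  show ?thesis using elemf_char_sat[OF \<phi>(2,1)] by (rule elemf_cong) (simp add: \<phi>(3))
qed

text \<open>\<open>FSum\<close>, \<open>FProd\<close> and the limit rule apply to symbols, not to
  terms; projections and composition turn any term into a symbol of prescribed arity.\<close>

lemma term_symbol:
  "wf_tm t \<Longrightarrow> fv_tm t \<subseteq> {..<n} \<Longrightarrow> \<exists>f. wf_fun f \<and> arity f = n \<and>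
     (\<forall>(M :: mdl) e. models M EA \<longrightarrow> e \<in> env M \<longrightarrow> interp M f (map e [0..<n]) = eval M e t)"
proof (induction t)
  case (Var i)
  then have "i < n" by simp
  moreover have "interp M (FProj n i) (map e [0..<n]) = e i" if "models M EA" "e \<in> env M" for M :: mdl and e
    using EA_proj[OF that(1) \<open>i < n\<close>, of "map e [0..<n]"] that \<open>i < n\<close> by (auto simp: env_def)
  ultimately show ?case by (intro exI[of _ "FProj n i"]) simp
next
  case (App g ts)
  have "\<forall>t\<in>set ts. \<exists>f. wf_fun f \<and> arity f = n \<and>
     (\<forall>(M :: mdl) e. models M EA \<longrightarrow> e \<in> env M \<longrightarrow> interp M f (map e [0..<n]) = eval M e t)"
    using App by auto
  then obtain F where F: "\<forall>t\<in>set ts. wf_fun (F t) \<and> arity (F t) = n \<and>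
     (\<forall>(M :: mdl) e. models M EA \<longrightarrow> e \<in> env M \<longrightarrow> interp M (F t) (map e [0..<n]) = eval M e t)"
    by metis
  let ?f = "FComp n g (map F ts)"
  have wf: "wf_fun ?f" using F App.prems by auto
  have "interp M ?f (map e [0..<n]) = eval M e (App g ts)" if M: "models M EA" "e \<in> env M" for M :: mdl and e
  proof -
    have "interp M ?f (map e [0..<n]) = interp M g (map (\<lambda>h. interp M h (map e [0..<n])) (map F ts))"
      using EA_comp[OF M(1) wf, of "map e [0..<n]"] M by (auto simp: env_def)
    also have "map (\<lambda>h. interp M h (map e [0..<n])) (map F ts) = map (eval M e) ts"
      using F M by auto
    finally show ?thesis by simp
  qed
  then show ?case using wf by (intro exI[of _ ?f]) simp
qed

lemma elemf_symbol:
  assumes "elemf (\<lambda>M e. F M (e 0) (\<lambda>n. e (Suc n)))"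
  obtains f n where "wf_fun f" "arity f = Suc n"
    "\<And>M x p. models M EA \<Longrightarrow> x \<in> carrier M \<Longrightarrow> p \<in> env M \<Longrightarrow> interp M f (x # map p [0..<n]) = F M x p"
proof -
  from assms obtain t where t: "wf_tm t"
    "\<And>M e. models M EA \<Longrightarrow> e \<in> env M \<Longrightarrow> F M (e 0) (\<lambda>n. e (Suc n)) = eval M e t" unfolding elemf_def by blast
  obtain m where "fv_tm t \<subseteq> {..<m}" using finite_fv_tm[of t] unfolding finite_nat_set_iff_bounded by blast
  then have "fv_tm t \<subseteq> {..<Suc m}" by auto
  from term_symbol[OF t(1) this] obtain f where f: "wf_fun f" "arity f = Suc m"
     "\<And>(M :: mdl) e. models M EA \<Longrightarrow> e \<in> env M \<Longrightarrow> interp M f (map e [0..<Suc m]) = eval M e t" by blast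
  have "interp M f (x # map p [0..<m]) = F M x p" if "models M EA" "x \<in> carrier M" "p \<in> env M" for M x p
    using f(3)[of M "case_nat x p"] t(2)[of M "case_nat x p"] that
    by (simp add: upt_conv_Cons map_Suc_upt[symmetric] comp_def del: upt_Suc)
  then show ?thesis using that f by blast
qed

lemma elemf_Cons:
  assumes "wf_fun f" "arity f = Suc n" shows "elemf (\<lambda>M e. interp M f (e 0 # map (\<lambda>i. e (Suc i)) [0..<n]))"
  using elemf_appl[of f "(\<lambda>M e. e 0) # map (\<lambda>i M e. e (Suc i)) [0..<n]"] assms elemf_var
  by (auto simp: comp_def)

lemma elemf_sub:
  assumes "elemf (\<lambda>M e. F M (e 0) (\<lambda>n. e (Suc n)))" "elemf G"
  shows "elemf (\<lambda>M e. F M (G M e) (\<lambda>n. e (\<rho> n)))"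
  using elemf_subst_all[OF assms(1), of "case_nat G (\<lambda>n M e. e (\<rho> n))"] assms(2) elemf_var
  by (simp split: nat.split)

lemma elemd_sub:
  assumes "elemd (\<lambda>M e. Q M (e 0) (\<lambda>n. e (Suc n)))" "elemf G"
  shows "elemd (\<lambda>M e. Q M (G M e) (\<lambda>n. e (\<rho> n)))"
  using elemd_subst_all[OF assms(1), of "case_nat G (\<lambda>n M e. e (\<rho> n))"] assms(2) elemf_var
  by (simp split: nat.split)

lemma env_Suc: "e \<in> env M \<Longrightarrow> (\<lambda>n. e (\<rho> n)) \<in> env M"
  by (auto simp: env_def)

lemma env_list: "e \<in> env M \<Longrightarrow> set (map e xs) \<subseteq> carrier M"
  by (auto simp: env_def)

text \<open>\<open>P x\<close> is the product over \<open>z < x\<close> of the characteristic function of \<open>\<not> Q\<close>, and \<open>S x\<close> the sum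
  over \<open>z < x\<close> of \<open>P (z + 1)\<close>, i.e. the length of the longest initial segment of \<open>x\<close> missing \<open>Q\<close>.\<close>

lemma bounded_search:
  assumes Q: "elemd (\<lambda>M e. Q M (e 0) (\<lambda>n. e (Suc n)))"
  obtains S where "elemf (\<lambda>M e. S M (e 0) (\<lambda>n. e (Suc n)))"
    "\<And>M x p. models M EA \<Longrightarrow> x \<in> carrier M \<Longrightarrow> p \<in> env M \<Longrightarrow> S M x p \<in> carrier M \<and> le M (S M x p) x"
    "\<And>M x p. models M EA \<Longrightarrow> x \<in> carrier M \<Longrightarrow> p \<in> env M \<Longrightarrow> S M x p = x \<or> Q M (S M x p) p"
    "\<And>M x p z. models M EA \<Longrightarrow> x \<in> carrier M \<Longrightarrow> p \<in> env M \<Longrightarrow> z \<in> carrier M \<Longrightarrow>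
       lt M z (S M x p) \<Longrightarrow> \<not> Q M z p"
proof -
  have "elemf (\<lambda>M e. if \<not> Q M (e 0) (\<lambda>n. e (Suc n)) then sc M (zr M) else zr M)"
    using Q by (intro elemf_char elem_intros)
  from elemf_symbol[where F = "\<lambda>M x p. if \<not> Q M x p then sc M (zr M) else zr M", OF this]
  obtain f n where f: "wf_fun f" "arity f = Suc n"
    "\<And>M x p. models M EA \<Longrightarrow> x \<in> carrier M \<Longrightarrow> p \<in> env M \<Longrightarrow>
      interp M f (x # map p [0..<n]) = (if \<not> Q M x p then sc M (zr M) else zr M)" by metis
  define P where "P = (\<lambda>(M :: mdl) x p. interp M (FProd f) (x # map p [0..<n]))"
  have eP: "elemf (\<lambda>M e. P M (e 0) (\<lambda>n. e (Suc n)))"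
    unfolding P_def using elemf_Cons[of "FProd f" n] f by simp
  have P0: "P M (zr M) p = sc M (zr M)" if "models M EA" "p \<in> env M" for M p
    using EA_prod(1)[of M f "map p [0..<n]" "zr M"] f that env_list[OF that(2), of "[0..<n]"]
    by (simp add: P_def)
  have PS: "P M (sc M x) p = ml M (P M x p) (if \<not> Q M x p then sc M (zr M) else zr M)"
    if "models M EA" "x \<in> carrier M" "p \<in> env M" for M x p
    using EA_prod(2)[of M f "map p [0..<n]" x] f that env_list[OF that(3), of "[0..<n]"] by (simp add: P_def)
  have "elemf (\<lambda>M e. P M (sc M (e 0)) (\<lambda>n. e (Suc n)))"
    by (rule elemf_sub[OF eP]) (intro elem_intros; simp)
  from elemf_symbol[where F = "\<lambda>M x p. P M (sc M x) p", OF this]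
  obtain g m where g: "wf_fun g" "arity g = Suc m"
    "\<And>M x p. models M EA \<Longrightarrow> x \<in> carrier M \<Longrightarrow> p \<in> env M \<Longrightarrow> interp M g (x # map p [0..<m]) = P M (sc M x) p" by metis
  define S where "S = (\<lambda>(M :: mdl) x p. interp M (FSum g) (x # map p [0..<m]))"
  have eS: "elemf (\<lambda>M e. S M (e 0) (\<lambda>n. e (Suc n)))"
    unfolding S_def using elemf_Cons[of "FSum g" m] g by simp
  have S0: "S M (zr M) p = zr M" if "models M EA" "p \<in> env M" for M p
    using EA_sum(1)[of M g "map p [0..<m]" "zr M"] g that env_list[OF that(2), of "[0..<m]"]
    by (simp add: S_def)
  have SS: "S M (sc M x) p = ad M (S M x p) (P M (sc M x) p)"
    if "models M EA" "x \<in> carrier M" "p \<in> env M" for M x p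
    using EA_sum(2)[of M g "map p [0..<m]" x] g that env_list[OF that(3), of "[0..<m]"] by (simp add: S_def)
  have Sc: "S M x p \<in> carrier M" and Pc: "P M x p \<in> carrier M"
    if "models M EA" "x \<in> carrier M" "p \<in> env M" for M x p
    using EA_carrier[of M "FSum g" "x # map p [0..<m]"] EA_carrier[of M "FProd f" "x # map p [0..<n]"] f g that
      env_list[OF that(3), of "[0..<m]"] env_list[OF that(3), of "[0..<n]"]
    by (simp_all add: S_def P_def)
  have P01: "P M x p = sc M (zr M) \<or> P M x p = zr M" if "models M EA" "x \<in> carrier M" "p \<in> env M" for M x p
  proof (rule EA_rule[where P = "\<lambda>M x p. P M x p = sc M (zr M) \<or> P M x p = zr M", OF _ _ _ that])
    show "elemd (\<lambda>M e. P M (e 0) (\<lambda>n. e (Suc n)) = sc M (zr M) \<or> P M (e 0) (\<lambda>n. e (Suc n)) = zr M)"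
      by (intro elem_intros eP) simp_all
    fix M x p assume M: "models M EA" "x \<in> carrier M" "p \<in> env M"
      and "P M x p = sc M (zr M) \<or> P M x p = zr M"
    then show "P M (sc M x) p = sc M (zr M) \<or> P M (sc M x) p = zr M"
      using PS[OF M] by (elim disjE) simp_all
  qed (simp add: P0)
  have P1: "P M (sc M x) p = (if P M x p = sc M (zr M) \<and> \<not> Q M x p then sc M (zr M) else zr M)"
    if "models M EA" "x \<in> carrier M" "p \<in> env M" for M x p
    using P01[OF that] PS[OF that] that by (elim disjE) simp_all
  have S1: "P M x p = sc M (zr M) \<longrightarrow> S M x p = x" if "models M EA" "x \<in> carrier M" "p \<in> env M" for M x p
  proof (rule EA_rule[where P = "\<lambda>M x p. P M x p = sc M (zr M) \<longrightarrow> S M x p = x", OF _ _ _ that])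
    show "elemd (\<lambda>M e. P M (e 0) (\<lambda>n. e (Suc n)) = sc M (zr M) \<longrightarrow> S M (e 0) (\<lambda>n. e (Suc n)) = e 0)"
      by (intro elem_intros eP eS) simp_all
    fix M x p assume M: "models M EA" "x \<in> carrier M" "p \<in> env M"
      and IH: "P M x p = sc M (zr M) \<longrightarrow> S M x p = x"
    show "P M (sc M x) p = sc M (zr M) \<longrightarrow> S M (sc M x) p = sc M x"
    proof
      assume 1: "P M (sc M x) p = sc M (zr M)"
      then have "P M x p = sc M (zr M)" using P1[OF M] M by (simp split: if_splits)
      then show "S M (sc M x) p = sc M x" using 1 IH SS[OF M] M by simp
    qed
  qed (simp add: S0)
  \<comment> \<open>Once the product vanishes the sum no longer grows, so \<open>S\<close> stays at
    the first hit.\<close>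
  have Q1: "P M x p = zr M \<longrightarrow> Q M (S M x p) p" if "models M EA" "x \<in> carrier M" "p \<in> env M" for M x p
  proof (rule EA_rule[where P = "\<lambda>M x p. P M x p = zr M \<longrightarrow> Q M (S M x p) p", OF _ _ _ that])
    show "elemd (\<lambda>M e. P M (e 0) (\<lambda>n. e (Suc n)) = zr M \<longrightarrow> Q M (S M (e 0) (\<lambda>n. e (Suc n))) (\<lambda>n. e (Suc n)))"
      by (intro elem_intros eP elemd_sub[OF Q] eS)
    fix M x p assume M: "models M EA" "x \<in> carrier M" "p \<in> env M" and IH: "P M x p = zr M \<longrightarrow> Q M (S M x p) p"
    show "P M (sc M x) p = zr M \<longrightarrow> Q M (S M (sc M x) p) p"
    proof
      assume z: "P M (sc M x) p = zr M"
      then have S: "S M (sc M x) p = S M x p" using SS[OF M] Sc[OF M] M by simp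
      show "Q M (S M (sc M x) p) p"
      proof (cases "P M x p = zr M")
        case False
        then have 1: "P M x p = sc M (zr M)" using P01[OF M] by simp
        then have "Q M x p" using z P1[OF M] M by (simp split: if_splits)
        then show ?thesis using S S1[OF M] 1 by simp
      qed (use IH S in simp)
    qed
  qed (simp add: P0)
  \<comment> \<open>The product is still one at \<open>S x\<close>: the search never runs past a
    hit.\<close>
  have PS1: "P M (S M x p) p = sc M (zr M)" if "models M EA" "x \<in> carrier M" "p \<in> env M" for M x p
  proof (rule EA_rule[where P = "\<lambda>M x p. P M (S M x p) p = sc M (zr M)", OF _ _ _ that])
    show "elemd (\<lambda>M e. P M (S M (e 0) (\<lambda>n. e (Suc n))) (\<lambda>n. e (Suc n)) = sc M (zr M))"
      by (intro elem_intros elemf_sub[OF eP] eS) simp_all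
    fix M x p assume M: "models M EA" "x \<in> carrier M" "p \<in> env M" and IH: "P M (S M x p) p = sc M (zr M)"
    show "P M (S M (sc M x) p) p = sc M (zr M)"
    proof (cases "P M (sc M x) p = zr M")
      case True
      then show ?thesis using IH SS[OF M] Sc[OF M] M by simp
    next
      case False
      then have "P M (sc M x) p = sc M (zr M)" "P M x p = sc M (zr M)"
        using P1[OF M] by (simp_all split: if_splits)
      then show ?thesis using SS[OF M] S1[OF M] M by simp
    qed
  qed (simp add: P0 S0)
  have Sle: "le M (S M x p) x" if "models M EA" "x \<in> carrier M" "p \<in> env M" for M x p
  proof (rule EA_rule[where P = "\<lambda>M x p. le M (S M x p) x", OF _ _ _ that])
    show "elemd (\<lambda>M e. le M (S M (e 0) (\<lambda>n. e (Suc n))) (e 0))"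
      by (intro elem_intros eS)
    fix M x p assume M: "models M EA" "x \<in> carrier M" "p \<in> env M" and IH: "le M (S M x p) x"
    have "le M (S M x p) (sc M x)"
      using IH le_trans[of M "S M x p" x "sc M x"] le_ad[of M x "sc M (zr M)"] Sc[OF M] M by simp
    then show "le M (S M (sc M x) p) (sc M x)"
      using IH SS[OF M] P1[OF M] Sc[OF M] M by (simp split: if_splits)
  qed (simp add: S0)
  have nQ: "lt M z x \<longrightarrow> P M x p = sc M (zr M) \<longrightarrow> \<not> Q M z p"
    if "models M EA" "x \<in> carrier M" "p \<in> env M" "z \<in> carrier M" for M x p z
  proof -
    \<comment> \<open>The number \<open>z\<close> is put in front of the environment, so that the
      induction on \<open>x\<close> treats it as a parameter.\<close>
    have "(\<lambda>M x p. lt M (p 0) x \<longrightarrow> P M x (\<lambda>n. p (Suc n)) = sc M (zr M) \<longrightarrow> \<not> Q M (p 0) (\<lambda>n. p (Suc n)))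
        M x (case_nat z p)"
    proof (rule EA_rule[OF _ _ _ that(1,2)])
      show "elemd (\<lambda>M e. lt M (e (Suc 0)) (e 0) \<longrightarrow> P M (e 0) (\<lambda>n. e (Suc (Suc n))) = sc M (zr M) \<longrightarrow>
           \<not> Q M (e (Suc 0)) (\<lambda>n. e (Suc (Suc n))))"
        by (intro elem_intros elemf_sub[OF eP] elemd_sub[OF Q]) simp_all
      fix M x p assume M: "models M EA" "x \<in> carrier M" "p \<in> env M"
        and IH: "lt M (p 0) x \<longrightarrow> P M x (\<lambda>n. p (Suc n)) = sc M (zr M) \<longrightarrow> \<not> Q M (p 0) (\<lambda>n. p (Suc n))"
      show "lt M (p 0) (sc M x) \<longrightarrow> P M (sc M x) (\<lambda>n. p (Suc n)) = sc M (zr M) \<longrightarrow> \<not> Q M (p 0) (\<lambda>n. p (Suc n))"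
        using IH P1[OF M(1,2) env_Suc[OF M(3)], of Suc] M env_carrier[OF M(3)] lt_le[of M "p 0" x]
        by (cases "p 0 = x") (simp_all split: if_splits)
    qed (use that in \<open>auto simp: lt_iff env_carrier\<close>)
    then show ?thesis by simp
  qed
  show ?thesis
  proof (rule that[OF eS])
    show "S M x p \<in> carrier M \<and> le M (S M x p) x"
      if "models M EA" "x \<in> carrier M" "p \<in> env M" for M x p using Sc Sle that by blast
    show "S M x p = x \<or> Q M (S M x p) p"
      if "models M EA" "x \<in> carrier M" "p \<in> env M" for M x p using P01 Q1 S1 that by blast
    show "\<not> Q M z p" if "models M EA" "x \<in> carrier M" "p \<in> env M" "z \<in> carrier M" "lt M z (S M x p)" for M x p z
      using nQ[of M "S M x p" p z] PS1 Sc that by blast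
  qed
qed

lemma least_number:
  assumes "elemd (\<lambda>M e. Q M (e 0) (\<lambda>n. e (Suc n)))" "models M EA" "p \<in> env M" "x \<in> carrier M" "Q M x p"
  obtains s where "s \<in> carrier M" "Q M s p" "\<And>z. z \<in> carrier M \<Longrightarrow> lt M z s \<Longrightarrow> \<not> Q M z p"
proof -
  obtain S where S: "elemf (\<lambda>M e. S M (e 0) (\<lambda>n. e (Suc n)))" "\<And>M x p. models M EA \<Longrightarrow> x \<in> carrier M \<Longrightarrow> p \<in> env M \<Longrightarrow> S M x p \<in> carrier M \<and> le M (S M x p) x"
    "\<And>M x p. models M EA \<Longrightarrow> x \<in> carrier M \<Longrightarrow> p \<in> env M \<Longrightarrow> S M x p = x \<or> Q M (S M x p) p"
    "\<And>M x p z. models M EA \<Longrightarrow> x \<in> carrier M \<Longrightarrow> p \<in> env M \<Longrightarrow> z \<in> carrier M \<Longrightarrow>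
       lt M z (S M x p) \<Longrightarrow> \<not> Q M z p"
    using bounded_search[OF assms(1)] by blast
  show ?thesis
  proof (rule that[of "S M x p"])
    show "S M x p \<in> carrier M" using S(2)[OF assms(2,4,3)] by blast
    \<comment> \<open>A search that finds nothing below \<open>x\<close> returns \<open>x\<close>,
      and \<open>x\<close> satisfies \<open>Q\<close> by assumption.\<close>
    show "Q M (S M x p) p" using S(3)[OF assms(2,4,3)] assms(5) by metis
    show "\<not> Q M z p" if "z \<in> carrier M" "lt M z (S M x p)" for z
      using S(4)[OF assms(2,4,3) that] .
  qed
qed

text \<open>Unlike in \<open>EA_rule\<close>, base and step are asked for the given \<open>M\<close>
  and \<open>p\<close> only. A counterexample would have a least one, by bounded search, and its
  predecessor contradicts the step.\<close>

lemma EA_induct: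
  assumes Q: "elemd (\<lambda>M e. Q M (e 0) (\<lambda>n. e (Suc n)))" and M: "models M EA" and p: "p \<in> env M"
    and base: "Q M (zr M) p" and step: "\<And>x. x \<in> carrier M \<Longrightarrow> Q M x p \<Longrightarrow> Q M (sc M x) p"
    and x: "x \<in> carrier M"
  shows "Q M x p"
proof (rule ccontr)
  assume "\<not> Q M x p"
  from least_number[where Q = "\<lambda>M x p. \<not> Q M x p", OF elemd_not[OF Q] M p x this]
  obtain s where s: "s \<in> carrier M" "\<not> Q M s p" "\<And>z. z \<in> carrier M \<Longrightarrow> lt M z s \<Longrightarrow> Q M z p" by metis
  then have "s \<noteq> zr M" using base by metis
  then have sp: "sc M (pd M s) = s" using zero_or_succ M s(1) by metis
  then have "lt M (pd M s) s" using M s(1) lt_sc[of M "pd M s" "pd M s"] by simp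
  then have "Q M (pd M s) p" using s M by simp
  from step[OF _ this] show False using sp s M by simp
qed

text \<open>The search below \<open>G\<close> returns \<open>G\<close> exactly when it finds
  nothing, so the bounded quantifier becomes an inequation between terms.\<close>

lemma elemd_bex:
  assumes Q: "elemd (\<lambda>M e. Q M (e 0) (\<lambda>n. e (Suc n)))" and G: "elemf G"
  shows "elemd (\<lambda>M e. \<exists>z\<in>carrier M. lt M z (G M e) \<and> Q M z e)"
proof -
  obtain S where S: "elemf (\<lambda>M e. S M (e 0) (\<lambda>n. e (Suc n)))"
    "\<And>M x p. models M EA \<Longrightarrow> x \<in> carrier M \<Longrightarrow> p \<in> env M \<Longrightarrow> S M x p \<in> carrier M \<and> le M (S M x p) x"
    "\<And>M x p. models M EA \<Longrightarrow> x \<in> carrier M \<Longrightarrow> p \<in> env M \<Longrightarrow> S M x p = x \<or> Q M (S M x p) p"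
    "\<And>M x p z. models M EA \<Longrightarrow> x \<in> carrier M \<Longrightarrow> p \<in> env M \<Longrightarrow> z \<in> carrier M \<Longrightarrow>
       lt M z (S M x p) \<Longrightarrow> \<not> Q M z p"
    using bounded_search[OF assms(1)] by blast
  have "elemd (\<lambda>M e. S M (G M e) e \<noteq> G M e)"
    by (intro elem_intros elemf_subst0[OF S(1)] G)
  then show ?thesis
  proof (rule elemd_cong)
    fix M :: mdl and e assume M: "models M EA" "e \<in> env M"
    have G': "G M e \<in> carrier M" using elemf_carrier[OF G] M by blast
    show "(\<exists>z\<in>carrier M. lt M z (G M e) \<and> Q M z e) = (S M (G M e) e \<noteq> G M e)"
      using S(2-4)[OF M(1) G' M(2)] lt_le[OF M(1) _ G'] by metis
  qed
qed

lemma elemd_ball: "(\<And>i. i < (k :: nat) \<Longrightarrow> elemd (Q i)) \<Longrightarrow> elemd (\<lambda>M e. \<forall>i<k. Q i M e)"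
proof (induction k)
  case 0
  then show ?case using elemd_not[OF elemd_false] by simp
next
  case (Suc k)
  then show ?case using elemd_and[of "Q k" "\<lambda>M e. \<forall>i<k. Q i M e"] by (simp add: All_less_Suc)
qed


subsection \<open>Tuples\<close>

definition tup :: "mdl \<Rightarrow> nat \<Rightarrow> elt list set" where
  "tup M k = {xs. length xs = k \<and> set xs \<subseteq> carrier M}"

definition pre :: "'a list \<Rightarrow> (nat \<Rightarrow> 'a) \<Rightarrow> nat \<Rightarrow> 'a" where
  "pre xs e i = (if i < length xs then xs ! i else e (i - length xs))"

definition blt :: "mdl \<Rightarrow> elt \<Rightarrow> elt list \<Rightarrow> bool" where
  "blt M b xs \<longleftrightarrow> (\<forall>x\<in>set xs. lt M x b)"

lemma tup_0 [simp]: "tup M 0 = {[]}"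
  by (auto simp: tup_def)

lemma tup_length: "xs \<in> tup M k \<Longrightarrow> length xs = k"
  by (simp add: tup_def)

lemma tup_Suc: "xs \<in> tup M (Suc k) \<longleftrightarrow> (\<exists>x ys. xs = x # ys \<and> x \<in> carrier M \<and> ys \<in> tup M k)"
  by (auto simp: tup_def length_Suc_conv)

lemma bex_tup_Suc: "(\<exists>xs\<in>tup M (Suc k). P xs) \<longleftrightarrow> (\<exists>x\<in>carrier M. \<exists>ys\<in>tup M k. P (x # ys))"
  unfolding Bex_def tup_Suc by blast

lemma tup_append: "xs \<in> tup M (m + n) \<longleftrightarrow> (\<exists>ys zs. xs = ys @ zs \<and> ys \<in> tup M m \<and> zs \<in> tup M n)"
proof
  assume "xs \<in> tup M (m + n)"
  then have "xs = take m xs @ drop m xs" "take m xs \<in> tup M m" "drop m xs \<in> tup M n"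
    by (auto simp: tup_def dest: in_set_takeD in_set_dropD)
  then show "\<exists>ys zs. xs = ys @ zs \<and> ys \<in> tup M m \<and> zs \<in> tup M n" by blast
qed (auto simp: tup_def)

lemma bex_tup_append:
  "(\<exists>xs\<in>tup M (m + n). P xs) \<longleftrightarrow> (\<exists>ys\<in>tup M m. \<exists>zs\<in>tup M n. P (ys @ zs))"
  unfolding Bex_def tup_append by blast

lemma tup_snoc: "xs \<in> tup M (Suc k) \<longleftrightarrow> (\<exists>ys x. xs = ys @ [x] \<and> ys \<in> tup M k \<and> x \<in> carrier M)"
  using tup_append[of xs M k 1] by (auto simp: tup_Suc)

lemma bex_tup_snoc: "(\<exists>xs\<in>tup M (Suc k). P xs) \<longleftrightarrow> (\<exists>ys\<in>tup M k. \<exists>x\<in>carrier M. P (ys @ [x]))"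
  unfolding Bex_def tup_snoc by blast

lemma bex_tup_rev: "(\<exists>xs\<in>tup M k. P (rev xs)) \<longleftrightarrow> (\<exists>xs\<in>tup M k. P xs)"
proof -
  have "xs \<in> tup M k \<Longrightarrow> rev xs \<in> tup M k" for xs by (simp add: tup_def)
  then show ?thesis by (metis rev_rev_ident)
qed


lemma pre_env: "xs \<in> tup M k \<Longrightarrow> e \<in> env M \<Longrightarrow> pre xs e \<in> env M"
  by (auto simp: tup_def pre_def env_def)

lemma pre_Nil [simp]: "pre [] e = e"
  by (auto simp: pre_def)

lemma pre_append: "pre (xs @ ys) e = pre xs (pre ys e)"
  by (rule ext) (auto simp: pre_def nth_append)

lemma pre_single [simp]: "pre [x] e = case_nat x e"
  by (rule ext) (auto simp: pre_def split: nat.split)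


lemma pre_map [simp]: "pre (map e [0..<k]) (\<lambda>n. e (n + k)) = e"
  by (auto simp: pre_def)

lemma map_pre [simp]: "length xs = k \<Longrightarrow> map (pre xs e) [0..<k] = xs"
  by (auto simp: pre_def intro!: nth_equalityI)

lemma pre_plus [simp]: "length xs = k \<Longrightarrow> pre xs e (n + k) = e n"
  by (auto simp: pre_def)

lemma elemd_btup:
  assumes "elemd (\<lambda>M e. Q M (map e [0..<k]) (\<lambda>n. e (n + k)))" "elemf G"
  shows "elemd (\<lambda>M e. \<exists>xs\<in>tup M k. blt M (G M e) xs \<and> Q M xs e)"
  using assms
proof (induction k arbitrary: Q G)
  case 0
  then show ?case by (simp add: blt_def)
next
  case (Suc k)
  \<comment> \<open>The head of the tuple is quantified outermost, hence has index \<open>k\<close>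
    above the other \<open>k\<close> entries, while the hypothesis expects it at index 0; this
    permutation mediates.\<close>
  let ?\<rho> = "\<lambda>i. if i = 0 then k else if i \<le> k then i - 1 else i"
  have "elemd (\<lambda>M e. Q M (map (\<lambda>i. e (?\<rho> i)) [0..<Suc k]) (\<lambda>n. e (?\<rho> (n + Suc k))))"
    using elemd_ren[OF Suc.prems(1), of ?\<rho>] by simp
  moreover have "map (\<lambda>i. e (?\<rho> i)) [0..<Suc k] = e k # map e [0..<k]" for e :: "nat \<Rightarrow> elt"
    by (simp add: upt_conv_Cons map_Suc_upt[symmetric] del: upt_Suc)
  moreover have "(\<lambda>n. e (?\<rho> (n + Suc k))) = (\<lambda>n. e (Suc (n + k)))" for e :: "nat \<Rightarrow> elt"
    by auto
  ultimately have 1: "elemd (\<lambda>M e. Q M (e k # map e [0..<k]) (\<lambda>n. e (Suc (n + k))))" by simp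
  have "elemd (\<lambda>M e. \<exists>xs\<in>tup M k. blt M (G M (\<lambda>n. e (Suc n))) xs \<and> Q M (e 0 # xs) (\<lambda>n. e (Suc n)))"
    by (rule Suc.IH[where Q = "\<lambda>M xs e. Q M (e 0 # xs) (\<lambda>n. e (Suc n))"])
      (use 1 elemf_ren[OF Suc.prems(2), of Suc] in simp_all)
  note 2 = elemd_bex[where Q = "\<lambda>M x e. \<exists>xs\<in>tup M k. blt M (G M e) xs \<and> Q M (x # xs) e", OF this Suc.prems(2)]
  have eq: "(\<exists>z\<in>carrier M. lt M z b \<and> (\<exists>xs\<in>tup M k. blt M b xs \<and> P (z # xs))) \<longleftrightarrow>
      (\<exists>xs\<in>tup M (Suc k). blt M b xs \<and> P xs)" for M b P
    unfolding bex_tup_Suc by (auto simp: blt_def)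
  show ?case by (rule elemd_cong[OF 2]) (simp add: eq[symmetric])
qed


subsection \<open>Existential relations, uniformly in all models\<close>

definition sigd :: "(mdl \<Rightarrow> (nat \<Rightarrow> elt) \<Rightarrow> bool) \<Rightarrow> bool" where
  "sigd Q \<longleftrightarrow> (\<exists>n R. elemd R \<and>
     (\<forall>M e. models M EA \<longrightarrow> e \<in> env M \<longrightarrow> (Q M e \<longleftrightarrow> (\<exists>ws\<in>tup M n. R M (pre ws e)))))"

named_theorems sig_intros


lemma sigd_elemd: "elemd Q \<Longrightarrow> sigd Q"
  unfolding sigd_def by (intro exI[of _ 0] exI[of _ Q]) simp

lemma sigd_and [sig_intros]:
  assumes "sigd P" "sigd Q" shows "sigd (\<lambda>M e. P M e \<and> Q M e)"
proof -
  obtain n R where R: "elemd R" "\<And>M e. models M EA \<Longrightarrow> e \<in> env M \<Longrightarrow> P M e \<longleftrightarrow> (\<exists>ws\<in>tup M n. R M (pre ws e))"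
    using assms(1)[unfolded sigd_def] by blast
  obtain m S where S: "elemd S" "\<And>M e. models M EA \<Longrightarrow> e \<in> env M \<Longrightarrow> Q M e \<longleftrightarrow> (\<exists>ws\<in>tup M m. S M (pre ws e))"
    using assms(2)[unfolded sigd_def] by blast
  \<comment> \<open>The witnesses of \<open>P\<close> come first and those of \<open>Q\<close> next;
    each renaming skips the witnesses of the other relation.\<close>
  let ?\<rho> = "\<lambda>i. if i < n then i else i + m" and ?\<tau> = "\<lambda>i. i + n"
  let ?T = "\<lambda>M e. R M (\<lambda>i. e (?\<rho> i)) \<and> S M (\<lambda>i. e (?\<tau> i))"
  have "elemd ?T" by (rule elemd_and[OF elemd_ren[OF R(1)] elemd_ren[OF S(1)]])
  moreover have "P M e \<and> Q M e \<longleftrightarrow> (\<exists>ws\<in>tup M (n + m). ?T M (pre ws e))"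
    if "models M EA" "e \<in> env M" for M e
  proof -
    have "(\<lambda>i. pre (us @ vs) e (?\<rho> i)) = pre us e" "(\<lambda>i. pre (us @ vs) e (?\<tau> i)) = pre vs e"
      if "us \<in> tup M n" "vs \<in> tup M m" for us vs
      using that[THEN tup_length] by (auto simp: pre_def nth_append fun_eq_iff)
    then show ?thesis unfolding R(2)[OF that] S(2)[OF that] bex_tup_append by auto
  qed
  ultimately show ?thesis unfolding sigd_def by (intro exI[of _ "n + m"] exI[of _ ?T]) blast
qed

lemma sigd_extup [sig_intros]:
  assumes "sigd (\<lambda>M e. Q M (map e [0..<k]) (\<lambda>n. e (n + k)))"
  shows "sigd (\<lambda>M e. \<exists>xs\<in>tup M k. Q M xs e)"
proof -
  obtain n R where R: "elemd R" "\<And>M e. models M EA \<Longrightarrow> e \<in> env M \<Longrightarrow>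
      Q M (map e [0..<k]) (\<lambda>n. e (n + k)) \<longleftrightarrow> (\<exists>ws\<in>tup M n. R M (pre ws e))"
    using assms(1)[unfolded sigd_def] by blast
  have "(\<exists>xs\<in>tup M k. Q M xs e) \<longleftrightarrow> (\<exists>ws\<in>tup M (n + k). R M (pre ws e))"
    if M: "models M EA" "e \<in> env M" for M e
  proof -
    have "Q M xs e \<longleftrightarrow> (\<exists>ws\<in>tup M n. R M (pre (ws @ xs) e))" if "xs \<in> tup M k" for xs
      using R(2)[OF M(1) pre_env[OF that M(2)]] tup_length[OF that] by (simp add: pre_append)
    then show ?thesis unfolding bex_tup_append by blast
  qed
  then show ?thesis using R(1) unfolding sigd_def by (intro exI[of _ "n + k"] exI[of _ R]) blast
qed

lemma sigd_ex [sig_intros]: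
  assumes "sigd (\<lambda>M e. Q M (e 0) (\<lambda>n. e (Suc n)))"
  shows "sigd (\<lambda>M e. \<exists>x\<in>carrier M. Q M x e)"
proof -
  have "sigd (\<lambda>M e. \<exists>xs\<in>tup M (Suc 0). Q M (hd xs) e)"
    by (rule sigd_extup) (use assms in simp)
  then show ?thesis by (simp add: bex_tup_Suc)
qed

lemma sigd_subst_all:
  assumes "sigd Q" "\<And>n. elemf (G n)" shows "sigd (\<lambda>M e. Q M (\<lambda>n. G n M e))"
proof -
  obtain n R where R: "elemd R" "\<And>M e. models M EA \<Longrightarrow> e \<in> env M \<Longrightarrow> Q M e \<longleftrightarrow> (\<exists>ws\<in>tup M n. R M (pre ws e))"
    using assms(1)[unfolded sigd_def] by blast
  let ?G = "\<lambda>i M e. if i < n then e i else G (i - n) M (\<lambda>j. e (j + n))"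
  have "elemf (?G i)" for i
    using elemf_var elemf_ren[OF assms(2)] by (cases "i < n") auto
  then have "elemd (\<lambda>M e. R M (\<lambda>i. ?G i M e))" by (rule elemd_subst_all[OF R(1)])
  moreover have "Q M (\<lambda>n. G n M e) \<longleftrightarrow> (\<exists>ws\<in>tup M n. R M (\<lambda>i. ?G i M (pre ws e)))"
    if M: "models M EA" "e \<in> env M" for M e
  proof -
    have "(\<lambda>n. G n M e) \<in> env M" using elemf_carrier[OF assms(2) M] by (auto simp: env_def)
    moreover have "(\<lambda>i. ?G i M (pre ws e)) = pre ws (\<lambda>n. G n M e)" if "ws \<in> tup M n" for ws
      using tup_length[OF that] by (intro ext) (simp add: pre_def)
    ultimately show ?thesis using R(2)[OF M(1)] by simp
  qed
  ultimately show ?thesis unfolding sigd_def by (intro exI[of _ n] exI[of _ "\<lambda>M e. R M (\<lambda>i. ?G i M e)"]) blast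
qed

lemma sigd_ren: "sigd Q \<Longrightarrow> sigd (\<lambda>M e. Q M (\<lambda>n. e (\<rho> n)))"
  by (rule sigd_subst_all[OF _ elemf_var])

text \<open>A single bound for all witnesses replaces their coding as a tuple.\<close>

lemma blt_mono:
  assumes "models M EA" "set ws \<subseteq> carrier M" "u \<in> carrier M" "v \<in> carrier M" "blt M u ws" "le M u v"
  shows "blt M v ws"
  using assms lt_le_trans unfolding blt_def by (metis subsetD)

lemma ex_blt:
  assumes "models M EA"
  shows "set ws \<subseteq> carrier M \<Longrightarrow> \<exists>u\<in>carrier M. blt M u ws"
proof (induction ws)
  case Nil
  then show ?case using EA_carriers(1)[OF assms] by (auto simp: blt_def)
next
  case (Cons w ws)
  then obtain u where u: "u \<in> carrier M" "blt M u ws" by auto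
  let ?v = "ad M u (sc M w)"
  have "le M u ?v" using Cons.prems u assms by (intro le_ad) simp_all
  then have "blt M ?v ws" using Cons.prems u assms by (intro blt_mono[OF assms _ u(1) _ u(2)]) simp_all
  moreover have "lt M w ?v" using Cons.prems u assms by simp
  ultimately show ?case using Cons.prems u assms by (intro bexI[of _ ?v]) (auto simp: blt_def)
qed

text \<open>\<open>B M u\<close> says that there are witnesses all below \<open>u\<close>.
  Monotonicity in \<open>u\<close> is essential later: what has been found at one stage of a search
  remains found at all later stages.\<close>

lemma sigd_bounded:
  assumes "sigd Q"
  obtains B where "elemd (\<lambda>M e. B M (e 0) (\<lambda>n. e (Suc n)))"
    "\<And>M e. models M EA \<Longrightarrow> e \<in> env M \<Longrightarrow> Q M e \<longleftrightarrow> (\<exists>u\<in>carrier M. B M u e)"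
    "\<And>M e u v. models M EA \<Longrightarrow> e \<in> env M \<Longrightarrow> u \<in> carrier M \<Longrightarrow> v \<in> carrier M \<Longrightarrow> B M u e \<Longrightarrow> le M u v \<Longrightarrow> B M v e"
proof -
  obtain n R where R: "elemd R" "\<And>M e. models M EA \<Longrightarrow> e \<in> env M \<Longrightarrow> Q M e \<longleftrightarrow> (\<exists>ws\<in>tup M n. R M (pre ws e))"
    using assms(1)[unfolded sigd_def] by blast
  let ?B = "\<lambda>M u e. \<exists>ws\<in>tup M n. blt M u ws \<and> R M (pre ws e)"
  let ?\<rho> = "\<lambda>i. if i < n then i else Suc i"
  have "elemd (\<lambda>M e. \<exists>ws\<in>tup M n. blt M (e 0) ws \<and> R M (pre ws (\<lambda>n. e (Suc n))))"
  proof (rule elemd_btup[where G = "\<lambda>M e. e 0" and Q = "\<lambda>M ws e. R M (pre ws (\<lambda>n. e (Suc n)))"])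
    have "pre (map e [0..<n]) (\<lambda>i. e (Suc i + n)) = (\<lambda>i. e (?\<rho> i))" for e :: "nat \<Rightarrow> elt"
      by (rule ext) (auto simp: pre_def)
    then show "elemd (\<lambda>M e. R M (pre (map e [0..<n]) (\<lambda>i. e (Suc i + n))))"
      using elemd_ren[OF R(1), of ?\<rho>] by simp
  qed (rule elemf_var)
  moreover have "Q M e \<longleftrightarrow> (\<exists>u\<in>carrier M. ?B M u e)" if "models M EA" "e \<in> env M" for M e
  proof -
    have "\<exists>u\<in>carrier M. blt M u ws" if "ws \<in> tup M n" for ws
      using ex_blt[OF \<open>models M EA\<close>] that by (simp add: tup_def)
    then show ?thesis unfolding R(2)[OF that] by blast
  qed
  moreover have "?B M v e" if "models M EA" "e \<in> env M" "u \<in> carrier M" "v \<in> carrier M" "?B M u e" "le M u v" for M e u v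
    using that(5) blt_mono[OF that(1) _ that(3,4) _ that(6)] by (auto simp: tup_def)
  ultimately show ?thesis by (rule that[of ?B])
qed

section \<open>Existential relations and \<Sigma>1 formulas\<close>

lemma ball_tup_Suc: "(\<forall>xs\<in>tup M (Suc k). P xs) \<longleftrightarrow> (\<forall>x\<in>carrier M. \<forall>ys\<in>tup M k. P (x # ys))"
  unfolding Ball_def tup_Suc by blast

lemma ball_tup_snoc: "(\<forall>xs\<in>tup M (Suc k). P xs) \<longleftrightarrow> (\<forall>ys\<in>tup M k. \<forall>x\<in>carrier M. P (ys @ [x]))"
  unfolding Ball_def tup_snoc by blast

text \<open>The outermost quantifier has the highest index and supplies the last entry of
  \<open>ws\<close>, so tuples are split at their end.\<close>

lemma sat_Ex_pow: "sat M e ((Ex ^^ n) \<phi>) \<longleftrightarrow> (\<exists>ws\<in>tup M n. sat M (pre ws e) \<phi>)"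
proof (induction n arbitrary: e)
  case (Suc n)
  have "sat M e ((Ex ^^ Suc n) \<phi>) \<longleftrightarrow> (\<exists>x\<in>carrier M. sat M (case_nat x e) ((Ex ^^ n) \<phi>))"
    by simp
  also have "\<dots> \<longleftrightarrow> (\<exists>ws\<in>tup M (Suc n). sat M (pre ws e) \<phi>)"
    unfolding Suc.IH bex_tup_snoc by (auto simp: pre_append)
  finally show ?case .
qed simp

lemma sat_All_pow: "sat M e ((All ^^ n) \<phi>) \<longleftrightarrow> (\<forall>ws\<in>tup M n. sat M (pre ws e) \<phi>)"
proof (induction n arbitrary: e)
  case (Suc n)
  have "sat M e ((All ^^ Suc n) \<phi>) \<longleftrightarrow> (\<forall>x\<in>carrier M. sat M (case_nat x e) ((All ^^ n) \<phi>))"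
    by simp
  also have "\<dots> \<longleftrightarrow> (\<forall>ws\<in>tup M (Suc n). sat M (pre ws e) \<phi>)"
    unfolding Suc.IH ball_tup_snoc by (auto simp: pre_append)
  finally show ?case .
qed simp

lemma sat_Conj: "sat M e (Conj \<phi>s) \<longleftrightarrow> (\<forall>\<phi>\<in>set \<phi>s. sat M e \<phi>)"
  by (induction \<phi>s) auto

lemma wf_Ex_pow: "wf_fm ((Ex ^^ n) \<phi>) \<longleftrightarrow> wf_fm \<phi>"
  by (induction n) auto

lemma wf_All_pow: "wf_fm ((All ^^ n) \<phi>) \<longleftrightarrow> wf_fm \<phi>"
  by (induction n) auto

lemma wf_Conj: "wf_fm (Conj \<phi>s) \<longleftrightarrow> (\<forall>\<phi>\<in>set \<phi>s. wf_fm \<phi>)"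
  by (induction \<phi>s) auto

lemma fv_Ex_pow: "fv ((Ex ^^ n) \<phi>) = {i. i + n \<in> fv \<phi>}"
  by (induction n) auto

lemma Sigma1_Ex_pow: "Sigma1 \<phi> \<Longrightarrow> Sigma1 ((Ex ^^ n) \<phi>)"
  by (induction n) (auto intro: Sigma1.intros)

lemma qfree_bounded: "qfree \<phi> \<Longrightarrow> bounded_fm \<phi>"
  by (induction \<phi>) (auto intro: bounded_fm.intros)

lemma fv_subst_tm_bound: "(\<And>i. fv_tm (\<sigma> i) \<subseteq> {..<m}) \<Longrightarrow> fv_tm (subst_tm \<sigma> t) \<subseteq> {..<m}"
  by (induction t) auto

lemma fv_lift_tm: "fv_tm (lift_tm t) = Suc ` fv_tm t"
  by (induction t) auto

lemma fv_subst_bound: "(\<And>i. fv_tm (\<sigma> i) \<subseteq> {..<m}) \<Longrightarrow> fv (subst \<sigma> \<phi>) \<subseteq> {..<m}"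
proof (induction \<phi> arbitrary: \<sigma> m)
  case (Eq s t)
  then show ?case using fv_subst_tm_bound[OF Eq] by simp
next
  case (All \<phi>)
  have "fv (subst (case_nat (Var 0) (\<lambda>n. lift_tm (\<sigma> n))) \<phi>) \<subseteq> {..<Suc m}"
  proof (rule All.IH)
    show "fv_tm (case_nat (Var 0) (\<lambda>n. lift_tm (\<sigma> n)) i) \<subseteq> {..<Suc m}" for i
      using All.prems by (auto simp: fv_lift_tm split: nat.split)
  qed
  then show ?case by auto
qed auto

lemma elemd_sat: "bounded_fm \<phi> \<Longrightarrow> wf_fm \<phi> \<Longrightarrow> elemd (\<lambda>M e. sat M e \<phi>)"
proof (induction rule: bounded_fm.induct[case_names Bot Eq Imp All_le])
  case Bot
  then show ?case by (simp add: elemd_false)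
next
  case (Eq s t)
  then show ?case by (auto intro: elem_intros elemf_eval)
next
  case (Imp \<phi> \<psi>)
  then show ?case by (auto intro: elem_intros)
next
  case (All_le \<phi> t)
  have wt: "wf_tm t"
  proof -
    have "wf_tm (lift_tm t)" using All_le.prems by simp
    then show ?thesis by (induction t) auto
  qed
  \<comment> \<open>Bounded search is strict, so \<open>x \<le> t\<close> is read as
    \<open>x < t + 1\<close>.\<close>
  have "elemd (\<lambda>M e. \<not> (\<exists>x\<in>carrier M. lt M x (sc M (eval M e t)) \<and> \<not> sat M (case_nat x e) \<phi>))"
  proof (intro elemd_not elemd_bex)
    have "case_nat (e 0) (\<lambda>n. e (Suc n)) = e" for e :: "nat \<Rightarrow> elt"
      by (rule ext) (simp split: nat.split)
    then show "elemd (\<lambda>M e. sat M (case_nat (e 0) (\<lambda>n. e (Suc n))) \<phi>)"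
      using All_le by simp
    show "elemf (\<lambda>M e. sc M (eval M e t))" using wt by (intro elem_intros elemf_eval) simp_all
  qed
  then show ?case
  proof (rule elemd_cong)
    fix M :: mdl and e assume M: "models M EA" "e \<in> env M"
    then have "eval M e t \<in> carrier M" using elemf_carrier[OF elemf_eval[OF wt]] by blast
    then show "sat M e (All (Imp (Le (Var 0) (lift_tm t)) \<phi>)) \<longleftrightarrow>
        \<not> (\<exists>x\<in>carrier M. lt M x (sc M (eval M e t)) \<and> \<not> sat M (case_nat x e) \<phi>)"
      using M by (auto simp: le_def eval_subst_tm)
  qed
qed

lemma sigd_sat: "Sigma1 \<phi> \<Longrightarrow> wf_fm \<phi> \<Longrightarrow> sigd (\<lambda>M e. sat M e \<phi>)"
proof (induction rule: Sigma1.induct[case_names bounded Ex])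
  case (bounded \<phi>)
  then show ?case by (intro sigd_elemd elemd_sat)
next
  case (Ex \<phi>)
  have "case_nat (e 0) (\<lambda>n. e (Suc n)) = e" for e :: "nat \<Rightarrow> elt"
    by (rule ext) (simp split: nat.split)
  then have "sigd (\<lambda>M e. \<exists>x\<in>carrier M. sat M (case_nat x e) \<phi>)"
    using Ex by (intro sigd_ex) simp
  then show ?case by simp
qed

lemma sigd_formula:
  assumes "sigd Q"
  obtains \<theta> where "wf_fm \<theta>" "Sigma1 \<theta>" "fv \<theta> \<subseteq> {..<k}"
    "\<And>M xs e. models M EA \<Longrightarrow> xs \<in> tup M k \<Longrightarrow> e \<in> env M \<Longrightarrow>
      sat M (pre xs e) \<theta> \<longleftrightarrow> Q M (pre xs (\<lambda>_. zr M))"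
proof -
  obtain n R where R: "elemd R" "\<And>M e. models M EA \<Longrightarrow> e \<in> env M \<Longrightarrow> Q M e \<longleftrightarrow> (\<exists>ws\<in>tup M n. R M (pre ws e))"
    using assms(1)[unfolded sigd_def] by blast
  from R(1) obtain \<phi> where \<phi>: "wf_fm \<phi>" "qfree \<phi>"
    "\<And>M e. models M EA \<Longrightarrow> e \<in> env M \<Longrightarrow> (R M e \<longleftrightarrow> sat M e \<phi>)" unfolding elemd_def by blast
  \<comment> \<open>Indices below \<open>n\<close> are witnesses and the next \<open>k\<close> the
    tuple; all others become zero, which leaves no parameters.\<close>
  define \<sigma> where "\<sigma> = (\<lambda>i. if i < n + k then Var i else zero)"
  let ?\<theta> = "(Ex ^^ n) (subst \<sigma> \<phi>)"
  show ?thesis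
  proof (rule that[of ?\<theta>])
    show "wf_fm ?\<theta>" using \<phi>(1) by (auto simp: wf_Ex_pow \<sigma>_def intro!: wf_subst)
    show "Sigma1 ?\<theta>"
      by (intro Sigma1_Ex_pow Sigma1.intros qfree_bounded) (simp add: qfree_subst \<phi>(2))
    have "fv (subst \<sigma> \<phi>) \<subseteq> {..<n + k}" by (rule fv_subst_bound) (simp add: \<sigma>_def)
    then show "fv ?\<theta> \<subseteq> {..<k}" by (auto simp: fv_Ex_pow)
    fix M :: mdl and xs e assume M: "models M EA" "xs \<in> tup M k" "e \<in> env M"
    have z: "(\<lambda>_. zr M) \<in> env M" using M by (auto simp: env_def)
    have "sat M (pre ws (pre xs e)) (subst \<sigma> \<phi>) \<longleftrightarrow> R M (pre ws (pre xs (\<lambda>_. zr M)))" if "ws \<in> tup M n" for ws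
    proof -
      have "(\<lambda>i. eval M (pre ws (pre xs e)) (\<sigma> i)) = pre ws (pre xs (\<lambda>_. zr M))"
        using tup_length[OF that] tup_length[OF M(2)] by (intro ext) (auto simp: pre_def \<sigma>_def)
      then show ?thesis using \<phi>(3)[OF M(1) pre_env[OF that pre_env[OF M(2) z]]] by (simp add: sat_subst)
    qed
    then show "sat M (pre xs e) ?\<theta> \<longleftrightarrow> Q M (pre xs (\<lambda>_. zr M))"
      using R(2)[OF M(1) pre_env[OF M(2) z]] by (simp add: sat_Ex_pow)
  qed
qed


subsection \<open>Least tuples\<close>

fun lexle :: "mdl \<Rightarrow> elt list \<Rightarrow> elt list \<Rightarrow> bool" where
  "lexle M [] [] \<longleftrightarrow> True"
| "lexle M (x # xs) (y # ys) \<longleftrightarrow> lt M x y \<or> x = y \<and> lexle M xs ys"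
| "lexle M _ _ \<longleftrightarrow> False"

definition least :: "mdl \<Rightarrow> nat \<Rightarrow> (elt list \<Rightarrow> bool) \<Rightarrow> elt list \<Rightarrow> bool" where
  "least M k P as \<longleftrightarrow> as \<in> tup M k \<and> P as \<and> (\<forall>bs\<in>tup M k. P bs \<longrightarrow> lexle M as bs)"

definition sigt :: "nat \<Rightarrow> (mdl \<Rightarrow> elt list \<Rightarrow> bool) \<Rightarrow> bool" where
  "sigt k Q \<longleftrightarrow> sigd (\<lambda>M e. Q M (map e [0..<k]))"

text \<open>The schema in semantic form. Absence of parameters is encoded by uniformity: one
  existential definition of \<open>Q\<close> serves all models and reads only the \<open>k\<close>
  entries of the tuple.\<close>

definition Lsem :: "nat \<Rightarrow> mdl \<Rightarrow> bool" where
  "Lsem k M \<longleftrightarrow> models M EA \<and>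
    (\<forall>Q. sigt k Q \<longrightarrow> (\<exists>xs\<in>tup M k. Q M xs) \<longrightarrow> (\<exists>as. least M k (Q M) as))"

text \<open>The condition at place 0 deals with tuples that have another first entry, by trichotomy;
  the remaining conditions are the same statement for \<open>P\<close> with the first entry
  fixed.\<close>

lemma least_prefix:
  assumes "models M EA" "as \<in> tup M k"
  shows "(\<forall>i<k. \<forall>z\<in>carrier M. lt M z (as ! i) \<longrightarrow> (\<forall>ys\<in>tup M (k - Suc i). \<not> P (take i as @ z # ys)))
    \<longleftrightarrow> (\<forall>bs\<in>tup M k. P bs \<longrightarrow> lexle M as bs)"
  using assms(2)
proof (induction k arbitrary: as P)
  case 0
  then show ?case by simp
next
  case (Suc k)
  then obtain a as' where as: "as = a # as'" "a \<in> carrier M" "as' \<in> tup M k" by (auto simp: tup_Suc)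
  have tri: "lt M a b \<or> a = b \<or> lt M b a" "\<not> (lt M b a \<and> lt M a b)" "\<not> lt M a a" if "b \<in> carrier M" for b
    using that as(2) assms(1) by (metis lt_le le_linear, metis lt_le le_antisym, metis lt_le)
  have "(\<forall>bs\<in>tup M (Suc k). P bs \<longrightarrow> lexle M as bs) \<longleftrightarrow>
     (\<forall>b\<in>carrier M. \<forall>bs\<in>tup M k. P (b # bs) \<longrightarrow> lt M a b \<or> a = b \<and> lexle M as' bs)"
    unfolding ball_tup_Suc as(1) lexle.simps by blast
  also have "\<dots> \<longleftrightarrow> (\<forall>z\<in>carrier M. lt M z a \<longrightarrow> (\<forall>ys\<in>tup M k. \<not> P (z # ys))) \<and>
      (\<forall>bs\<in>tup M k. P (a # bs) \<longrightarrow> lexle M as' bs)"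
    using tri as(2) by blast
  finally show ?case
    using Suc.IH[OF as(3), of "\<lambda>bs. P (a # bs)"] by (simp add: All_less_Suc2 as(1))
qed

text \<open>Lists have \<open>x_1\<close> in front whereas \<open>x_1\<close> has the highest index,
  hence \<open>rev\<close>. Places are counted from 0 here and from 1 in the axiom, hence
  \<open>Suc i\<close>.\<close>

lemma sat_least_tuple_axiom:
  fixes M :: mdl
  defines "P \<equiv> \<lambda>\<theta> e xs. sat M (pre (rev xs) e) \<theta>"
  shows "sat M e (least_tuple_axiom k \<theta>) \<longleftrightarrow> ((\<exists>xs\<in>tup M k. P \<theta> e xs) \<longrightarrow>
    (\<exists>as\<in>tup M k. \<forall>i<k. (\<exists>ys\<in>tup M (k - Suc i). P \<theta> e (take (Suc i) as @ ys)) \<and>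
      (\<forall>z\<in>carrier M. lt M z (as ! i) \<longrightarrow> (\<forall>ys\<in>tup M (k - Suc i). \<not> P \<theta> e (take i as @ z # ys)))))"
proof -
  have tl: "sat M (pre ws (pre (rev as) e)) (subst_tail k (Suc i) \<theta>) \<longleftrightarrow> P \<theta> e (take (Suc i) as @ rev ws)"
    if "i < k" "as \<in> tup M k" "ws \<in> tup M (k - Suc i)" for i as ws
  proof -
    have "(\<lambda>n. eval M (pre ws (pre (rev as) e)) (if n < k - Suc i then Var n else Var (n + (k - Suc i))))
        = pre (rev (take (Suc i) as @ rev ws)) e"
      using that[unfolded tup_def] by (intro ext) (auto simp: pre_def rev_take nth_append)
    then show ?thesis by (simp add: subst_tail_def sat_subst P_def)
  qed
  have bl: "sat M (pre ws (case_nat z (pre (rev as) e))) (subst_below k (Suc i) \<theta>) \<longleftrightarrow>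
      P \<theta> e (take i as @ z # rev ws)"
    if "i < k" "as \<in> tup M k" "ws \<in> tup M (k - Suc i)" for i as ws z
  proof -
    have "(\<lambda>n. eval M (pre ws (pre [z] (pre (rev as) e)))
          (if n \<le> k - Suc i then Var n else Var (n + (k - Suc i) + 1)))
        = pre (rev (take i as @ z # rev ws)) e"
      using that[unfolded tup_def] by (intro ext) (auto simp: pre_def rev_take nth_append nth_Cons')
    then show ?thesis by (simp add: subst_below_def sat_subst P_def)
  qed
  have le: "sat M (case_nat z (pre (rev as) e)) (Less (Var 0) (Var (k - Suc i + 1))) \<longleftrightarrow> lt M z (as ! i)"
    if "i < k" "as \<in> tup M k" for i as z
  proof -
    have "k - Suc (k - Suc i) = i" using that by simp
    then have "pre (rev as) e (k - Suc i) = as ! i"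
      using that tup_length[OF that(2)] by (simp add: pre_def rev_nth)
    then show ?thesis by (simp only: sat.simps eval.simps list.map lt_def le_def) simp
  qed
  let ?A = "\<lambda>i. And ((Ex ^^ (k - i)) (subst_tail k i \<theta>))
          (All (Imp (Less (Var 0) (Var (k - i + 1))) ((All ^^ (k - i)) (Neg (subst_below k i \<theta>)))))"
  have A: "sat M (pre (rev as) e) (?A (Suc i)) \<longleftrightarrow> (\<exists>ys\<in>tup M (k - Suc i). P \<theta> e (take (Suc i) as @ ys)) \<and>
      (\<forall>z\<in>carrier M. lt M z (as ! i) \<longrightarrow> (\<forall>ys\<in>tup M (k - Suc i). \<not> P \<theta> e (take i as @ z # ys)))"
    if "i < k" "as \<in> tup M k" for i as
  proof -
    have "sat M (pre (rev as) e) (?A (Suc i)) \<longleftrightarrow>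
      (\<exists>ws\<in>tup M (k - Suc i). P \<theta> e (take (Suc i) as @ rev ws)) \<and>
      (\<forall>z\<in>carrier M. lt M z (as ! i) \<longrightarrow> \<not> (\<exists>ws\<in>tup M (k - Suc i). P \<theta> e (take i as @ z # rev ws)))"
      using tl[OF that] bl[OF that] le[OF that] unfolding sat.simps sat_Ex_pow sat_All_pow by auto
    then show ?thesis
      unfolding bex_tup_rev[of M _ "\<lambda>ws. P \<theta> e (take (Suc i) as @ ws)"]
        bex_tup_rev[of M _ "\<lambda>ws. P \<theta> e (take i as @ _ # ws)"] by blast
  qed
  have "sat M e (least_tuple_axiom k \<theta>) \<longleftrightarrow> ((\<exists>xs\<in>tup M k. P \<theta> e xs) \<longrightarrow>
     (\<exists>ws\<in>tup M k. \<forall>i<k. sat M (pre ws e) (?A (Suc i))))"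
  proof -
    have "set [1..<k + 1] = Suc ` {..<k}" by (auto simp: image_Suc_lessThan)
    then have "sat M e' (Conj (map ?A [1..<k + 1])) \<longleftrightarrow> (\<forall>i<k. sat M e' (?A (Suc i)))" for e'
      unfolding sat_Conj set_map by auto
    moreover have "(\<exists>xs\<in>tup M k. P \<theta> e xs) \<longleftrightarrow> sat M e ((Ex ^^ k) \<theta>)"
      unfolding sat_Ex_pow P_def by (rule bex_tup_rev)
    ultimately show ?thesis unfolding least_tuple_axiom_def sat.simps(3) sat_Ex_pow by simp
  qed
  also have "(\<exists>ws\<in>tup M k. \<forall>i<k. sat M (pre ws e) (?A (Suc i))) \<longleftrightarrow>
     (\<exists>as\<in>tup M k. \<forall>i<k. sat M (pre (rev as) e) (?A (Suc i)))"
    by (rule bex_tup_rev[symmetric])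
  finally show ?thesis using A by simp
qed

lemma wf_least_tuple_axiom: "wf_fm \<theta> \<Longrightarrow> wf_fm (least_tuple_axiom k \<theta>)"
  by (auto simp: least_tuple_axiom_def wf_Ex_pow wf_All_pow wf_Conj subst_tail_def subst_below_def
      intro!: wf_subst)

lemma least_tuple_axiom_least:
  assumes M: "models M EA"
  shows "sat M e (least_tuple_axiom k \<theta>) \<longleftrightarrow> ((\<exists>xs\<in>tup M k. sat M (pre (rev xs) e) \<theta>) \<longrightarrow>
    (\<exists>as. least M k (\<lambda>xs. sat M (pre (rev xs) e) \<theta>) as))"
proof -
  let ?P = "\<lambda>xs. sat M (pre (rev xs) e) \<theta>"
  have "(\<exists>as\<in>tup M k. \<forall>i<k. (\<exists>ys\<in>tup M (k - Suc i). ?P (take (Suc i) as @ ys)) \<and>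
      (\<forall>z\<in>carrier M. lt M z (as ! i) \<longrightarrow> (\<forall>ys\<in>tup M (k - Suc i). \<not> ?P (take i as @ z # ys))))
    \<longleftrightarrow> (\<exists>as. least M k ?P as)" (is "?L \<longleftrightarrow> ?R") if ne: "\<exists>xs\<in>tup M k. ?P xs"
  proof
    assume ?L
    then obtain as where as: "as \<in> tup M k" "\<forall>i<k. \<exists>ys\<in>tup M (k - Suc i). ?P (take (Suc i) as @ ys)"
      "\<forall>i<k. \<forall>z\<in>carrier M. lt M z (as ! i) \<longrightarrow> (\<forall>ys\<in>tup M (k - Suc i). \<not> ?P (take i as @ z # ys))" by blast
    \<comment> \<open>At the last place nothing is left to be extended, so the condition there is
      membership of the whole tuple. For \<open>k = 0\<close> there is no such place, and the
      assumption that some tuple exists takes over.\<close>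
    have "?P as"
    proof (cases k)
      case 0
      then show ?thesis using ne as(1) by auto
    next
      case (Suc j)
      then show ?thesis using as(2)[rule_format, of j] as(1) tup_length by force
    qed
    then have "least M k ?P as" using as least_prefix[OF M as(1), of ?P] by (simp add: least_def)
    then show ?R ..
  next
    assume ?R
    then obtain as where as: "as \<in> tup M k" "?P as" "\<forall>bs\<in>tup M k. ?P bs \<longrightarrow> lexle M as bs"
      by (auto simp: least_def)
    have "\<exists>ys\<in>tup M (k - Suc i). ?P (take (Suc i) as @ ys)" if "i < k" for i
      using as(1,2) that by (intro bexI[of _ "drop (Suc i) as"])
        (auto simp: tup_def dest: in_set_dropD simp del: rev_append)
    then show ?L using as least_prefix[OF M as(1), of ?P] by blast
  qed
  then show ?thesis unfolding sat_least_tuple_axiom by blast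
qed

lemma models_EA_LSigma1: "models M (LSigma1 k) \<Longrightarrow> models M EA"
  by (rule models_mono) (auto simp: LSigma1_def)

lemma models_LSigma1: "models M (LSigma1 k) \<longleftrightarrow> Lsem k M"
proof
  assume L: "models M (LSigma1 k)"
  then have M: "models M EA" by (rule models_EA_LSigma1)
  have "\<exists>as. least M k (Q M) as" if Q: "sigt k Q" "\<exists>xs\<in>tup M k. Q M xs" for Q
  proof -
    \<comment> \<open>Reverses the first \<open>k\<close> indices, to pass from the order of lists
      to the order of indices in the axiom.\<close>
    have "sigd (\<lambda>M e. Q M (map (\<lambda>i. e (if i < k then k - Suc i else i)) [0..<k]))"
      using sigd_ren[OF Q(1)[unfolded sigt_def]] .
    from sigd_formula[OF this, of k] obtain \<theta> where \<theta>: "wf_fm \<theta>" "Sigma1 \<theta>" "fv \<theta> \<subseteq> {..<k}"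
      "\<And>M xs e. models M EA \<Longrightarrow> xs \<in> tup M k \<Longrightarrow> e \<in> env M \<Longrightarrow>
        sat M (pre xs e) \<theta> \<longleftrightarrow> Q M (map (\<lambda>i. pre xs (\<lambda>_. zr M) (if i < k then k - Suc i else i)) [0..<k])"
      by blast
    let ?e = "\<lambda>_. zr M"
    have e: "?e \<in> env M" using M by (auto simp: env_def)
    have eq: "sat M (pre (rev xs) ?e) \<theta> \<longleftrightarrow> Q M xs" if xs: "xs \<in> tup M k" for xs
    proof -
      have "map (\<lambda>i. pre (rev xs) ?e (if i < k then k - Suc i else i)) [0..<k] = xs"
        using tup_length[OF xs] by (intro nth_equalityI) (auto simp: pre_def rev_nth)
      moreover have "rev xs \<in> tup M k" using xs by (simp add: tup_def)
      ultimately show ?thesis using \<theta>(4)[OF M _ e] by simp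
    qed
    have "least_tuple_axiom k \<theta> \<in> LSigma1 k" using \<theta> by (auto simp: LSigma1_def)
    then have "sat M ?e (least_tuple_axiom k \<theta>)"
      using L e wf_least_tuple_axiom[OF \<theta>(1)] by (auto simp: models_def)
    then have "\<exists>as. least M k (\<lambda>xs. sat M (pre (rev xs) ?e) \<theta>) as"
      unfolding least_tuple_axiom_least[OF M] using Q(2) eq by blast
    then show ?thesis using eq unfolding least_def by blast
  qed
  then show "Lsem k M" using M by (auto simp: Lsem_def)
next
  assume L: "Lsem k M"
  then have M: "models M EA" by (simp add: Lsem_def)
  have "sat M e (least_tuple_axiom k \<theta>)" if \<theta>: "wf_fm \<theta>" "Sigma1 \<theta>" "fv \<theta> \<subseteq> {..<k}" and e: "e \<in> env M" for \<theta> e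
  proof -
    have "sigd (\<lambda>M e. sat M (\<lambda>i. e (if i < k then k - Suc i else i)) \<theta>)"
      using sigd_ren[OF sigd_sat[OF \<theta>(2,1)]] .
    \<comment> \<open>All free variables of \<theta> lie below \<open>k\<close>, so the environment
      may be cut down to a list; here the absence of parameters enters.\<close>
    moreover have "sat M' (\<lambda>i. e (if i < k then k - Suc i else i)) \<theta> \<longleftrightarrow>
       sat M' (lenv M' (rev (map e [0..<k]))) \<theta>" for e :: "nat \<Rightarrow> elt" and M'
      by (rule sat_cong) (use \<theta>(3) in \<open>auto simp: lenv_def rev_nth\<close>)
    ultimately have "sigt k (\<lambda>M xs. sat M (lenv M (rev xs)) \<theta>)" unfolding sigt_def by simp
    then have "(\<exists>xs\<in>tup M k. sat M (lenv M (rev xs)) \<theta>) \<longrightarrow>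
        (\<exists>as. least M k (\<lambda>xs. sat M (lenv M (rev xs)) \<theta>) as)"
      using L unfolding Lsem_def by fastforce
    moreover have "sat M (lenv M (rev xs)) \<theta> \<longleftrightarrow> sat M (pre (rev xs) e) \<theta>" if "xs \<in> tup M k" for xs
      by (rule sat_cong) (use \<theta>(3) tup_length[OF that] in \<open>auto simp: lenv_def pre_def\<close>)
    ultimately show ?thesis unfolding least_tuple_axiom_least[OF M] least_def by blast
  qed
  then show "models M (LSigma1 k)" using M by (auto simp: models_def LSigma1_def)
qed

lemma lexle_refl: "lexle M xs xs"
  by (induction xs) auto

lemma lexle_antisym:
  assumes M: "models M EA"
  shows "xs \<in> tup M k \<Longrightarrow> ys \<in> tup M k \<Longrightarrow> lexle M xs ys \<Longrightarrow> lexle M ys xs \<Longrightarrow> xs = ys"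
proof (induction k arbitrary: xs ys)
  case (Suc k)
  then obtain x xs' y ys' where *: "xs = x # xs'" "ys = y # ys'" "x \<in> carrier M" "y \<in> carrier M"
    "xs' \<in> tup M k" "ys' \<in> tup M k" unfolding tup_Suc by blast
  then have "x = y" using Suc.prems M by (metis lexle.simps(2) lt_le le_antisym)
  moreover have "\<not> lt M y y" using * M by (simp add: lt_le)
  ultimately show ?case using Suc.IH[of xs' ys'] Suc.prems * by simp
qed auto

lemma lexle_snoc:
  "length xs = length ys \<Longrightarrow> lexle M (xs @ [x]) (ys @ [y]) \<longleftrightarrow> lexle M xs ys \<and> (xs = ys \<longrightarrow> x = y \<or> lt M x y) \<or>
     xs = ys \<and> (x = y \<or> lt M x y)"
  if "models M EA" "set xs \<subseteq> carrier M" "set ys \<subseteq> carrier M" for x y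
  using that(2,3)
proof (induction xs ys rule: list_induct2')
  case (4 a as b bs)
  have "lt M a b \<longrightarrow> a \<noteq> b" using 4 that(1) by (auto simp: lt_le)
  then show ?case using 4 by auto
qed auto

lemma least_unique:
  assumes "models M EA" "s \<in> carrier M" "t \<in> carrier M" "P s" "P t"
    "\<And>z. z \<in> carrier M \<Longrightarrow> lt M z s \<Longrightarrow> \<not> P z" "\<And>z. z \<in> carrier M \<Longrightarrow> lt M z t \<Longrightarrow> \<not> P z"
  shows "s = t"
  using assms by (metis lt_le le_linear)


lemma least_number_ex:
  assumes "elemd (\<lambda>M e. Q M (e 0) (\<lambda>n. e (Suc n)))" "models M EA" "p \<in> env M" "x \<in> carrier M" "Q M x p"
  shows "\<exists>s\<in>carrier M. Q M s p \<and> (\<forall>z\<in>carrier M. lt M z s \<longrightarrow> \<not> Q M z p)"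
  by (rule least_number[OF assms]) blast


subsection \<open>Uniformization of existential relations\<close>

text \<open>\<open>X\<close> itself is only existential, so a least \<open>w\<close> cannot be
  searched for. Instead the common bound \<open>u\<close> of \<open>w\<close> and its witnesses is
  minimised first, and then \<open>w\<close> for this \<open>u\<close>. Both minimisations are
  elementary, so \<open>Y\<close> is existential.\<close>

lemma uniformize:
  assumes "sigd (\<lambda>M e. X M (e 0) (\<lambda>n. e (Suc n)))"
  obtains Y where "sigd (\<lambda>M e. Y M (e 0) (\<lambda>n. e (Suc n)))"
    "\<And>M w p. models M EA \<Longrightarrow> p \<in> env M \<Longrightarrow> w \<in> carrier M \<Longrightarrow> X M w p \<Longrightarrow>
      \<exists>w\<in>carrier M. X M w p \<and> Y M w p \<and> (\<forall>v\<in>carrier M. Y M v p \<longrightarrow> v = w)"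
proof -
  obtain B where B: "elemd (\<lambda>M e. B M (e 0) (\<lambda>n. e (Suc n)))"
    "\<And>M e. models M EA \<Longrightarrow> e \<in> env M \<Longrightarrow> X M (e 0) (\<lambda>n. e (Suc n)) \<longleftrightarrow> (\<exists>u\<in>carrier M. B M u e)"
    "\<And>M e u v. models M EA \<Longrightarrow> e \<in> env M \<Longrightarrow> u \<in> carrier M \<Longrightarrow> v \<in> carrier M \<Longrightarrow> B M u e \<Longrightarrow> le M u v \<Longrightarrow> B M v e"
    using sigd_bounded[OF assms] by blast
  define C where "C = (\<lambda>M u w p. B M u (case_nat w p) \<and> lt M w u)"
  have eC: "elemd (\<lambda>M e. C M (e i) (e j) (\<lambda>n. e (\<rho> n)))" for i j \<rho>
  proof -
    have "elemd (\<lambda>M e. B M (e i) (\<lambda>n. e (case n of 0 \<Rightarrow> j | Suc n \<Rightarrow> \<rho> n)))"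
      using elemd_ren[OF B(1), of "\<lambda>n. case n of 0 \<Rightarrow> i | Suc n \<Rightarrow> (case n of 0 \<Rightarrow> j | Suc n \<Rightarrow> \<rho> n)"] by simp
    moreover have "(\<lambda>n. e (case n of 0 \<Rightarrow> j | Suc n \<Rightarrow> \<rho> n)) = case_nat (e j) (\<lambda>n. e (\<rho> n))" for e :: "nat \<Rightarrow> elt"
      by (rule ext) (simp split: nat.split)
    ultimately show ?thesis unfolding C_def by (intro elemd_and elemd_lt elemf_var) simp
  qed
  define E where "E = (\<lambda>M u p. \<exists>w\<in>carrier M. lt M w u \<and> C M u w p)"
  have eE: "elemd (\<lambda>M e. E M (e i) (\<lambda>n. e (\<rho> n)))" for i \<rho>
    unfolding E_def by (rule elemd_bex[where Q = "\<lambda>M w e. C M (e i) w (\<lambda>n. e (\<rho> n))", OF eC elemf_var])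
  define Y where "Y = (\<lambda>M w p. \<exists>u\<in>carrier M. (E M u p \<and> \<not> (\<exists>v\<in>carrier M. lt M v u \<and> E M v p)) \<and>
     C M u w p \<and> \<not> (\<exists>v\<in>carrier M. lt M v w \<and> C M u v p))"
  have "sigd (\<lambda>M e. Y M (e 0) (\<lambda>n. e (Suc n)))"
  proof -
    have "elemd (\<lambda>M e. \<exists>v\<in>carrier M. lt M v (e 0) \<and> E M v (\<lambda>n. e (Suc (Suc n))))"
      by (rule elemd_bex[where Q = "\<lambda>M v e. E M v (\<lambda>n. e (Suc (Suc n)))", OF eE elemf_var])
    moreover have "elemd (\<lambda>M e. \<exists>v\<in>carrier M. lt M v (e (Suc 0)) \<and> C M (e 0) v (\<lambda>n. e (Suc (Suc n))))"
      by (rule elemd_bex[where Q = "\<lambda>M v e. C M (e 0) v (\<lambda>n. e (Suc (Suc n)))", OF eC elemf_var])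
    ultimately have "elemd (\<lambda>M e. (E M (e 0) (\<lambda>n. e (Suc (Suc n))) \<and>
         \<not> (\<exists>v\<in>carrier M. lt M v (e 0) \<and> E M v (\<lambda>n. e (Suc (Suc n))))) \<and>
       C M (e 0) (e (Suc 0)) (\<lambda>n. e (Suc (Suc n))) \<and>
         \<not> (\<exists>v\<in>carrier M. lt M v (e (Suc 0)) \<and> C M (e 0) v (\<lambda>n. e (Suc (Suc n)))))"
      by (intro elemd_and elemd_not eE eC)
    then show ?thesis unfolding Y_def by (intro sigd_ex sigd_elemd)
  qed
  moreover have "\<exists>w\<in>carrier M. X M w p \<and> Y M w p \<and> (\<forall>v\<in>carrier M. Y M v p \<longrightarrow> v = w)"
    if M: "models M EA" and p: "p \<in> env M" and w: "w \<in> carrier M" "X M w p" for M w p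
  proof -
    have XB: "X M w p \<longleftrightarrow> (\<exists>u\<in>carrier M. B M u (case_nat w p))" if "w \<in> carrier M" for w
      using B(2)[OF M, of "case_nat w p"] p that by simp
    then obtain u0 where u0: "u0 \<in> carrier M" "B M u0 (case_nat w p)" using w by blast
    \<comment> \<open>Large enough for the witnesses, being at least \<open>u0\<close>, and strictly
      above \<open>w\<close>.\<close>
    let ?u = "ad M u0 (sc M w)"
    have u: "?u \<in> carrier M" using u0 w M by simp
    have le: "le M u0 ?u" using u0 w M by (intro le_ad) simp_all
    have ltw: "lt M w ?u" using u0 w M by simp
    have "C M ?u w p"
      using B(3)[OF M _ u0(1) u u0(2) le] ltw p w by (simp add: C_def)
    then have "E M ?u p" using ltw w unfolding E_def by blast
    from least_number_ex[where Q = E, OF eE M p u this] obtain s where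
      s: "s \<in> carrier M" "E M s p" "\<And>z. z \<in> carrier M \<Longrightarrow> lt M z s \<Longrightarrow> \<not> E M z p" by blast
    from s(2) obtain v where v: "v \<in> carrier M" "C M s v p" unfolding E_def by blast
    let ?C = "\<lambda>M w p. C M (p 0) w (\<lambda>n. p (Suc n))"
    have p': "case_nat s p \<in> env M" using p s(1) by simp
    have "?C M v (case_nat s p)" using v(2) by simp
    from least_number_ex[where Q = ?C, OF eC M p' v(1) this]
    have "\<exists>t\<in>carrier M. C M s t p \<and> (\<forall>z\<in>carrier M. lt M z t \<longrightarrow> \<not> C M s z p)" by simp
    then obtain t where t: "t \<in> carrier M" "C M s t p" "\<And>z. z \<in> carrier M \<Longrightarrow> lt M z t \<Longrightarrow> \<not> C M s z p" by blast
    have "X M t p" using t(1,2) s(1) XB[OF t(1)] by (auto simp: C_def)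
    moreover have "Y M t p" unfolding Y_def using s t by blast
    moreover have "x = t" if x: "x \<in> carrier M" "Y M x p" for x
    proof -
      from x(2) obtain r where r: "r \<in> carrier M" "E M r p" "\<And>z. z \<in> carrier M \<Longrightarrow> lt M z r \<Longrightarrow> \<not> E M z p"
        "C M r x p" "\<And>z. z \<in> carrier M \<Longrightarrow> lt M z x \<Longrightarrow> \<not> C M r z p" unfolding Y_def by blast
      have "r = s" using least_unique[OF M r(1) s(1), of "\<lambda>u. E M u p"] r s by blast
      then show ?thesis using least_unique[OF M x(1) t(1), of "\<lambda>w. C M s w p"] r t by blast
    qed
    ultimately show ?thesis using t(1) by blast
  qed
  ultimately show ?thesis by (rule that)
qed


subsection \<open>Elements definable from a tuple\<close>

definition sigt1 :: "nat \<Rightarrow> (mdl \<Rightarrow> elt list \<Rightarrow> elt \<Rightarrow> bool) \<Rightarrow> bool" where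
  "sigt1 k Q \<longleftrightarrow> sigd (\<lambda>M e. Q M (map (\<lambda>n. e (Suc n)) [0..<k]) (e 0))"

definition sigt2 :: "nat \<Rightarrow> nat \<Rightarrow> (mdl \<Rightarrow> elt list \<Rightarrow> elt list \<Rightarrow> bool) \<Rightarrow> bool" where
  "sigt2 k n Q \<longleftrightarrow> sigd (\<lambda>M e. Q M (map (\<lambda>i. e (i + n)) [0..<k]) (map e [0..<n]))"

lemma sigt_leaf: "sigt k Q \<Longrightarrow> sigd (\<lambda>M e. Q M (map (\<lambda>n. e (\<rho> n)) [0..<k]))"
  unfolding sigt_def by (drule sigd_ren[where \<rho> = \<rho>])

lemma sigt1_leaf: "sigt1 k Q \<Longrightarrow> sigd (\<lambda>M e. Q M (map (\<lambda>n. e (\<rho> n)) [0..<k]) (e i))"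
  unfolding sigt1_def by (drule sigd_ren[where \<rho> = "case_nat i \<rho>"]) simp

lemma sigt2_leaf: "sigt2 k m Q \<Longrightarrow>
    sigd (\<lambda>M e. Q M (map (\<lambda>n. e (\<rho> n)) [0..<k]) (map (\<lambda>n. e (\<tau> n)) [0..<m]))"
proof -
  assume "sigt2 k m Q"
  from sigd_ren[OF this[unfolded sigt2_def], of "\<lambda>n. if n < m then \<tau> n else \<rho> (n - m)"]
  have "sigd (\<lambda>M e. Q M (map (\<lambda>n. e (\<rho> n)) [0..<k])
      (map (\<lambda>n. e (if n < m then \<tau> n else \<rho> (n - m))) [0..<m]))" by simp
  moreover have "map (\<lambda>n. e (if n < m then \<tau> n else \<rho> (n - m))) [0..<m] = map (\<lambda>n. e (\<tau> n)) [0..<m]"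
    for e :: "nat \<Rightarrow> elt" by simp
  ultimately show ?thesis by (simp only:)
qed

lemma map_Cons_upt: "e i # map (\<lambda>j. e (\<tau> j)) [0..<n] = map (\<lambda>j. e (case_nat i \<tau> j)) [0..<Suc n]"
  by (simp add: upt_conv_Cons map_Suc_upt[symmetric] comp_def del: upt_Suc)

lemma sigt2_Cons_leaf: "sigt2 k (Suc m) Q \<Longrightarrow>
    sigd (\<lambda>M e. Q M (map (\<lambda>n. e (\<rho> n)) [0..<k]) (e i # map (\<lambda>n. e (\<tau> n)) [0..<m]))"
  unfolding map_Cons_upt by (rule sigt2_leaf)

text \<open>The existentially definable closure of \<open>as\<close>. Uniqueness is asked in
  \<open>M\<close> and at \<open>as\<close> only; at other tuples or in other models \<psi> may be
  many-valued.\<close>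

definition defset :: "mdl \<Rightarrow> nat \<Rightarrow> elt list \<Rightarrow> elt set" where
  "defset M k as = {b \<in> carrier M. \<exists>\<psi>. sigt1 k \<psi> \<and> \<psi> M as b \<and> (\<forall>w\<in>carrier M. \<psi> M as w \<longrightarrow> w = b)}"

text \<open>Definable Skolem functions for existential relations, obtained by uniformization; they
  are the source of the elementarity of the hull.\<close>

lemma defset_select:
  assumes M: "models M EA" and as: "as \<in> tup M k" and \<chi>: "sigt1 k \<chi>" "w \<in> carrier M" "\<chi> M as w"
  shows "\<exists>w\<in>defset M k as. \<chi> M as w"
proof -
  let ?X = "\<lambda>M w p. \<chi> M (map p [0..<k]) w"
  from uniformize[where X = ?X, OF \<chi>(1)[unfolded sigt1_def]] obtain Y where
    Y: "sigd (\<lambda>M e. Y M (e 0) (\<lambda>n. e (Suc n)))"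
    "\<And>M w p. models M EA \<Longrightarrow> p \<in> env M \<Longrightarrow> w \<in> carrier M \<Longrightarrow> ?X M w p \<Longrightarrow>
      \<exists>w\<in>carrier M. ?X M w p \<and> Y M w p \<and> (\<forall>v\<in>carrier M. Y M v p \<longrightarrow> v = w)" by blast
  \<comment> \<open>\<open>Y\<close> may read any index of its environment; indices beyond the tuple
    are set to zero so that only \<open>as\<close> is used.\<close>
  let ?G = "case_nat (\<lambda>M e. e 0) (\<lambda>n M e. if n < k then e (Suc n) else zr M)"
  have eG: "elemf (?G i)" for i
    by (cases i; cases "i \<le> k") (simp_all add: elemf_var elemf_app0)
  from sigd_subst_all[OF Y(1), of ?G, OF eG] have "sigd (\<lambda>M e. Y M (e 0) (\<lambda>n. if n < k then e (Suc n) else zr M))"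
    by simp
  moreover have "(\<lambda>n. if n < k then e (Suc n) else zr M) = lenv M (map (\<lambda>n. e (Suc n)) [0..<k])" for M e
    by (rule ext) (simp add: lenv_def)
  ultimately have "sigt1 k (\<lambda>M xs w. Y M w (lenv M xs))" unfolding sigt1_def by simp
  moreover have "\<exists>w\<in>carrier M. \<chi> M as w \<and> Y M w (lenv M as) \<and> (\<forall>v\<in>carrier M. Y M v (lenv M as) \<longrightarrow> v = w)"
  proof -
    have eq: "map (lenv M as) [0..<k] = as" using map_lenv tup_length[OF as] by blast
    have "lenv M as \<in> env M" using as by (intro lenv_env M) (simp add: tup_def)
    from Y(2)[OF M this \<chi>(2)] show ?thesis unfolding eq using \<chi>(3) by blast
  qed
  ultimately show ?thesis unfolding defset_def by blast
qed

lemma defset_tuple: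
  assumes "set bs \<subseteq> defset M k as"
  shows "\<exists>\<Psi>. sigt2 k (length bs) \<Psi> \<and> \<Psi> M as bs \<and> (\<forall>ys\<in>tup M (length bs). \<Psi> M as ys \<longrightarrow> ys = bs)"
  using assms
proof (induction bs)
  case Nil
  have "sigt2 k 0 (\<lambda>M xs ys. True)"
    unfolding sigt2_def using sigd_elemd[OF elemd_not[OF elemd_false]] by simp
  then show ?case by (intro exI[of _ "\<lambda>M xs ys. True"]) simp
next
  case (Cons b bs)
  then obtain \<psi> \<Psi> where 1: "sigt1 k \<psi>" "\<psi> M as b" "\<forall>w\<in>carrier M. \<psi> M as w \<longrightarrow> w = b" and
    2: "sigt2 k (length bs) \<Psi>" "\<Psi> M as bs" "\<forall>ys\<in>tup M (length bs). \<Psi> M as ys \<longrightarrow> ys = bs"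
    unfolding defset_def by auto
  let ?\<Psi> = "\<lambda>M xs ys. \<psi> M xs (hd ys) \<and> \<Psi> M xs (tl ys)"
  have "sigt2 k (length (b # bs)) ?\<Psi>"
    unfolding sigt2_def
    using sigd_and[OF sigt1_leaf[OF 1(1), of "\<lambda>i. i + Suc (length bs)" 0]
       sigt2_leaf[OF 2(1), of "\<lambda>i. i + Suc (length bs)" Suc]]
    by (simp add: upt_conv_Cons map_Suc_upt[symmetric] comp_def del: upt_Suc)
  moreover have "?\<Psi> M as (b # bs)" using 1 2 by simp
  moreover have "\<forall>ys\<in>tup M (length (b # bs)). ?\<Psi> M as ys \<longrightarrow> ys = b # bs"
    using 1 2 by (auto simp: tup_Suc)
  ultimately show ?case by blast
qed

lemma elemf_map_var: "wf_fun f \<Longrightarrow> arity f = n \<Longrightarrow> elemf (\<lambda>M e. interp M f (map (\<lambda>i. e (\<rho> i)) [0..<n]))"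
  using elemf_appl[of f "map (\<lambda>i M e. e (\<rho> i)) [0..<n]"] elemf_var by (auto simp: comp_def)

lemma defset_interp:
  assumes M: "models M EA" and f: "wf_fun f" "length bs = arity f" "set bs \<subseteq> defset M k as"
  shows "interp M f bs \<in> defset M k as"
proof -
  let ?n = "length bs"
  obtain \<Psi> where \<Psi>: "sigt2 k ?n \<Psi>" "\<Psi> M as bs" "\<forall>ys\<in>tup M ?n. \<Psi> M as ys \<longrightarrow> ys = bs"
    using defset_tuple[OF f(3)] by blast
  let ?\<psi> = "\<lambda>M xs w. \<exists>ys\<in>tup M ?n. \<Psi> M xs ys \<and> w = interp M f ys"
  have "sigt1 k ?\<psi>" unfolding sigt1_def
  proof (rule sigd_extup[where Q = "\<lambda>M ys e. \<Psi> M (map (\<lambda>n. e (Suc n)) [0..<k]) ys \<and> e 0 = interp M f ys"],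
      rule sigd_and)
    show "sigd (\<lambda>M e. \<Psi> M (map (\<lambda>n. e (Suc n + ?n)) [0..<k]) (map e [0..<?n]))"
      using sigt2_leaf[OF \<Psi>(1), where \<tau> = "\<lambda>i. i"] .
    show "sigd (\<lambda>M e. e (0 + ?n) = interp M f (map e [0..<?n]))"
      using elemf_map_var[OF f(1) f(2)[symmetric], of "\<lambda>i. i"]
      by (intro sigd_elemd elemd_eq elemf_var) simp
  qed
  moreover have bs: "bs \<in> tup M ?n" using f(3) by (auto simp: tup_def defset_def)
  then have "interp M f bs \<in> carrier M" using EA_carrier[OF M f(1,2)] by (simp add: tup_def)
  ultimately show ?thesis unfolding defset_def using \<Psi> bs
    by (intro CollectI conjI exI[of _ ?\<psi>]) blast+
qed

text \<open>The first component is selected alone. It is not among the entries of \<open>as\<close>,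
  but its definition can be inserted in its place, so the remaining components are again selected
  over \<open>as\<close> only.\<close>

lemma defset_select_tuple:
  assumes M: "models M EA" and as: "as \<in> tup M k"
  shows "sigt2 k n \<chi> \<Longrightarrow> ws \<in> tup M n \<Longrightarrow> \<chi> M as ws \<Longrightarrow>
    \<exists>ws. length ws = n \<and> set ws \<subseteq> defset M k as \<and> \<chi> M as ws"
proof (induction n arbitrary: \<chi> ws)
  case 0
  then show ?case by auto
next
  case (Suc n)
  let ?\<chi>1 = "\<lambda>M xs w. \<exists>ys\<in>tup M n. \<chi> M xs (w # ys)"
  have "sigt1 k ?\<chi>1" unfolding sigt1_def
  proof (rule sigd_extup[where Q = "\<lambda>M ys e. \<chi> M (map (\<lambda>n. e (Suc n)) [0..<k]) (e 0 # ys)"])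
    show "sigd (\<lambda>M e. \<chi> M (map (\<lambda>i. e (Suc i + n)) [0..<k]) (e (0 + n) # map e [0..<n]))"
      using sigt2_Cons_leaf[OF Suc.prems(1), where \<tau> = "\<lambda>i. i"] .
  qed
  moreover from Suc.prems(2,3) obtain w0 ws0 where "w0 \<in> carrier M" "?\<chi>1 M as w0" by (auto simp: tup_Suc)
  ultimately obtain w where w: "w \<in> defset M k as" "?\<chi>1 M as w" using defset_select[OF M as] by blast
  then obtain \<psi> where \<psi>: "w \<in> carrier M" "sigt1 k \<psi>" "\<psi> M as w" "\<forall>v\<in>carrier M. \<psi> M as v \<longrightarrow> v = w"
    unfolding defset_def by blast
  let ?\<chi>2 = "\<lambda>M xs ys. \<exists>w\<in>carrier M. \<psi> M xs w \<and> \<chi> M xs (w # ys)"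
  have "sigt2 k n ?\<chi>2" unfolding sigt2_def
  proof (rule sigd_ex[where Q = "\<lambda>M w e. \<psi> M (map (\<lambda>i. e (i + n)) [0..<k]) w \<and>
        \<chi> M (map (\<lambda>i. e (i + n)) [0..<k]) (w # map e [0..<n])"])
    show "sigd (\<lambda>M e. \<psi> M (map (\<lambda>i. e (Suc (i + n))) [0..<k]) (e 0) \<and>
        \<chi> M (map (\<lambda>i. e (Suc (i + n))) [0..<k]) (e 0 # map (\<lambda>n. e (Suc n)) [0..<n]))"
      by (intro sigd_and sigt1_leaf[OF \<psi>(2)] sigt2_Cons_leaf[OF Suc.prems(1)])
  qed
  moreover from w(2) \<psi> obtain ys where "ys \<in> tup M n" "?\<chi>2 M as ys" by blast
  ultimately obtain ys where "length ys = n" "set ys \<subseteq> defset M k as" "?\<chi>2 M as ys" using Suc.IH by blast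
  then have "length (w # ys) = Suc n \<and> set (w # ys) \<subseteq> defset M k as \<and> \<chi> M as (w # ys)"
    using w(1) \<psi>(4) by auto
  then show ?case by blast
qed

lemma defset_nth:
  assumes "as \<in> tup M k" "i < k" shows "as ! i \<in> defset M k as"
proof -
  have "sigt1 k (\<lambda>M xs w. w = xs ! i)"
    unfolding sigt1_def using assms(2) sigd_elemd[OF elemd_eq[OF elemf_var elemf_var], of 0 "Suc i"] by simp
  moreover have "as ! i \<in> carrier M" using assms by (auto simp: tup_def)
  ultimately show ?thesis unfolding defset_def by blast
qed


subsection \<open>Sums of least tuples\<close>

abbreviation sums :: "mdl \<Rightarrow> elt list \<Rightarrow> elt list \<Rightarrow> elt list" where
  "sums M \<equiv> map2 (ad M)"

lemma sums_tup: "models M EA \<Longrightarrow> xs \<in> tup M k \<Longrightarrow> ys \<in> tup M k \<Longrightarrow> sums M xs ys \<in> tup M k"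
proof (induction k arbitrary: xs ys)
  case (Suc k)
  then obtain x xs' y ys' where *: "xs = x # xs'" "ys = y # ys'" "x \<in> carrier M" "y \<in> carrier M"
    "xs' \<in> tup M k" "ys' \<in> tup M k" unfolding tup_Suc by blast
  then have "sums M xs' ys' \<in> tup M k" "ad M x y \<in> carrier M" using Suc by simp_all
  then show ?case unfolding tup_Suc * by simp
qed simp

lemma sums_comm: "models M EA \<Longrightarrow> xs \<in> tup M k \<Longrightarrow> ys \<in> tup M k \<Longrightarrow> sums M xs ys = sums M ys xs"
proof (induction k arbitrary: xs ys)
  case (Suc k)
  then obtain x xs' y ys' where *: "xs = x # xs'" "ys = y # ys'" "x \<in> carrier M" "y \<in> carrier M"
    "xs' \<in> tup M k" "ys' \<in> tup M k" unfolding tup_Suc by blast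
  then show ?case using Suc.IH[of xs' ys'] Suc.prems(1) ad_comm[of M x y] by simp
qed simp

text \<open>At the first place where one of the summands is smaller than its counterpart the sum is
  strictly smaller as well; hence equal sums leave no such place.\<close>

lemma lexle_sums:
  assumes M: "models M EA"
  shows "xs \<in> tup M k \<Longrightarrow> ys \<in> tup M k \<Longrightarrow> as \<in> tup M k \<Longrightarrow> bs \<in> tup M k \<Longrightarrow>
    lexle M as xs \<Longrightarrow> lexle M bs ys \<Longrightarrow>
    lexle M (sums M as bs) (sums M xs ys) \<and> (sums M as bs = sums M xs ys \<longrightarrow> as = xs \<and> bs = ys)"
proof (induction k arbitrary: xs ys as bs)
  case (Suc k)
  from Suc.prems(1) obtain x xs' where x: "xs = x # xs'" "x \<in> carrier M" "xs' \<in> tup M k" unfolding tup_Suc by blast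
  from Suc.prems(2) obtain y ys' where y: "ys = y # ys'" "y \<in> carrier M" "ys' \<in> tup M k" unfolding tup_Suc by blast
  from Suc.prems(3) obtain a as' where a: "as = a # as'" "a \<in> carrier M" "as' \<in> tup M k" unfolding tup_Suc by blast
  from Suc.prems(4) obtain b bs' where b: "bs = b # bs'" "b \<in> carrier M" "bs' \<in> tup M k" unfolding tup_Suc by blast
  have ax: "lt M a x \<or> a = x \<and> lexle M as' xs'" and bY: "lt M b y \<or> b = y \<and> lexle M bs' ys'"
    using Suc.prems(5,6) x y a b by simp_all
  have le: "le M a x" "le M b y" using ax bY M a b x y by (metis lt_le le_refl)+
  have sle: "le M (ad M a b) (ad M x y)" using ad_le_mono[OF M a(2) x(2) b(2) y(2) le] .
  show ?case
  proof (cases "ad M a b = ad M x y")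
    case True
    then have eq: "a = x" "b = y"
      using ad_le_eq[OF M a(2) x(2) b(2) y(2) le] le_refl[OF M, of "ad M x y"] M x y by simp_all
    then have "lexle M as' xs'" "lexle M bs' ys'" using ax bY M x y by (simp_all add: lt_le)
    then show ?thesis using Suc.IH[OF x(3) y(3) a(3) b(3)] eq x y a b by simp
  next
    case False
    then have "lt M (ad M a b) (ad M x y)" using sle M a b x y by (simp add: lt_le)
    then show ?thesis using False x y a b by simp
  qed
qed simp

definition leasts :: "mdl \<Rightarrow> nat \<Rightarrow> elt list set" where
  "leasts M k = {as. \<exists>Q. sigt k Q \<and> least M k (Q M) as}"

lemma leasts_tup: "as \<in> leasts M k \<Longrightarrow> as \<in> tup M k"
  by (auto simp: leasts_def least_def)

lemma sums_eq_iff: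
  assumes "length xs = k" "length ys = k" "length zs = k"
  shows "zs = sums M xs ys \<longleftrightarrow> (\<forall>i<k. zs ! i = ad M (xs ! i) (ys ! i))"
  using assms by (auto simp: list_eq_iff_nth_eq)

lemma elemd_sums:
  "elemd (\<lambda>M e. map (\<lambda>n. e (\<rho> n)) [0..<k] = sums M (map (\<lambda>n. e (\<tau> n)) [0..<k]) (map (\<lambda>n. e (\<sigma> n)) [0..<k]))"
proof -
  have "elemd (\<lambda>M e. \<forall>i<k. e (\<rho> i) = ad M (e (\<tau> i)) (e (\<sigma> i)))"
    by (intro elemd_ball elem_intros) simp_all
  then show ?thesis by (simp add: sums_eq_iff[where k = k])
qed

lemma sums_least:
  assumes M: "models M EA" and Q: "least M k P as" "least M k P' bs"
    and xs: "xs \<in> tup M k" "P xs" "ys \<in> tup M k" "P' ys"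
  shows "lexle M (sums M as bs) (sums M xs ys)" "sums M as bs = sums M xs ys \<Longrightarrow> as = xs \<and> bs = ys"
  using lexle_sums[OF M xs(1,3), of as bs] Q xs by (simp_all add: least_def)

text \<open>The sum is least among all sums of a member of \<open>Q\<close> and a member of
  \<open>Q'\<close>. Only \<open>as\<close> and \<open>bs\<close> add up to it, so \<open>as\<close>
  is definable from the sum, and so is everything definable from \<open>as\<close>.\<close>

lemma sums_leasts:
  assumes M: "models M EA" and as: "as \<in> leasts M k" "bs \<in> leasts M k"
  shows "sums M as bs \<in> leasts M k \<and> defset M k as \<subseteq> defset M k (sums M as bs)"
proof -
  obtain Q Q' where Q: "sigt k Q" "least M k (Q M) as" and Q': "sigt k Q'" "least M k (Q' M) bs"
    using as unfolding leasts_def by blast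
  have t: "as \<in> tup M k" "bs \<in> tup M k" using as leasts_tup by blast+
  let ?S = "\<lambda>M zs. \<exists>xs\<in>tup M k. \<exists>ys\<in>tup M k. Q M xs \<and> Q' M ys \<and> zs = sums M xs ys"
  have "sigt k ?S" unfolding sigt_def
  proof (rule sigd_extup[where Q = "\<lambda>M xs e. \<exists>ys\<in>tup M k. Q M xs \<and> Q' M ys \<and> map e [0..<k] = sums M xs ys"],
      rule sigd_extup[where Q = "\<lambda>M ys e. Q M (map e [0..<k]) \<and> Q' M ys \<and> map (\<lambda>n. e (n + k)) [0..<k] = sums M (map e [0..<k]) ys"])
    show "sigd (\<lambda>M e. Q M (map (\<lambda>n. e (n + k)) [0..<k]) \<and> Q' M (map e [0..<k]) \<and>
        map (\<lambda>n. e (n + k + k)) [0..<k] = sums M (map (\<lambda>n. e (n + k)) [0..<k]) (map e [0..<k]))"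
      by (intro sigd_and sigt_leaf[OF Q(1)] sigt_leaf[OF Q'(1), where \<rho> = "\<lambda>n. n"] sigd_elemd
          elemd_sums[where \<sigma> = "\<lambda>n. n"])
  qed
  moreover have "least M k (?S M) (sums M as bs)"
    unfolding least_def using sums_tup[OF M t] t Q(2) Q'(2) sums_least(1)[OF M Q(2) Q'(2)]
    by (auto simp: least_def)
  moreover have "b \<in> defset M k (sums M as bs)" if "b \<in> defset M k as" for b
  proof -
    from that obtain \<psi> where \<psi>: "b \<in> carrier M" "sigt1 k \<psi>" "\<psi> M as b" "\<forall>w\<in>carrier M. \<psi> M as w \<longrightarrow> w = b"
      unfolding defset_def by blast
    let ?\<psi> = "\<lambda>M zs w. \<exists>xs\<in>tup M k. \<exists>ys\<in>tup M k. (Q M xs \<and> Q' M ys \<and> zs = sums M xs ys) \<and> \<psi> M xs w"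
    have "sigt1 k ?\<psi>" unfolding sigt1_def
    proof (rule sigd_extup[where Q = "\<lambda>M xs e. \<exists>ys\<in>tup M k. (Q M xs \<and> Q' M ys \<and>
            map (\<lambda>n. e (Suc n)) [0..<k] = sums M xs ys) \<and> \<psi> M xs (e 0)"],
        rule sigd_extup[where Q = "\<lambda>M ys e. (Q M (map e [0..<k]) \<and> Q' M ys \<and>
            map (\<lambda>n. e (Suc n + k)) [0..<k] = sums M (map e [0..<k]) ys) \<and> \<psi> M (map e [0..<k]) (e (0 + k))"])
      show "sigd (\<lambda>M e. (Q M (map (\<lambda>n. e (n + k)) [0..<k]) \<and> Q' M (map e [0..<k]) \<and>
          map (\<lambda>n. e (Suc n + k + k)) [0..<k] = sums M (map (\<lambda>n. e (n + k)) [0..<k]) (map e [0..<k])) \<and>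
          \<psi> M (map (\<lambda>n. e (n + k)) [0..<k]) (e (0 + k + k)))"
        by (intro sigd_and sigt_leaf[OF Q(1)] sigt_leaf[OF Q'(1), where \<rho> = "\<lambda>n. n"] sigd_elemd
            elemd_sums[where \<sigma> = "\<lambda>n. n"] sigt1_leaf[OF \<psi>(2)])
    qed
    moreover have "?\<psi> M (sums M as bs) b" using t Q(2) Q'(2) \<psi>(3) by (auto simp: least_def)
    moreover have "w = b" if "w \<in> carrier M" "?\<psi> M (sums M as bs) w" for w
      using that(2) \<psi>(4) that(1) sums_least(2)[OF M Q(2) Q'(2)] by blast
    ultimately show ?thesis unfolding defset_def using \<psi>(1) by blast
  qed
  ultimately show ?thesis unfolding leasts_def by blast
qed

text \<open>\<open>sums_leasts\<close> treats the first summand; commutativity gives the inclusion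
  for the second.\<close>

lemma leasts_directed:
  assumes M: "models M EA" and as: "as \<in> leasts M k" "bs \<in> leasts M k"
  shows "\<exists>cs\<in>leasts M k. defset M k as \<union> defset M k bs \<subseteq> defset M k cs"
  using sums_leasts[OF M as] sums_leasts[OF M as(2,1)]
    sums_comm[OF M leasts_tup[OF as(1)] leasts_tup[OF as(2)]] by (intro bexI[of _ "sums M as bs"]) auto


subsection \<open>The hull of the least tuples\<close>

definition hull :: "mdl \<Rightarrow> nat \<Rightarrow> mdl" where
  "hull M k = Struct (\<Union>as\<in>leasts M k. defset M k as) (interp M)"

lemma interp_hull [simp]: "interp (hull M k) = interp M"
  by (simp add: hull_def)

lemma le_hull [simp]: "le (hull M k) = le M"
  by (intro ext) (simp add: le_def)

lemma lt_hull [simp]: "lt (hull M k) = lt M"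
  by (intro ext) (simp add: lt_def)

lemma lexle_hull [simp]: "lexle (hull M k) xs ys = lexle M xs ys"
  by (induction M xs ys rule: lexle.induct) auto

lemma eval_hull [simp]: "eval (hull M k) e t = eval M e t"
  by (induction t) (simp_all cong: map_cong)

lemma sat_hull: "qfree \<phi> \<Longrightarrow> sat (hull M k) e \<phi> = sat M e \<phi>"
  by (induction \<phi> arbitrary: e) auto

lemma hull_subset: "carrier (hull M k) \<subseteq> carrier M"
  by (auto simp: hull_def defset_def)

lemma hull_env: "e \<in> env (hull M k) \<Longrightarrow> e \<in> env M"
  using hull_subset by (fastforce simp: env_def)

lemma hull_tup: "xs \<in> tup (hull M k) n \<Longrightarrow> xs \<in> tup M n"
  using hull_subset by (fastforce simp: tup_def)

lemma leasts_nonempty: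
  assumes "Lsem k M" shows "leasts M k \<noteq> {}"
proof -
  have M: "models M EA" using assms by (simp add: Lsem_def)
  have "sigt k (\<lambda>M xs. True)" unfolding sigt_def using sigd_elemd[OF elemd_not[OF elemd_false]] by simp
  moreover have "replicate k (zr M) \<in> tup M k" using M by (simp add: tup_def set_replicate_conv_if)
  ultimately have "\<exists>as. least M k (\<lambda>xs. True) as" using assms unfolding Lsem_def by blast
  then show ?thesis using \<open>sigt k (\<lambda>M xs. True)\<close> unfolding leasts_def by blast
qed

text \<open>Directedness puts finitely many elements under a single least tuple, as closure under
  functions of several arguments requires.\<close>

lemma hull_list:
  assumes L: "Lsem k M" shows "set xs \<subseteq> carrier (hull M k) \<Longrightarrow> \<exists>as\<in>leasts M k. set xs \<subseteq> defset M k as"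
proof (induction xs)
  case Nil
  then show ?case using leasts_nonempty[OF L] by auto
next
  case (Cons x xs)
  then obtain as bs where *: "as \<in> leasts M k" "set xs \<subseteq> defset M k as" "bs \<in> leasts M k" "x \<in> defset M k bs"
    by (auto simp: hull_def)
  have M: "models M EA" using L by (simp add: Lsem_def)
  from leasts_directed[OF M *(1,3)] obtain cs where
    "cs \<in> leasts M k" "defset M k as \<union> defset M k bs \<subseteq> defset M k cs" by blast
  then show ?case using * by (intro bexI[of _ cs]) auto
qed

text \<open>The axioms are open formulas, so they pass to every substructure; induction is no
  exception, because it enters as a rule with open conclusions.\<close>

lemma hull_EA:
  assumes L: "Lsem k M" shows "models (hull M k) EA"
proof -
  have M: "models M EA" using L by (simp add: Lsem_def)
  have cl: "interp M f xs \<in> carrier (hull M k)"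
    if "wf_fun f" "length xs = arity f" "set xs \<subseteq> carrier (hull M k)" for f xs
    using hull_list[OF L that(3)] defset_interp[OF M that(1,2)] by (auto simp: hull_def)
  have "wf_struct (hull M k)"
  proof -
    have "zr M \<in> carrier (hull M k)" using cl[of FZero "[]"] by simp
    then show ?thesis unfolding wf_struct_def interp_hull using cl by blast
  qed
  moreover have "sat (hull M k) e \<phi>" if "\<phi> \<in> EA" "wf_fm \<phi>" "e \<in> env (hull M k)" for e \<phi>
    using M that hull_env[OF that(3)] sat_hull[OF EA_universal[OF that(1)]] by (simp add: models_def)
  ultimately show ?thesis by (simp add: models_def)
qed

lemma elemd_hull:
  assumes "Lsem k M" "elemd R" "e \<in> env (hull M k)" shows "R (hull M k) e \<longleftrightarrow> R M e"
proof -
  obtain \<phi> where \<phi>: "wf_fm \<phi>" "qfree \<phi>"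
      "\<And>M e. models M EA \<Longrightarrow> e \<in> env M \<Longrightarrow> R M e \<longleftrightarrow> sat M e \<phi>"
    using assms(2) unfolding elemd_def by blast
  have "models M EA" using assms(1) by (simp add: Lsem_def)
  then show ?thesis
    using \<phi>(3)[OF hull_EA[OF assms(1)] assms(3)] \<phi>(3)[OF _ hull_env[OF assms(3)]] sat_hull[OF \<phi>(2)] by simp
qed

text \<open>Existential relations persist from the hull to \<open>M\<close>, so a tuple that is
  least in \<open>M\<close> stays below all members in the hull. It lies in the hull since its
  entries are definable from it, and its witnesses can be chosen there by
  \<open>defset_select_tuple\<close>.\<close>

lemma hull_Lsem:
  assumes L: "Lsem k M" shows "Lsem k (hull M k)"
proof -
  let ?N = "hull M k"
  have M: "models M EA" using L by (simp add: Lsem_def)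
  have N: "models ?N EA" by (rule hull_EA[OF L])
  have "\<exists>as. least ?N k (Q ?N) as" if Q: "sigt k Q" and ne: "\<exists>xs\<in>tup ?N k. Q ?N xs" for Q
  proof -
    obtain n R where R: "elemd R" "\<And>M e. models M EA \<Longrightarrow> e \<in> env M \<Longrightarrow>
        Q M (map e [0..<k]) \<longleftrightarrow> (\<exists>ws\<in>tup M n. R M (pre ws e))"
      using Q[unfolded sigt_def sigd_def] by blast
    have QM: "Q M xs \<longleftrightarrow> (\<exists>ws\<in>tup M n. R M (pre ws (lenv M xs)))"
      if "models M EA" "xs \<in> tup M k" for M xs
      using R(2)[OF that(1) lenv_env[OF that(1)], of xs] that(2) map_lenv[of xs k M] by (simp add: tup_def)
    have lN: "lenv ?N xs = lenv M xs" for xs by (rule ext) (simp add: lenv_def)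
    have up: "Q M xs" if xs: "xs \<in> tup ?N k" "Q ?N xs" for xs
    proof -
      from xs QM[OF N xs(1)] obtain ws where ws: "ws \<in> tup ?N n" "R ?N (pre ws (lenv ?N xs))" by blast
      have "pre ws (lenv ?N xs) \<in> env ?N"
        using ws(1) lenv_env[OF N] xs(1) by (intro pre_env) (auto simp: tup_def)
      from elemd_hull[OF L R(1) this] ws have "R M (pre ws (lenv M xs))" by (simp add: lN)
      then show ?thesis using QM[OF M hull_tup[OF xs(1)]] hull_tup[OF ws(1)] by blast
    qed
    have "\<exists>xs\<in>tup M k. Q M xs" using ne up hull_tup by blast
    then obtain as where as: "least M k (Q M) as" using L Q unfolding Lsem_def by blast
    then have asA: "as \<in> leasts M k" using Q unfolding leasts_def by blast
    have ast: "as \<in> tup M k" using as by (simp add: least_def)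
    have "as ! i \<in> carrier ?N" if "i < k" for i
      using defset_nth[OF ast that] asA by (auto simp: hull_def)
    then have asN: "as \<in> tup ?N k" using ast by (auto simp: tup_def in_set_conv_nth)
    let ?\<chi> = "\<lambda>M xs ws. R M (pre ws (lenv M xs))"
    \<comment> \<open>Witnesses, then the tuple, then zeros: the environment of \<open>R\<close>
      depends on nothing else.\<close>
    let ?G = "\<lambda>i M e. if i < n then e i else if i - n < k then e i else zr M"
    have eG: "elemf (?G i)" for i
      by (cases "i < n"; cases "i - n < k") (simp_all add: elemf_var elemf_app0)
    have "elemd (\<lambda>M e. R M (\<lambda>i. ?G i M e))" by (rule elemd_subst_all[OF R(1) eG])
    moreover have "(\<lambda>i. ?G i M e) = pre (map e [0..<n]) (lenv M (map (\<lambda>i. e (i + n)) [0..<k]))" for M e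
      by (rule ext) (simp add: pre_def lenv_def)
    ultimately have "sigt2 k n ?\<chi>" unfolding sigt2_def by (intro sigd_elemd) simp
    moreover obtain ws0 where "ws0 \<in> tup M n" "?\<chi> M as ws0"
      using as QM[OF M ast] by (auto simp: least_def)
    ultimately obtain ws where ws: "length ws = n" "set ws \<subseteq> defset M k as" "?\<chi> M as ws"
      using defset_select_tuple[OF M ast, of n ?\<chi>] by blast
    then have wsN: "ws \<in> tup ?N n" using asA by (auto simp: tup_def hull_def)
    have "pre ws (lenv ?N as) \<in> env ?N"
      using wsN lenv_env[OF N] asN by (intro pre_env) (auto simp: tup_def)
    from elemd_hull[OF L R(1) this] ws(3) have "R ?N (pre ws (lenv ?N as))" by (simp add: lN)
    then have "Q ?N as" using QM[OF N asN] wsN by blast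
    moreover have "lexle ?N as bs" if "bs \<in> tup ?N k" "Q ?N bs" for bs
      using as up[OF that] hull_tup[OF that(1)] by (simp add: least_def)
    ultimately show ?thesis using asN unfolding least_def by blast
  qed
  then show ?thesis using N unfolding Lsem_def by blast
qed


subsection \<open>Limits from least tuples\<close>

definition decreasing :: "efun \<Rightarrow> mdl \<Rightarrow> bool" where
  "decreasing h M \<longleftrightarrow> (\<exists>m\<in>carrier M. \<forall>n\<in>carrier M. le M m n \<longrightarrow> le M (interp M h [sc M n]) (interp M h [n]))"

definition converges :: "efun \<Rightarrow> mdl \<Rightarrow> bool" where
  "converges h M \<longleftrightarrow> (\<exists>m\<in>carrier M. \<forall>n\<in>carrier M. le M m n \<longrightarrow> interp M h [n] = interp M h [m])"

lemma least_snoc: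
  assumes "least M (Suc k) P zs"
  shows "\<exists>cs\<in>tup M k. \<exists>d\<in>carrier M. P (cs @ [d]) \<and>
    (\<forall>bs\<in>tup M k. \<forall>b\<in>carrier M. P (bs @ [b]) \<longrightarrow> lexle M (cs @ [d]) (bs @ [b]))"
  using assms unfolding least_def ball_tup_snoc unfolding tup_snoc by blast

lemma Lsem_Suc:
  assumes L: "Lsem (Suc k) M" shows "Lsem k M"
proof -
  have M: "models M EA" using L by (simp add: Lsem_def)
  have "\<exists>as. least M k (Q M) as" if Q: "sigt k Q" "\<exists>xs\<in>tup M k. Q M xs" for Q
  proof -
    \<comment> \<open>The last component is left unconstrained, so the first \<open>k\<close>
      entries of a least tuple here form a least tuple of \<open>Q\<close>.\<close>
    have "sigt (Suc k) (\<lambda>M zs. Q M (butlast zs))"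
      unfolding sigt_def using sigt_leaf[OF Q(1), of "\<lambda>n. n"] by simp
    moreover from Q(2) obtain xs where "xs \<in> tup M k" "Q M xs" by blast
    then have "\<exists>zs\<in>tup M (Suc k). Q M (butlast zs)"
      unfolding bex_tup_snoc using EA_carriers(1)[OF M] by auto
    ultimately obtain zs where "least M (Suc k) (\<lambda>zs. Q M (butlast zs)) zs" using L unfolding Lsem_def by blast
    then obtain cs d where c: "cs \<in> tup M k" "d \<in> carrier M" "Q M cs"
      "\<forall>bs\<in>tup M k. \<forall>b\<in>carrier M. Q M bs \<longrightarrow> lexle M (cs @ [d]) (bs @ [b])"
      using least_snoc[of M k "\<lambda>zs. Q M (butlast zs)" zs] unfolding butlast_snoc by blast
    have "lexle M cs bs" if "bs \<in> tup M k" "Q M bs" for bs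
      using c(4)[rule_format, OF that(1) c(2) that(2)] lexle_snoc[OF M, of cs bs d d] c(1) that(1)
      by (auto simp: tup_def lexle_refl)
    then show ?thesis using c unfolding least_def by blast
  qed
  then show ?thesis using M unfolding Lsem_def by blast
qed

text \<open>By completeness, \<open>dec\<close> is the provability of the premise of the rule at
  stage \<open>k\<close>. It is used for the hull only, so that \<open>m\<close> is
  definable.\<close>

lemma limit_of_least:
  assumes L: "Lsem (Suc k) M" and h: "wf_fun h" "arity h = 1"
    and dec: "\<And>N. Lsem k N \<Longrightarrow> decreasing h N"
  shows "converges h M"
proof -
  let ?h = "\<lambda>x. interp M h [x]"
  have M: "models M EA" using L by (simp add: Lsem_def)
  have hc: "?h x \<in> carrier M" if "x \<in> carrier M" for x using EA_carrier[OF M h(1), of "[x]"] h(2) that by simp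
  have Lk: "Lsem k M" by (rule Lsem_Suc[OF L])
  from dec[OF hull_Lsem[OF Lk]] obtain m where m: "m \<in> carrier (hull M k)"
    "\<forall>n\<in>carrier (hull M k). le M m n \<longrightarrow> le M (?h (sc M n)) (?h n)"
    unfolding decreasing_def by auto
  then obtain as where as: "as \<in> leasts M k" "m \<in> defset M k as" by (auto simp: hull_def)
  then obtain Q \<psi> where Q: "sigt k Q" "least M k (Q M) as" and
    \<psi>: "m \<in> carrier M" "sigt1 k \<psi>" "\<psi> M as m" "\<forall>w\<in>carrier M. \<psi> M as w \<longrightarrow> w = m"
    unfolding leasts_def defset_def by blast
  have ast: "as \<in> tup M k" "Q M as" using Q(2) by (auto simp: least_def)
  \<comment> \<open>An increase of \<open>h\<close> beyond \<open>m\<close> is an existential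
    condition over \<open>as\<close>, once \<open>m\<close> is replaced by its definition. If it
    occurred in \<open>M\<close>, it would occur at an element of the hull, contrary to the choice
    of \<open>m\<close>.\<close>
  have decM: "le M (?h (sc M n)) (?h n)" if n: "n \<in> carrier M" "le M m n" for n
  proof (rule ccontr)
    assume jump: "\<not> le M (?h (sc M n)) (?h n)"
    let ?\<chi> = "\<lambda>M xs n. \<exists>m\<in>carrier M. \<psi> M xs m \<and> le M m n \<and> \<not> le M (interp M h [sc M n]) (interp M h [n])"
    have "sigt1 k ?\<chi>" unfolding sigt1_def
    proof (rule sigd_ex[where Q = "\<lambda>M m e. \<psi> M (map (\<lambda>n. e (Suc n)) [0..<k]) m \<and> le M m (e 0) \<and>
         \<not> le M (interp M h [sc M (e 0)]) (interp M h [e 0])"])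
      show "sigd (\<lambda>M e. \<psi> M (map (\<lambda>n. e (Suc (Suc n))) [0..<k]) (e 0) \<and> le M (e 0) (e (Suc 0)) \<and>
         \<not> le M (interp M h [sc M (e (Suc 0))]) (interp M h [e (Suc 0)]))"
        using h by (intro sigd_and sigt1_leaf[OF \<psi>(2)] sigd_elemd elem_intros) simp_all
    qed
    moreover have "?\<chi> M as n" using \<psi> n jump by blast
    ultimately obtain n' where n': "n' \<in> defset M k as" "?\<chi> M as n'"
      using defset_select[OF M ast(1) _ n(1), of ?\<chi>] by blast
    then have "le M m n'" "\<not> le M (?h (sc M n')) (?h n')" using \<psi>(4) by blast+
    moreover have "n' \<in> carrier (hull M k)" using n'(1) as(1) by (auto simp: hull_def)
    ultimately show False using m(2) by blast
  qed
  \<comment> \<open>Keeping \<open>Q\<close> forces the first \<open>k\<close> entries of the least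
    tuple to be \<open>as\<close>; at \<open>as\<close> the last entry ranges over the values of
    \<open>h\<close> beyond \<open>m\<close>, so it is their minimum.\<close>
  let ?\<theta> = "\<lambda>M xs y. Q M xs \<and> (\<exists>m\<in>carrier M. \<exists>n\<in>carrier M. \<psi> M xs m \<and> le M m n \<and> y = interp M h [n])"
  have "sigt (Suc k) (\<lambda>M zs. ?\<theta> M (butlast zs) (last zs))"
  proof -
    have "sigd (\<lambda>M e. Q M (map e [0..<k]) \<and> (\<exists>m\<in>carrier M. \<exists>n\<in>carrier M. \<psi> M (map e [0..<k]) m \<and>
       le M m n \<and> e k = interp M h [n]))"
    proof (rule sigd_and[OF sigt_leaf[OF Q(1), of "\<lambda>n. n"]],
        rule sigd_ex[where Q = "\<lambda>M m e. \<exists>n\<in>carrier M. \<psi> M (map e [0..<k]) m \<and> le M m n \<and> e k = interp M h [n]"],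
        rule sigd_ex[where Q = "\<lambda>M n e. \<psi> M (map (\<lambda>n. e (Suc n)) [0..<k]) (e 0) \<and> le M (e 0) n \<and>
          e (Suc k) = interp M h [n]"])
      show "sigd (\<lambda>M e. \<psi> M (map (\<lambda>n. e (Suc (Suc n))) [0..<k]) (e (Suc 0)) \<and> le M (e (Suc 0)) (e 0) \<and>
          e (Suc (Suc k)) = interp M h [e 0])"
        using h by (intro sigd_and sigt1_leaf[OF \<psi>(2)] sigd_elemd elem_intros) simp_all
    qed
    then show ?thesis unfolding sigt_def by simp
  qed
  moreover have \<theta>h: "?\<theta> M as (?h n)" if "n \<in> carrier M" "le M m n" for n
    using ast \<psi> that by blast
  have "\<exists>zs\<in>tup M (Suc k). ?\<theta> M (butlast zs) (last zs)"
    unfolding bex_tup_snoc using \<theta>h[OF \<psi>(1) le_refl[OF M \<psi>(1)]] ast(1) hc[OF \<psi>(1)] by auto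
  ultimately obtain zs where "least M (Suc k) (\<lambda>zs. ?\<theta> M (butlast zs) (last zs)) zs"
    using L unfolding Lsem_def by blast
  then obtain cs d where c: "cs \<in> tup M k" "d \<in> carrier M" "?\<theta> M cs d"
    "\<forall>bs\<in>tup M k. \<forall>b\<in>carrier M. ?\<theta> M bs b \<longrightarrow> lexle M (cs @ [d]) (bs @ [b])"
    using least_snoc[of M k "\<lambda>zs. ?\<theta> M (butlast zs) (last zs)" zs] unfolding butlast_snoc last_snoc by blast
  have lx: "lexle M (cs @ [d]) (as @ [?h n])" if "n \<in> carrier M" "le M m n" for n
    using c(4) ast(1) hc[OF that(1)] \<theta>h[OF that] by blast
  have sub: "set cs \<subseteq> carrier M" "set as \<subseteq> carrier M" "length cs = length as"
    using c(1) ast(1) by (auto simp: tup_def)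
  have "lexle M cs as"
    using lx[OF \<psi>(1) le_refl[OF M \<psi>(1)]] lexle_snoc[OF M sub(1,2,3)] by (auto simp: lexle_refl)
  moreover have "lexle M as cs" using Q(2) c(1,3) by (simp add: least_def)
  ultimately have [simp]: "cs = as" using lexle_antisym[OF M c(1) ast(1)] by blast
  have dle: "le M d (?h n)" if "n \<in> carrier M" "le M m n" for n
    using lx[OF that] lexle_snoc[OF M sub(1,2,3), of d "?h n"] M c(2) hc[OF that(1)]
    by (auto simp: lt_le)
  from c(3) \<psi>(4) obtain n0 where n0: "n0 \<in> carrier M" "le M m n0" "d = ?h n0" by auto
  \<comment> \<open>The minimum is attained at \<open>n0\<close>, and \<open>h\<close> cannot rise
    afterwards. The induction is available because the claim with \<open>n0\<close> as parameter is
    quantifier-free, while its step uses \<open>decM\<close>, a fact about this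
    \<open>M\<close>.\<close>
  have "le M n0 n \<longrightarrow> le M (?h n) (?h n0)" if "n \<in> carrier M" for n
  proof -
    let ?Q = "\<lambda>M x p. le M (p 0) x \<longrightarrow> le M (interp M h [x]) (interp M h [p 0])"
    have "?Q M n (lenv M [n0])"
    proof (rule EA_induct[where Q = ?Q, OF _ M _ _ _ that])
      show "elemd (\<lambda>M e. ?Q M (e 0) (\<lambda>n. e (Suc n)))"
        using h by (intro elem_intros) simp_all
      show "lenv M [n0] \<in> env M" using n0(1) by (intro lenv_env[OF M]) simp
      show "?Q M (zr M) (lenv M [n0])" using M n0(1) hc by auto
      fix x assume x: "x \<in> carrier M" "?Q M x (lenv M [n0])"
      have "le M (?h (sc M x)) (?h n0)" if le: "le M n0 (sc M x)"
      proof (cases "n0 = sc M x")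
        case True
        then show ?thesis using M hc[OF n0(1)] by simp
      next
        case False
        then have "le M n0 x" using le M x(1) n0(1) lt_le[of M n0 "sc M x"] by simp
        then have "le M (?h x) (?h n0)" "le M m x" using x le_trans[OF M \<psi>(1) n0(1) x(1) n0(2)] by simp_all
        then show ?thesis using decM[OF x(1)] le_trans[OF M hc[OF EA_carriers(2)[OF M x(1)]] hc[OF x(1)] hc[OF n0(1)]]
          by blast
      qed
      then show "?Q M (sc M x) (lenv M [n0])" by simp
    qed
    then show ?thesis by simp
  qed
  then have "?h n = ?h n0" if "n \<in> carrier M" "le M n0 n" for n
    using that dle[OF that(1) le_trans[OF M \<psi>(1) n0(1) that(1) n0(2) that(2)]] n0(3)
      le_antisym[OF M hc[OF that(1)] hc[OF n0(1)]] by blast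
  then show ?thesis unfolding converges_def using n0(1) by blast
qed


subsection \<open>Least tuples from limits\<close>

text \<open>The rule takes unary symbols only. Since \<open>F\<close> reads index 0 alone, all
  variables of the term can be identified with it.\<close>

lemma elemf_unary_symbol:
  assumes "elemf (\<lambda>M e. F M (e 0))"
  obtains h where "wf_fun h" "arity h = 1"
    "\<And>M x. models M EA \<Longrightarrow> x \<in> carrier M \<Longrightarrow> interp M h [x] = F M x"
proof -
  from assms obtain t where t: "wf_tm t"
    "\<And>M e. models M EA \<Longrightarrow> e \<in> env M \<Longrightarrow> F M (e 0) = eval M e t" unfolding elemf_def by blast
  let ?t = "subst_tm (\<lambda>_. Var 0) t"
  have "wf_tm ?t" "fv_tm ?t \<subseteq> {..<1}" using t(1) by (simp_all add: wf_subst_tm fv_subst_tm_bound)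
  from term_symbol[OF this] obtain h where h: "wf_fun h" "arity h = 1"
    "\<And>(M :: mdl) e. models M EA \<Longrightarrow> e \<in> env M \<Longrightarrow> interp M h (map e [0..<1]) = eval M e ?t" by blast
  have "interp M h [x] = F M x" if "models M EA" "x \<in> carrier M" for M x
  proof -
    have e: "(\<lambda>_. x) \<in> env M" using that by (auto simp: env_def)
    show ?thesis using h(3)[OF that(1) e] t(2)[OF that(1) e] by (simp add: eval_subst_tm)
  qed
  then show ?thesis using that h(1,2) by blast
qed

lemma elemd_lexle_lists: "elemd (\<lambda>M e. lexle M (map e is) (map e js))"
proof (induction "is" js rule: list_induct2')
  case 1
  then show ?case using elemd_not[OF elemd_false] by simp
next
  case (4 i "is" j js)
  then show ?case by (auto intro!: elem_intros)
qed (simp_all add: elemd_false)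

lemma elemd_lexle: "elemd (\<lambda>M e. lexle M (map (\<lambda>n. e (\<rho> n)) [0..<k]) (map (\<lambda>n. e (\<tau> n)) [0..<k]))"
  using elemd_lexle_lists[of "map \<rho> [0..<k]" "map \<tau> [0..<k]"] by (simp add: comp_def)

text \<open>\<open>conv\<close> says that \<open>M\<close> satisfies the conclusions of all
  applications of the rule to premises valid in every model for \<open>k\<close>.\<close>

lemma least_of_limits:
  assumes L: "Lsem k M"
    and conv: "\<And>h. wf_fun h \<Longrightarrow> arity h = 1 \<Longrightarrow> (\<And>N. Lsem k N \<Longrightarrow> decreasing h N) \<Longrightarrow> converges h M"
    and Q: "sigt (Suc k) Q" and ne: "\<exists>xs\<in>tup M (Suc k). Q M xs"
  shows "\<exists>as. least M (Suc k) (Q M) as"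
proof -
  have MEA: "models M EA" using L by (simp add: Lsem_def)
  define X where "X = (\<lambda>M xs y. Q M (xs @ [y]))"
  have eX: "sigt1 k X"
  proof -
    have "map (\<lambda>n. e (if n < k then Suc n else 0)) [0..<Suc k] = map (\<lambda>n. e (Suc n)) [0..<k] @ [e 0]"
      for e :: "nat \<Rightarrow> elt" by simp
    then show ?thesis
      using sigd_ren[OF Q[unfolded sigt_def], of "\<lambda>i. if i < k then Suc i else 0"]
      unfolding sigt1_def X_def by (simp only:)
  qed
  obtain B where B: "elemd (\<lambda>M e. B M (e 0) (\<lambda>n. e (Suc n)))"
    "\<And>M e. models M EA \<Longrightarrow> e \<in> env M \<Longrightarrow>
      X M (map (\<lambda>n. e (Suc n)) [0..<k]) (e 0) \<longleftrightarrow> (\<exists>u\<in>carrier M. B M u e)"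
    "\<And>M e u v. models M EA \<Longrightarrow> e \<in> env M \<Longrightarrow> u \<in> carrier M \<Longrightarrow> v \<in> carrier M \<Longrightarrow> B M u e \<Longrightarrow> le M u v \<Longrightarrow> B M v e"
    using sigd_bounded[OF eX[unfolded sigt1_def]] by blast
  \<comment> \<open>Here \<open>n\<close> is the stage of the search: by stage \<open>n\<close> the
    pair of \<open>xs\<close> and \<open>y\<close> has been certified.\<close>
  define T where "T = (\<lambda>M n xs y. B M n (case_nat y (lenv M xs)))"
  have envT: "case_nat y (lenv M xs) \<in> env M" if "models M EA" "xs \<in> tup M k" "y \<in> carrier M" for M xs y
    using that lenv_env[OF that(1), of xs] by (simp add: tup_def)
  have XT: "X M xs y \<longleftrightarrow> (\<exists>u\<in>carrier M. T M u xs y)" if "models M EA" "xs \<in> tup M k" "y \<in> carrier M" for M xs y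
    using B(2)[OF that(1) envT[OF that]] map_lenv[OF tup_length[OF that(2)]] by (simp add: T_def)
  have Tmono: "T M v xs y" if "models M EA" "xs \<in> tup M k" "y \<in> carrier M" "u \<in> carrier M" "v \<in> carrier M"
      "T M u xs y" "le M u v" for M xs y u v
    using B(3)[OF that(1) envT[OF that(1-3)] that(4,5)] that(6,7) by (simp add: T_def)
  have eT: "elemd (\<lambda>M e. T M (e i) (map (\<lambda>n. e (\<rho> n)) [0..<k]) (e j))" for i j \<rho>
  proof -
    let ?G = "case_nat (\<lambda>M e. e i) (case_nat (\<lambda>M e. e j) (\<lambda>n M e. if n < k then e (\<rho> n) else zr M))"
    have eG: "elemf (?G n)" for n
    proof (cases n)
      case (Suc m)
      then show ?thesis by (cases m; cases "m \<le> k") (simp_all add: elemf_var elemf_app0)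
    qed (simp add: elemf_var)
    have "(\<lambda>n. ?G (Suc n) M e) = case_nat (e j) (lenv M (map (\<lambda>n. e (\<rho> n)) [0..<k]))" for M e
      by (rule ext) (simp add: lenv_def split: nat.split)
    then show ?thesis using elemd_subst_all[OF B(1), of ?G, OF eG] by (simp add: T_def)
  qed
  \<comment> \<open>At stage \<open>n\<close>, \<open>y\<close> accompanies the lexicographically
    least tuple among the pairs certified with all entries below \<open>n\<close>. The bounds on the
    entries keep the relation elementary.\<close>
  define W where "W = (\<lambda>M n y. \<exists>xs\<in>tup M k. blt M n xs \<and> T M n xs y \<and>
    \<not> (\<exists>xs'\<in>tup M k. blt M n xs' \<and> (\<exists>y'\<in>carrier M. lt M y' n \<and> T M n xs' y' \<and> \<not> lexle M xs xs')))"
  have eW: "elemd (\<lambda>M e. W M (e i) (e j))" for i j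
    unfolding W_def
  proof (rule elemd_btup[where G = "\<lambda>M e. e i" and Q = "\<lambda>M xs e. T M (e i) xs (e j) \<and>
      \<not> (\<exists>xs'\<in>tup M k. blt M (e i) xs' \<and> (\<exists>y'\<in>carrier M. lt M y' (e i) \<and> T M (e i) xs' y' \<and> \<not> lexle M xs xs'))"],
      rule elemd_and, use eT[where \<rho> = "\<lambda>n. n"] in blast, rule elemd_not,
      rule elemd_btup[where G = "\<lambda>M e. e (i + k)" and Q = "\<lambda>M xs' e. \<exists>y'\<in>carrier M. lt M y' (e (i + k)) \<and>
        T M (e (i + k)) xs' y' \<and> \<not> lexle M (map e [0..<k]) xs'"],
      rule elemd_bex[where G = "\<lambda>M e. e (i + k + k)" and Q = "\<lambda>M y' e. T M (e (i + k + k)) (map e [0..<k]) y' \<and>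
        \<not> lexle M (map (\<lambda>n. e (n + k)) [0..<k]) (map e [0..<k])"])
    show "elemd (\<lambda>M e. T M (e (Suc (i + k + k))) (map (\<lambda>n. e (Suc n)) [0..<k]) (e 0) \<and>
        \<not> lexle M (map (\<lambda>n. e (Suc (n + k))) [0..<k]) (map (\<lambda>n. e (Suc n)) [0..<k]))"
      by (intro elemd_and elemd_not eT elemd_lexle)
  qed (rule elemf_var)+
  \<comment> \<open>If no pair has been found then every \<open>z\<close> passes, and the search for
    \<open>z\<close> returns zero: the default value where the relation is empty.\<close>
  define H where "H = (\<lambda>M n z. W M n z \<or> \<not> (\<exists>y\<in>carrier M. lt M y n \<and> W M n y))"
  have eH: "elemd (\<lambda>M e. H M (e (Suc 0)) (e 0))"
    unfolding H_def
    by (intro elemd_or elemd_not eW elemd_bex[where Q = "\<lambda>M y e. W M (e (Suc 0)) y"] elemf_var)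
  obtain S where S: "elemf (\<lambda>M e. S M (e 0) (\<lambda>n. e (Suc n)))"
    "\<And>M x p. models M EA \<Longrightarrow> x \<in> carrier M \<Longrightarrow> p \<in> env M \<Longrightarrow> S M x p \<in> carrier M \<and> le M (S M x p) x"
    "\<And>M x p. models M EA \<Longrightarrow> x \<in> carrier M \<Longrightarrow> p \<in> env M \<Longrightarrow> S M x p = x \<or> H M (p 0) (S M x p)"
    "\<And>M x p z. models M EA \<Longrightarrow> x \<in> carrier M \<Longrightarrow> p \<in> env M \<Longrightarrow> z \<in> carrier M \<Longrightarrow>
       lt M z (S M x p) \<Longrightarrow> \<not> H M (p 0) z"
    using bounded_search[where Q = "\<lambda>M z p. H M (p 0) z", OF eH] by blast
  \<comment> \<open>The stage acts both as the bound of the search and as its parameter.\<close>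
  have "elemf (\<lambda>M e. S M (e 0) (\<lambda>_. e 0))"
    using elemf_sub[where F = S and \<rho> = "\<lambda>_. 0", OF S(1) elemf_var] .
  from elemf_unary_symbol[where F = "\<lambda>M x. S M x (\<lambda>_. x)", OF this] obtain h where
    h: "wf_fun h" "arity h = 1" "\<And>M x. models M EA \<Longrightarrow> x \<in> carrier M \<Longrightarrow> interp M h [x] = S M x (\<lambda>_. x)" by blast
  have h1: "interp M h [x] \<in> carrier M" "le M (interp M h [x]) x"
    "interp M h [x] = x \<or> H M x (interp M h [x])"
    "\<And>z. z \<in> carrier M \<Longrightarrow> lt M z (interp M h [x]) \<Longrightarrow> \<not> H M x z"
    if "models M EA" "x \<in> carrier M" for M x
  proof -
    have p: "(\<lambda>_. x) \<in> env M" using that by (auto simp: env_def)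
    show "interp M h [x] \<in> carrier M" "le M (interp M h [x]) x" "interp M h [x] = x \<or> H M x (interp M h [x])"
      "\<And>z. z \<in> carrier M \<Longrightarrow> lt M z (interp M h [x]) \<Longrightarrow> \<not> H M x z"
      unfolding h(3)[OF that] using S(2-4)[OF that p] by blast+
  qed
  \<comment> \<open>Formulated for an arbitrary \<open>N\<close>: it yields the premise of the rule
    in all models for \<open>k\<close>, and afterwards identifies the limit in
    \<open>M\<close>.\<close>
  have stable: "\<exists>as n0. least N k (\<lambda>xs. \<exists>y\<in>carrier N. X N xs y) as \<and> n0 \<in> carrier N \<and>
      (\<forall>n\<in>carrier N. le N n0 n \<longrightarrow> T N n as (interp N h [n]) \<and>
         (\<forall>y\<in>carrier N. T N n as y \<longrightarrow> le N (interp N h [n]) y))"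
    if N: "Lsem k N" and ex: "\<exists>xs\<in>tup N k. \<exists>y\<in>carrier N. X N xs y" for N
  proof -
    have NEA: "models N EA" using N by (simp add: Lsem_def)
    have "sigt k (\<lambda>M xs. \<exists>y\<in>carrier M. X M xs y)" unfolding sigt_def
      by (rule sigd_ex[where Q = "\<lambda>M y e. X M (map e [0..<k]) y"]) (rule sigt1_leaf[OF eX])
    then obtain as where as: "least N k (\<lambda>xs. \<exists>y\<in>carrier N. X N xs y) as"
      using N ex unfolding Lsem_def by blast
    then have ast: "as \<in> tup N k" by (simp add: least_def)
    from as obtain y0 where y0: "y0 \<in> carrier N" "X N as y0" by (auto simp: least_def)
    then obtain u0 where u0: "u0 \<in> carrier N" "T N u0 as y0" using XT[OF NEA ast] by blast
    have "set (y0 # as) \<subseteq> carrier N" using y0 ast by (simp add: tup_def)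
    from ex_blt[OF NEA this] obtain u1 where u1: "u1 \<in> carrier N" "blt N u1 (y0 # as)" by blast
    \<comment> \<open>From here on one pair over \<open>as\<close> is certified, by
      \<open>u0\<close>, and all its entries are below the stage, by \<open>u1\<close>. Thus
      \<open>as\<close> takes part in the search and, being least, wins it.\<close>
    let ?n0 = "ad N u0 u1"
    have n0: "?n0 \<in> carrier N" using u0 u1 NEA by simp
    have "T N n as (interp N h [n]) \<and> (\<forall>y\<in>carrier N. T N n as y \<longrightarrow> le N (interp N h [n]) y)"
      if n: "n \<in> carrier N" "le N ?n0 n" for n
    proof -
      have "le N u0 n" using le_trans[OF NEA u0(1) n0 n(1) _ n(2)] NEA u0 u1 by simp
      then have Tn: "T N n as y0" using Tmono[OF NEA ast y0(1) u0(1) n(1) u0(2)] by simp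
      have "le N u1 n" using le_trans[OF NEA u1(1) n0 n(1) _ n(2)] NEA u0 u1 by simp
      then have bl: "blt N n (y0 # as)"
        using blt_mono[OF NEA \<open>set (y0 # as) \<subseteq> carrier N\<close> u1(1) n(1) u1(2)] by simp
      then have bl: "lt N y0 n" "blt N n as" by (simp_all add: blt_def)
      have least: "lexle N as xs" if "xs \<in> tup N k" "y \<in> carrier N" "T N n xs y" for xs y
        using as XT[OF NEA that(1,2)] that n(1) unfolding least_def by blast
      have WT: "W N n y \<longleftrightarrow> T N n as y" if y: "y \<in> carrier N" for y
      proof
        assume "W N n y"
        then obtain xs where xs: "xs \<in> tup N k" "T N n xs y"
          "\<not> (\<exists>xs'\<in>tup N k. blt N n xs' \<and> (\<exists>y'\<in>carrier N. lt N y' n \<and> T N n xs' y' \<and> \<not> lexle N xs xs'))"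
          unfolding W_def by blast
        then have "lexle N xs as" using ast bl Tn y0(1) by blast
        then have "xs = as" using least[OF xs(1) y xs(2)] lexle_antisym[OF NEA xs(1) ast] by blast
        then show "T N n as y" using xs(2) by simp
      next
        assume "T N n as y"
        then show "W N n y" unfolding W_def using ast bl least by blast
      qed
      let ?d = "interp N h [n]"
      note h2 = h1[OF NEA n(1)]
      have exW: "\<exists>y\<in>carrier N. lt N y n \<and> W N n y" using y0(1) bl Tn WT by blast
      then have HW: "H N n z \<longleftrightarrow> W N n z" for z unfolding H_def by blast
      have min: "le N ?d y" if "y \<in> carrier N" "T N n as y" for y
      proof (rule ccontr)
        assume "\<not> le N ?d y"
        then have "lt N y ?d" using lt_iff[OF NEA that(1) h2(1)] by simp
        then show False using h2(4)[OF that(1)] HW WT that by blast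
      qed
      have "?d \<noteq> n" using min[OF y0(1) Tn] bl(1) lt_iff[OF NEA y0(1) n(1)] by auto
      then have "T N n as ?d" using h2(1,3) HW WT by blast
      then show ?thesis using min by blast
    qed
    then show ?thesis using as n0 by blast
  qed
  \<comment> \<open>The premise is needed in every model for \<open>k\<close>, so also where the
    relation is empty; there \<open>h\<close> is constantly zero.\<close>
  have "decreasing h N" if N: "Lsem k N" for N
  proof (cases "\<exists>xs\<in>tup N k. \<exists>y\<in>carrier N. X N xs y")
    case True
    have NEA: "models N EA" using N by (simp add: Lsem_def)
    from stable[OF N True] obtain as n0 where as: "as \<in> tup N k" "n0 \<in> carrier N"
      "\<And>n. n \<in> carrier N \<Longrightarrow> le N n0 n \<Longrightarrow> T N n as (interp N h [n])"
      "\<And>n y. n \<in> carrier N \<Longrightarrow> le N n0 n \<Longrightarrow> y \<in> carrier N \<Longrightarrow> T N n as y \<Longrightarrow> le N (interp N h [n]) y"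
      unfolding least_def by blast
    have "le N (interp N h [sc N n]) (interp N h [n])" if n: "n \<in> carrier N" "le N n0 n" for n
    proof -
      have s: "sc N n \<in> carrier N" using NEA n by simp
      have le: "le N n (sc N n)" using NEA n(1) lt_le[OF NEA n(1) s] by simp
      \<comment> \<open>The value chosen at stage \<open>n\<close> is still a candidate at the next
        stage, so the new minimum cannot exceed it.\<close>
      have "T N (sc N n) as (interp N h [n])"
        using Tmono[OF NEA as(1) h1(1)[OF NEA n(1)] n(1) s as(3)[OF n] le] .
      then show ?thesis
        using as(4)[OF s le_trans[OF NEA as(2) n(1) s n(2) le] h1(1)[OF NEA n(1)]] by blast
    qed
    then show ?thesis unfolding decreasing_def using as(2) by blast
  next
    case False
    have NEA: "models N EA" using N by (simp add: Lsem_def)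
    have h0: "interp N h [n] = zr N" if n: "n \<in> carrier N" for n
    proof (rule ccontr)
      assume nz: "interp N h [n] \<noteq> zr N"
      have "lt N (zr N) (interp N h [n])" using h1(1)[OF NEA n] nz NEA lt_le[of N "zr N"] by simp
      then have "\<not> H N n (zr N)" using h1(4)[OF NEA n] NEA by simp
      moreover have "\<not> W N n y" if "y \<in> carrier N" for y
        using False XT[OF NEA _ that] n that unfolding W_def by blast
      ultimately show False unfolding H_def by blast
    qed
    have "le N (interp N h [sc N n]) (interp N h [n])" if "n \<in> carrier N" for n
      using h0 that NEA by simp
    then show ?thesis unfolding decreasing_def using EA_carriers(1)[OF NEA] by blast
  qed
  from conv[OF h(1,2) this] obtain m where m: "m \<in> carrier M"
    "\<And>n. n \<in> carrier M \<Longrightarrow> le M m n \<Longrightarrow> interp M h [n] = interp M h [m]"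
    unfolding converges_def by blast
  from ne have "\<exists>xs\<in>tup M k. \<exists>y\<in>carrier M. X M xs y" unfolding bex_tup_snoc X_def .
  from stable[OF L this] obtain as n0 where as: "least M k (\<lambda>xs. \<exists>y\<in>carrier M. X M xs y) as" "n0 \<in> carrier M"
      "\<And>n. n \<in> carrier M \<Longrightarrow> le M n0 n \<Longrightarrow> T M n as (interp M h [n])"
      "\<And>n y. n \<in> carrier M \<Longrightarrow> le M n0 n \<Longrightarrow> y \<in> carrier M \<Longrightarrow> T M n as y \<Longrightarrow> le M (interp M h [n]) y"
    by blast
  have ast: "as \<in> tup M k" using as(1) by (simp add: least_def)
  \<comment> \<open>\<open>?N\<close> lies beyond the point where \<open>h\<close> becomes constant
    and beyond the point where the search has settled on \<open>as\<close>, so the limit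
    \<open>?d\<close> is a certified companion of \<open>as\<close>.\<close>
  let ?d = "interp M h [m]" and ?N = "ad M m n0"
  have N: "?N \<in> carrier M" "le M m ?N" "le M n0 ?N" using MEA m(1) as(2) by simp_all
  have d: "?d \<in> carrier M" using h1(1)[OF MEA m(1)] .
  have "T M ?N as ?d" using as(3)[OF N(1,3)] m(2)[OF N(1,2)] by simp
  then have Xd: "X M as ?d" using XT[OF MEA ast d] N(1) by blast
  have "lexle M (as @ [?d]) (bs @ [b])" if b: "bs \<in> tup M k" "b \<in> carrier M" "X M bs b" for bs b
  proof -
    have 1: "lexle M as bs" using as(1) b unfolding least_def by blast
    have "?d = b \<or> lt M ?d b" if eq: "as = bs"
    proof -
      obtain u where u: "u \<in> carrier M" "T M u as b" using XT[OF MEA b(1,2)] b(3) eq by blast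
      \<comment> \<open>Late enough for the competitor \<open>b\<close> to be certified, while
        \<open>h\<close> already has its limit value.\<close>
      let ?n = "ad M ?N u"
      have n: "?n \<in> carrier M" "le M ?N ?n" "le M u ?n" using MEA N u(1) by simp_all
      have "T M ?n as b" using Tmono[OF MEA ast b(2) u(1) n(1) u(2) n(3)] .
      moreover have "le M n0 ?n" "le M m ?n"
        using le_trans[OF MEA as(2) N(1) n(1) N(3) n(2)] le_trans[OF MEA m(1) N(1) n(1) N(2) n(2)] by blast+
      ultimately have "le M ?d b" using as(4)[OF n(1) _ b(2)] m(2)[OF n(1)] by simp
      then show ?thesis using lt_le[OF MEA d b(2)] by blast
    qed
    then show ?thesis
      using 1 lexle_snoc[OF MEA, of as bs ?d b] ast b(1) by (simp add: tup_def)
  qed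
  then have "least M (Suc k) (Q M) (as @ [?d])"
    unfolding least_def ball_tup_snoc using ast d Xd unfolding X_def tup_snoc by blast
  then show ?thesis ..
qed

lemma Lsem_Suc_of_limits:
  assumes "Lsem k M"
    and "\<And>h. wf_fun h \<Longrightarrow> arity h = 1 \<Longrightarrow> (\<And>N. Lsem k N \<Longrightarrow> decreasing h N) \<Longrightarrow> converges h M"
  shows "Lsem (Suc k) M"
  unfolding Lsem_def
proof (intro conjI allI impI)
  show "models M EA" using assms(1) by (simp add: Lsem_def)
qed (rule least_of_limits[OF assms])


subsection \<open>Models of the limit rule\<close>

lemma derives_theorems: "{\<psi>. T \<turnstile> \<psi>} \<turnstile> \<phi> \<Longrightarrow> T \<turnstile> \<phi>"
  by (induction rule: derives.induct) (auto intro: derives.intros)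

text \<open>Each stage is by definition the set of theorems of some axioms, and deriving from
  theorems yields nothing new.\<close>

lemma LimR_closed: "LimR k \<turnstile> \<phi> \<longleftrightarrow> \<phi> \<in> LimR k"
proof -
  obtain T where T: "LimR k = {\<psi>. T \<turnstile> \<psi>}" by (cases k) auto
  show ?thesis unfolding T by (auto intro: derives_theorems derives.Ax dest: derives_wf)
qed

lemma models_theorems: "models M {\<psi>. T \<turnstile> \<psi>} \<longleftrightarrow> models M T"
  using soundness[of T _ M] derives.Ax[of _ T] by (auto simp: models_def)

lemma sat_lim_premise: "sat M e (lim_premise h) \<longleftrightarrow> decreasing h M" for M :: mdl
  by (simp add: lim_premise_def decreasing_def le_def)

lemma sat_lim_conclusion: "sat M e (lim_conclusion h) \<longleftrightarrow> converges h M" for M :: mdl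
  by (simp add: lim_conclusion_def converges_def le_def)

lemma models_env: "models M T \<Longrightarrow> \<exists>e. e \<in> env M"
  by (auto simp: models_def wf_struct_def env_def)

lemma theorem_iff_models:
  assumes "wf_fm \<phi>" shows "T \<turnstile> \<phi> \<longleftrightarrow> (\<forall>M :: mdl. models M T \<longrightarrow> (\<forall>e\<in>env M. sat M e \<phi>))"
  using soundness completeness[OF assms] by blast

text \<open>The induction treats all models at once: provability of a premise at stage
  \<open>k\<close> refers to every model of that stage, not just to \<open>M\<close>.\<close>

lemma models_LimR: "models M (LimR k) \<longleftrightarrow> Lsem k M"
proof (induction k arbitrary: M)
  case 0
  \<comment> \<open>The empty tuple is the only one of length 0, so the schema holds trivially and
    both sides are models of \<open>EA\<close>.\<close>
  have "least M 0 (Q M) []" if "Q M []" for Q using that by (simp add: least_def)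
  then show ?case by (auto simp: models_theorems Lsem_def)
next
  case (Suc k)
  \<comment> \<open>Completeness and the induction hypothesis turn membership of the premise into
    the hypothesis on \<open>h\<close> of the two preceding subsections.\<close>
  have prem: "lim_premise h \<in> LimR k \<longleftrightarrow> (\<forall>N. Lsem k N \<longrightarrow> decreasing h N)" if h: "wf_fun h" "arity h = 1" for h
  proof -
    have "wf_fm (lim_premise h)" using h by (simp add: lim_premise_def)
    from theorem_iff_models[OF this, of "LimR k"] show ?thesis
      unfolding LimR_closed Suc.IH sat_lim_premise using models_env[of _ "LimR k"] Suc.IH by blast
  qed
  have "models M (LimR (Suc k)) \<longleftrightarrow> models M (LimR k) \<and>
      (\<forall>h. wf_fun h \<longrightarrow> arity h = 1 \<longrightarrow> lim_premise h \<in> LimR k \<longrightarrow> converges h M)"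
  proof -
    have wf: "wf_fm (lim_conclusion h)" if "wf_fun h" "arity h = 1" for h
      using that by (simp add: lim_conclusion_def)
    have "models M (LimR (Suc k)) \<longleftrightarrow> models M (LimR k \<union>
        {lim_conclusion h | h. wf_fun h \<and> arity h = 1 \<and> lim_premise h \<in> LimR k})"
      by (simp only: LimR.simps models_theorems)
    also have "\<dots> \<longleftrightarrow> models M (LimR k) \<and>
      (\<forall>h. wf_fun h \<longrightarrow> arity h = 1 \<longrightarrow> lim_premise h \<in> LimR k \<longrightarrow> converges h M)"
    proof
      assume *: "models M (LimR k \<union> {lim_conclusion h | h. wf_fun h \<and> arity h = 1 \<and> lim_premise h \<in> LimR k})"
      then obtain e where e: "e \<in> env M" using models_env by blast
      have "converges h M" if "wf_fun h" "arity h = 1" "lim_premise h \<in> LimR k" for h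
        using * that wf e unfolding models_def sat_lim_conclusion[of M e, symmetric] by blast
      then show "models M (LimR k) \<and>
        (\<forall>h. wf_fun h \<longrightarrow> arity h = 1 \<longrightarrow> lim_premise h \<in> LimR k \<longrightarrow> converges h M)"
        using models_mono[OF *] by blast
    qed (auto simp: models_def sat_lim_conclusion)
    finally show ?thesis .
  qed
  also have "\<dots> \<longleftrightarrow> Lsem (Suc k) M"
    unfolding Suc.IH using prem limit_of_least[of k M] Lsem_Suc[of k M] Lsem_Suc_of_limits[of k M] by metis
  finally show ?case .
qed

theorem theoremA1:
  fixes k :: nat and \<phi> :: fm
  assumes "sentence \<phi>"
  shows "\<phi> \<in> LimR k \<longleftrightarrow> LSigma1 k \<turnstile> \<phi>"
proof -
  have "wf_fm \<phi>" using assms by (simp add: sentence_def)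
  then show ?thesis
    unfolding LimR_closed[symmetric] by (simp add: theorem_iff_models models_LimR models_LSigma1)
qed

end
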